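(* Let $\{u_0^\nu\}_{\nu}\subset L^2(\mathbb{T}^2)$ be a strongly compact sequence of divergence-free vector fields and let $\{u^\nu\}_{\nu}$ be the corresponding sequence of Leray--Hopf solutions to the two-dimensional Navier--Stokes equations with viscosity $\nu$ on $\mathbb{T}^2\times[0,T)$. For $\ell>0$ let $$S^\nu_2(\ell):= \int_0^T \frac{1}{|B_\ell(0)|}\int_{B_{\ell}(0)}\|u^\nu (\cdot + y, t) - u^\nu(\cdot, t)\|_{L^2(\mathbb{T}^2)}^2 \, dy\,dt.$$ Then $$\lim_{\nu\rightarrow 0} S^\nu_2(\sqrt{\nu})=0 \qquad \Longleftrightarrow \qquad \lim_{\nu\rightarrow 0} \nu \int_0^T \|\nabla u^\nu (t)\|^2_{L^2(\mathbb{T}^2)}\,dt=0.$$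
   Context: $\mathbb{T}^2$ is the two-dimensional flat torus and $T>0$. The Navier--Stokes equations are $$\partial_t u^\nu +\operatorname{div} (u^\nu \otimes u^\nu) +\nabla p^\nu=\nu \Delta u^\nu,\qquad \operatorname{div} u^\nu=0,\qquad u^\nu(\cdot,0)=u_0^\nu .$$ For $\nu>0$ and divergence-free $u_0^\nu\in L^2(\mathbb{T}^2)$, the Leray--Hopf solution is the (unique) weak solution $u^\nu\in L^\infty([0,T];L^2(\mathbb{T}^2))\cap L^2([0,T];H^1(\mathbb{T}^2))$; it is global, smooth for $t>0$, and satisfies $\frac12\|u^\nu(t)\|_{L^2}^2+\nu\int_0^t\|\nabla u^\nu(s)\|_{L^2}^2ds=\frac12\|u_0^\nu\|_{L^2}^2$ for all $t$. Families are indexed by viscosities $\nu$ in a fixed set of positive numbers accumulating at $0$ (for instance a sequence), and limits $\nu\to 0$ are along this set. "Strongly compact" means relatively compact in the norm topology. $B_\ell(0)$ is the disk of radius $\ell$ centered at the origin. *)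

theory Defs
  imports "HOL-Analysis.Analysis"
begin

text \<open>
  The torus is \<open>\<real>\<^sup>2 / \<int>\<^sup>2\<close>: functions on it are \<open>\<int>\<^sup>2\<close>-periodic functions on \<open>\<real>\<^sup>2\<close>, integrated
  over the unit cell. Elements of \<open>L\<^sup>2\<close> are given by Borel representatives.
\<close>

definition periodic :: "(real^2 \<Rightarrow> 'b) \<Rightarrow> bool" where
  "periodic f \<longleftrightarrow> (\<forall>x k. (\<forall>i. k $ i \<in> \<int>) \<longrightarrow> f (x + k) = f x)"

definition cell :: "(real^2) set" where
  "cell = {x. \<forall>i. 0 \<le> x $ i \<and> x $ i < 1}"

definition L2 :: "(real^2 \<Rightarrow> 'b::euclidean_space) set" where
  "L2 = {f. periodic f \<and> f \<in> borel_measurable borel \<and>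
            set_integrable lborel cell (\<lambda>x. (norm (f x))\<^sup>2)}"

definition L2norm :: "(real^2 \<Rightarrow> 'b::euclidean_space) \<Rightarrow> real" where
  "L2norm f = sqrt (LINT x:cell|lborel. (norm (f x))\<^sup>2)"

text \<open>
  On representatives the \<open>L\<^sup>2\<close> norm is only a seminorm, so this topology is not Hausdorff; its
  Kolmogorov quotient is the norm topology on classes modulo a.e. equality, and passing to the
  quotient neither creates nor destroys relative compactness.
\<close>

definition L2_topology :: "(real^2 \<Rightarrow> 'b::euclidean_space) topology" where
  "L2_topology = topology_generated_by
     {{g \<in> L2. L2norm (\<lambda>x. g x - f x) < e} | f e. f \<in> L2 \<and> e > 0}"

definition strongly_compact :: "(real^2 \<Rightarrow> 'b::euclidean_space) set \<Rightarrow> bool" where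
  "strongly_compact F \<longleftrightarrow> F \<subseteq> L2 \<and> compactin L2_topology (L2_topology closure_of F)"

primrec Ck_on :: "nat \<Rightarrow> 'a::real_normed_vector set \<Rightarrow> ('a \<Rightarrow> 'b::real_normed_vector) \<Rightarrow> bool" where
  "Ck_on 0 S f \<longleftrightarrow> continuous_on S f"
| "Ck_on (Suc n) S f \<longleftrightarrow> (\<forall>x\<in>S. f differentiable (at x)) \<and>
     (\<forall>v. Ck_on n S (\<lambda>x. frechet_derivative f (at x) v))"

text \<open>Meant for open sets only, since derivatives are taken at \<open>at x\<close>.\<close>

definition smooth_on :: "'a::real_normed_vector set \<Rightarrow> ('a \<Rightarrow> 'b::real_normed_vector) \<Rightarrow> bool" where
  "smooth_on S f \<longleftrightarrow> (\<forall>n. Ck_on n S f)"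

definition pd :: "2 \<Rightarrow> (real^2 \<Rightarrow> 'b::real_normed_vector) \<Rightarrow> real^2 \<Rightarrow> 'b" where
  "pd j f x = frechet_derivative f (at x) (axis j 1)"

definition divergence :: "(real^2 \<Rightarrow> real^2) \<Rightarrow> real^2 \<Rightarrow> real" where
  "divergence f x = (\<Sum>j\<in>UNIV. pd j f x $ j)"

definition laplacian :: "(real^2 \<Rightarrow> 'b::real_normed_vector) \<Rightarrow> real^2 \<Rightarrow> 'b" where
  "laplacian f x = (\<Sum>j\<in>UNIV. pd j (pd j f) x)"

definition divergence_free :: "(real^2 \<Rightarrow> real^2) \<Rightarrow> bool" where
  "divergence_free v \<longleftrightarrow>
     (\<forall>\<psi> :: real^2 \<Rightarrow> real. smooth_on UNIV \<psi> \<and> periodic \<psi> \<longrightarrow>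
        (LINT x:cell|lborel. (\<Sum>j\<in>UNIV. v x $ j * pd j \<psi> x)) = 0)"

definition has_weak_gradient :: "(real^2 \<Rightarrow> real^2) \<Rightarrow> (real^2 \<Rightarrow> real^2^2) \<Rightarrow> bool" where
  "has_weak_gradient v G \<longleftrightarrow> v \<in> L2 \<and> G \<in> L2 \<and>
     (\<forall>\<psi> :: real^2 \<Rightarrow> real. smooth_on UNIV \<psi> \<and> periodic \<psi> \<longrightarrow>
        (\<forall>i j. (LINT x:cell|lborel. v x $ i * pd j \<psi> x) = - (LINT x:cell|lborel. G x $ i $ j * \<psi> x)))"

text \<open>
  A weak gradient is unique up to null sets, so its \<open>L\<^sup>2\<close> norm does not depend on the choice made
  by \<open>SOME\<close>. The norm of \<open>real^2^2\<close> is the Frobenius norm.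
\<close>

definition weak_gradient :: "(real^2 \<Rightarrow> real^2) \<Rightarrow> real^2 \<Rightarrow> real^2^2" where
  "weak_gradient v = (SOME G. has_weak_gradient v G)"

definition Linf_L2 :: "real \<Rightarrow> (real \<Rightarrow> real^2 \<Rightarrow> real^2) \<Rightarrow> bool" where
  "Linf_L2 T u \<longleftrightarrow>
     set_borel_measurable borel ({0..<T} \<times> UNIV) (\<lambda>(t, x). u t x) \<and>
     (\<exists>C. AE t in lborel. t \<in> {0..<T} \<longrightarrow> u t \<in> L2 \<and> L2norm (u t) \<le> C)"

text \<open>
  The condition that \<open>u\<close> itself be square integrable in time is part of \<open>Linf_L2\<close>, with which this
  is always combined.
\<close>

definition L2_H1 :: "real \<Rightarrow> (real \<Rightarrow> real^2 \<Rightarrow> real^2) \<Rightarrow> bool" where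
  "L2_H1 T u \<longleftrightarrow>
     (\<exists>G. set_borel_measurable borel ({0..<T} \<times> UNIV) (\<lambda>(t, x). G t x) \<and>
          (AE t in lborel. t \<in> {0..<T} \<longrightarrow> has_weak_gradient (u t) (G t)) \<and>
          set_integrable lborel ({0..<T} \<times> cell) (\<lambda>(t, x). (norm (G t x))\<^sup>2))"

text \<open>
  Divergence-free elements of \<open>C\<^sub>c\<^sup>\<infinity>([0,T) \<times> \<real>\<^sup>2/\<int>\<^sup>2)\<close>; they need not vanish at time \<open>0\<close>, and are
  given together with a smooth extension to negative times.
\<close>

definition test_field :: "real \<Rightarrow> (real \<Rightarrow> real^2 \<Rightarrow> real^2) \<Rightarrow> bool" where
  "test_field T \<phi> \<longleftrightarrow> smooth_on UNIV (\<lambda>(t, x). \<phi> t x) \<and>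
     (\<forall>t. periodic (\<phi> t)) \<and> (\<forall>t x. divergence (\<phi> t) x = 0) \<and>
     (\<exists>T'<T. \<forall>t\<ge>T'. \<forall>x. \<phi> t x = 0)"

text \<open>
  The pressure is eliminated by testing with divergence-free fields. The three terms under the
  space-time integral are \<open>u \<cdot> \<partial>\<^sub>t\<phi>\<close>, \<open>(u \<otimes> u) : \<nabla>\<phi>\<close> and \<open>\<nu> u \<cdot> \<Delta>\<phi>\<close>.
\<close>

definition weak_solution ::
    "real \<Rightarrow> real \<Rightarrow> (real^2 \<Rightarrow> real^2) \<Rightarrow> (real \<Rightarrow> real^2 \<Rightarrow> real^2) \<Rightarrow> bool" where
  "weak_solution T \<nu> u0 u \<longleftrightarrow>
     Linf_L2 T u \<and> L2_H1 T u \<and>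
     (AE t in lborel. t \<in> {0..<T} \<longrightarrow> divergence_free (u t)) \<and>
     (\<forall>\<phi>. test_field T \<phi> \<longrightarrow>
        (LINT t:{0..<T}|lborel. (LINT x:cell|lborel.
            u t x \<bullet> vector_derivative (\<lambda>s. \<phi> s x) (at t)
            + (\<Sum>j\<in>UNIV. u t x $ j * (u t x \<bullet> pd j (\<phi> t) x))
            + \<nu> * (u t x \<bullet> laplacian (\<phi> t) x)))
        + (LINT x:cell|lborel. u0 x \<bullet> \<phi> 0 x) = 0)"

text \<open>
  In two dimensions a weak solution with divergence-free data in \<open>L\<^sup>2\<close> is unique and, after
  modification on a null set, attains its datum at time \<open>0\<close>, is smooth for \<open>t > 0\<close> and satisfies the
  energy balance. As these clauses single out the regular representative, \<open>u t\<close> is meaningful for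
  every \<open>t\<close> and not merely almost every one.
\<close>

definition leray_hopf ::
    "real \<Rightarrow> real \<Rightarrow> (real^2 \<Rightarrow> real^2) \<Rightarrow> (real \<Rightarrow> real^2 \<Rightarrow> real^2) \<Rightarrow> bool" where
  "leray_hopf T \<nu> u0 u \<longleftrightarrow>
     weak_solution T \<nu> u0 u \<and>
     (AE x in lborel. u 0 x = u0 x) \<and>
     smooth_on ({0<..<T} \<times> UNIV) (\<lambda>(t, x). u t x) \<and>
     (\<forall>t\<in>{0..<T}. 1/2 * (L2norm (u t))\<^sup>2
        + \<nu> * (LINT s:{0..t}|lborel. (L2norm (weak_gradient (u s)))\<^sup>2) = 1/2 * (L2norm u0)\<^sup>2)"

definition S2 :: "real \<Rightarrow> (real \<Rightarrow> real^2 \<Rightarrow> real^2) \<Rightarrow> real \<Rightarrow> real" where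
  "S2 T u l = (LINT t:{0..<T}|lborel. 1 / measure lborel (ball (0::real^2) l) *
     (LINT y:ball 0 l|lborel. (L2norm (\<lambda>x. u t (x + y) - u t x))\<^sup>2))"

end

theory Submission
  imports Defs "HOL-Real_Asymp.Real_Asymp"
begin

text \<open>
  For one direction, \<open>\<parallel>v(\<cdot> + y) - v\<parallel>\<^sup>2 \<le> |y|\<^sup>2 \<parallel>\<nabla>v\<parallel>\<^sup>2\<close>, so the average over the
  disk of radius \<open>\<surd>\<nu>\<close> is at most \<open>\<nu> \<parallel>\<nabla>v\<parallel>\<^sup>2\<close>.

  For the converse the time interval is split at a small \<open>\<delta>\<close>. On \<open>(0, \<delta>]\<close> the dissipation is
  controlled uniformly in \<open>\<nu>\<close> by compactness of the data: a finite net reduces to data close to one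
  of finitely many smooth divergence-free fields \<open>v\<close>; testing the equation with \<open>v\<close> times a time
  cutoff and combining with the energy balance bounds the dissipation by
  \<open>\<parallel>u\<^sub>0 - v\<parallel>\<^sup>2 / 2 + O(\<delta>)\<close>. On \<open>[\<delta>, T)\<close> the vorticity \<open>\<omega>\<close> satisfies an enstrophy balance, because
  there is no vortex stretching in dimension two, and together with the energy balance this yields
  \<open>\<nu>\<^sup>2 \<integral> \<parallel>D\<^sup>2u\<parallel>\<^sup>2 \<le> C \<parallel>u\<^sub>0\<parallel>\<^sup>2 / \<delta>\<close>. Interpolating the gradient between increments of size
  \<open>h = \<epsilon> \<surd>\<nu>\<close> and second derivatives, \<open>h\<^sup>2 \<parallel>\<nabla>u\<parallel>\<^sup>2 \<le> C (increments + h\<^sup>4 \<parallel>D\<^sup>2u\<parallel>\<^sup>2)\<close>, gives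
  \<open>\<nu> \<integral> \<parallel>\<nabla>u\<parallel>\<^sup>2 \<le> C S\<^sub>2(\<surd>\<nu>) / \<epsilon>\<^sup>2 + C \<epsilon>\<^sup>2 / \<delta>\<close>; the limit in \<open>\<nu>\<close> is taken before those in \<open>\<epsilon>\<close>
  and \<open>\<delta>\<close>.
\<close>

section \<open>Directional derivatives and smooth functions\<close>

text \<open>The data have finite energy but in general no finite enstrophy, so a bound on second
  derivatives cannot reach down to time zero: the late estimate carries the factor 1/\<delta>, and
  compactness is spent only on the initial layer left open by it. Enstrophy at a given positive time
  is not controlled either; it is averaged over [\<delta>/2, \<delta>], where the energy balance
  pays for it. The averaging and the enstrophy balance cost one power of \<nu> each, which makes
  sqrt \<nu> the critical length: \<nu> times the interpolation error at length h, divided by h^2,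
  is of order one there. The extra \<epsilon> makes it small, and increments at the shorter length
  are recovered from the average over the larger disk.

  The equation is given only in weak form, so the vorticity identity comes from testing it with a
  field built from the solution. As the solution is smooth only on the open interval (0, T), it is
  first cut off in time, and the late estimates stop at some b < T before b tends to T.\<close>

definition dd :: "'a::real_normed_vector \<Rightarrow> ('a \<Rightarrow> 'b::real_normed_vector) \<Rightarrow> 'a \<Rightarrow> 'b" where
  "dd v f x = frechet_derivative f (at x) v"

lemma dd_eqI: "(f has_derivative f') (at x) \<Longrightarrow> dd v f x = f' v"
  unfolding dd_def using frechet_derivative_at by metis

lemma dd_has_derivative: "f differentiable (at x) \<Longrightarrow> (f has_derivative (\<lambda>v. dd v f x)) (at x)"
  unfolding dd_def using frechet_derivative_works by (auto simp: eta_contract_eq)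

text \<open>Differentiability is not assumed: \<open>frechet_derivative\<close> picks one of the
  maps satisfying \<open>has_derivative\<close>, and both functions admit the same ones, so even the
  arbitrary value in the non-differentiable case agrees.\<close>

lemma dd_cong_open:
  assumes "open S" "x \<in> S" "\<And>x. x \<in> S \<Longrightarrow> f x = g x"
  shows "dd v f x = dd v g x"
proof -
  have "(f has_derivative D) (at x) \<longleftrightarrow> (g has_derivative D) (at x)" for D
    using assms has_derivative_transform_within_open[of f D x UNIV S g]
      has_derivative_transform_within_open[of g D x UNIV S f] by auto
  then show ?thesis unfolding dd_def frechet_derivative_def by simp
qed

lemma Ck_on_Suc_dd:
  "Ck_on (Suc n) S f \<longleftrightarrow> (\<forall>x\<in>S. f differentiable (at x)) \<and> (\<forall>v. Ck_on n S (dd v f))"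
  unfolding dd_def[abs_def] by simp

lemma Ck_on_cong:
  assumes "open S" "\<And>x. x \<in> S \<Longrightarrow> f x = g x" "Ck_on n S f"
  shows "Ck_on n S g"
  using assms(2,3)
proof (induction n arbitrary: f g)
  case 0
  then show ?case by (simp cong: continuous_on_cong)
next
  case (Suc n)
  have "g differentiable (at x)" if "x \<in> S" for x
    using Suc.prems that assms(1) has_derivative_transform_within_open[of f _ x UNIV S g]
    unfolding Ck_on_Suc_dd differentiable_def by blast
  moreover have "Ck_on n S (dd v g)" for v
    using Suc.IH[of "dd v f" "dd v g"] Suc.prems dd_cong_open[OF assms(1), of _ f g v]
    unfolding Ck_on_Suc_dd by blast
  ultimately show ?case unfolding Ck_on_Suc_dd by blast
qed

text \<open>\<open>Ck_on\<close> speaks of the derivative picked by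
  \<open>frechet_derivative\<close>; this rule accepts any exhibited derivative instead. The closure
  properties below then become single steps of an induction that generalizes over the
  functions.\<close>

lemma Ck_on_SucI:
  assumes "open S" "\<And>x. x \<in> S \<Longrightarrow> (f has_derivative f' x) (at x)"
    "\<And>v. Ck_on n S (\<lambda>x. f' x v)"
  shows "Ck_on (Suc n) S f"
  unfolding Ck_on_Suc_dd
proof safe
  show "f differentiable (at x)" if "x \<in> S" for x
    using assms(2)[OF that] differentiable_def by blast
  show "Ck_on n S (dd v f)" for v
    by (rule Ck_on_cong[OF assms(1) _ assms(3)[of v]]) (use assms(2) dd_eqI in metis)
qed

lemma Ck_on_SucD: "Ck_on (Suc n) S f \<Longrightarrow> Ck_on n S f"
proof (induction n arbitrary: f)
  case 0
  then show ?case
    by (auto intro!: continuous_at_imp_continuous_on differentiable_imp_continuous_within)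
next
  case (Suc n)
  then show ?case unfolding Ck_on_Suc_dd[of "Suc n"] Ck_on_Suc_dd[of n] by blast
qed

lemma Ck_on_const [simp]: "open S \<Longrightarrow> Ck_on n S (\<lambda>x. c)"
proof (induction n arbitrary: c)
  case 0
  then show ?case by simp
next
  case (Suc n)
  show ?case by (rule Ck_on_SucI[where f'="\<lambda>x v. 0"]) (use Suc in auto)
qed

lemma Ck_on_add:
  assumes "open S" "Ck_on n S f" "Ck_on n S g" shows "Ck_on n S (\<lambda>x. f x + g x)"
  using assms(2,3)
proof (induction n arbitrary: f g)
  case 0
  then show ?case by (simp add: continuous_on_add)
next
  case (Suc n)
  show ?case
    by (rule Ck_on_SucI[where f'="\<lambda>x v. dd v f x + dd v g x"])
      (use Suc assms in \<open>auto simp: Ck_on_Suc_dd simp del: Ck_on.simps intro!: has_derivative_add dd_has_derivative\<close>)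
qed

lemma Ck_on_bounded_bilinear:
  assumes "bounded_bilinear B" "open S" "Ck_on n S f" "Ck_on n S g"
  shows "Ck_on n S (\<lambda>x. B (f x) (g x))"
  using assms(3,4)
proof (induction n arbitrary: f g)
  case 0
  then show ?case using bounded_bilinear.continuous_on[OF assms(1)] by simp
next
  case (Suc n)
  show ?case
  proof (rule Ck_on_SucI[where f'="\<lambda>x v. B (f x) (dd v g x) + B (dd v f x) (g x)"])
    show "((\<lambda>x. B (f x) (g x)) has_derivative (\<lambda>v. B (f x) (dd v g x) + B (dd v f x) (g x))) (at x)"
      if "x \<in> S" for x
      by (rule bounded_bilinear.FDERIV[OF assms(1)])
        (use that Suc.prems in \<open>auto simp: Ck_on_Suc_dd simp del: Ck_on.simps intro!: dd_has_derivative\<close>)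
    show "Ck_on n S (\<lambda>x. B (f x) (dd v g x) + B (dd v f x) (g x))" for v
      using Suc.prems Suc.prems[THEN Ck_on_SucD] by (intro Ck_on_add Suc.IH assms) (auto simp: Ck_on_Suc_dd simp del: Ck_on.simps)
  qed (use assms in auto)
qed

lemma Ck_on_linear_comp:
  assumes "bounded_linear L" "open S" "Ck_on n S f"
  shows "Ck_on n S (\<lambda>x. L (f x))"
  using assms(3)
proof (induction n arbitrary: f)
  case 0
  then show ?case using bounded_linear.continuous_on[OF assms(1)] by simp
next
  case (Suc n)
  show ?case
    by (rule Ck_on_SucI[where f'="\<lambda>x v. L (dd v f x)"])
      (use Suc assms in \<open>auto simp: Ck_on_Suc_dd simp del: Ck_on.simps intro!: bounded_linear.has_derivative[OF assms(1)] dd_has_derivative\<close>)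
qed

lemma Ck_on_compose_affine:
  assumes "bounded_linear L" "open S" "open R" "\<And>x. x \<in> R \<Longrightarrow> c + L x \<in> S" "Ck_on n S f"
  shows "Ck_on n R (\<lambda>x. f (c + L x))"
  using assms(5)
proof (induction n arbitrary: f)
  case 0
  have "continuous_on R (\<lambda>x. c + L x)"
    by (intro continuous_intros bounded_linear.continuous_on[OF assms(1)])
  then show ?case using 0 continuous_on_compose2[of S f R "\<lambda>x. c + L x"] assms(4) by auto
next
  case (Suc n)
  show ?case
  proof (rule Ck_on_SucI[where f'="\<lambda>x v. dd (L v) f (c + L x)"])
    fix x assume x: "x \<in> R"
    have 1: "((\<lambda>x. c + L x) has_derivative L) (at x)"
      using bounded_linear_imp_has_derivative[OF assms(1)] by (auto intro!: derivative_eq_intros)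
    have 2: "(f has_derivative (\<lambda>v. dd v f (c + L x))) (at (c + L x))"
      using Suc.prems assms(4)[OF x] by (auto simp: Ck_on_Suc_dd simp del: Ck_on.simps intro!: dd_has_derivative)
    show "((\<lambda>x. f (c + L x)) has_derivative (\<lambda>v. dd (L v) f (c + L x))) (at x)"
      using diff_chain_at[OF 1 2] by (simp add: o_def)
  next
    show "Ck_on n R (\<lambda>x. dd (L v) f (c + L x))" for v
      using Suc by (auto simp: Ck_on_Suc_dd simp del: Ck_on.simps)
  qed (use assms in auto)
qed

lemma Ck_on_subset: "Ck_on n S f \<Longrightarrow> R \<subseteq> S \<Longrightarrow> Ck_on n R f"
  by (induction n arbitrary: f) (auto intro: continuous_on_subset)

lemma Ck_on_Un: "open S \<Longrightarrow> open R \<Longrightarrow> Ck_on n S f \<Longrightarrow> Ck_on n R f \<Longrightarrow> Ck_on n (S \<union> R) f"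
  by (induction n arbitrary: f) (auto intro: continuous_on_open_Un)

lemma smooth_on_iff: "smooth_on S f \<longleftrightarrow> (\<forall>x\<in>S. f differentiable (at x)) \<and> (\<forall>v. smooth_on S (dd v f))"
  unfolding smooth_on_def using Ck_on_Suc_dd Ck_on_SucD by metis

lemma smooth_on_dd: "smooth_on S f \<Longrightarrow> smooth_on S (dd v f)"
  using smooth_on_iff by blast

lemma smooth_on_differentiable: "smooth_on S f \<Longrightarrow> x \<in> S \<Longrightarrow> f differentiable (at x)"
  using smooth_on_iff by blast

lemma smooth_on_has_derivative:
  "smooth_on S f \<Longrightarrow> x \<in> S \<Longrightarrow> (f has_derivative (\<lambda>v. dd v f x)) (at x)"
  using smooth_on_differentiable dd_has_derivative by blast

lemma smooth_on_continuous: "smooth_on S f \<Longrightarrow> continuous_on S f"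
  unfolding smooth_on_def using Ck_on.simps(1) by blast

lemma smooth_on_cong:
  assumes "open S" "\<And>x. x \<in> S \<Longrightarrow> f x = g x" "smooth_on S f" shows "smooth_on S g"
  using Ck_on_cong[OF assms(1), of f g] assms unfolding smooth_on_def by blast

lemma smooth_on_subset: "smooth_on S f \<Longrightarrow> R \<subseteq> S \<Longrightarrow> smooth_on R f"
  unfolding smooth_on_def using Ck_on_subset by blast

lemma smooth_on_Un: "open S \<Longrightarrow> open R \<Longrightarrow> smooth_on S f \<Longrightarrow> smooth_on R f \<Longrightarrow> smooth_on (S \<union> R) f"
  unfolding smooth_on_def using Ck_on_Un by blast

lemma smooth_on_const: "open S \<Longrightarrow> smooth_on S (\<lambda>x. c)"
  unfolding smooth_on_def by simp

lemma smooth_on_bounded_bilinear: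
  "bounded_bilinear B \<Longrightarrow> open S \<Longrightarrow> smooth_on S f \<Longrightarrow> smooth_on S g \<Longrightarrow> smooth_on S (\<lambda>x. B (f x) (g x))"
  unfolding smooth_on_def using Ck_on_bounded_bilinear by blast

lemma smooth_on_linear_comp:
  "bounded_linear L \<Longrightarrow> open S \<Longrightarrow> smooth_on S f \<Longrightarrow> smooth_on S (\<lambda>x. L (f x))"
  unfolding smooth_on_def using Ck_on_linear_comp by blast

lemma smooth_on_compose_affine:
  "bounded_linear L \<Longrightarrow> open S \<Longrightarrow> open R \<Longrightarrow> (\<And>x. x \<in> R \<Longrightarrow> c + L x \<in> S) \<Longrightarrow> smooth_on S f
    \<Longrightarrow> smooth_on R (\<lambda>x. f (c + L x))"
  unfolding smooth_on_def using Ck_on_compose_affine by blast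

lemmas smooth_on_mult = smooth_on_bounded_bilinear[OF bounded_bilinear_mult]
lemmas smooth_on_scaleR = smooth_on_bounded_bilinear[OF bounded_bilinear_scaleR]
lemmas smooth_on_vec_nth = smooth_on_linear_comp[OF bounded_linear_vec_nth]

lemma smooth_on_add: "open S \<Longrightarrow> smooth_on S f \<Longrightarrow> smooth_on S g \<Longrightarrow> smooth_on S (\<lambda>x. f x + g x)"
  unfolding smooth_on_def using Ck_on_add by blast

lemma smooth_on_uminus: "open S \<Longrightarrow> smooth_on S f \<Longrightarrow> smooth_on S (\<lambda>x. - f x)"
  using smooth_on_linear_comp[OF bounded_linear_minus[OF bounded_linear_ident]] by blast

lemma smooth_on_diff: "open S \<Longrightarrow> smooth_on S f \<Longrightarrow> smooth_on S g \<Longrightarrow> smooth_on S (\<lambda>x. f x - g x)"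
  using smooth_on_add[of S f "\<lambda>x. - g x"] smooth_on_uminus by auto

text \<open>A family closed under differentiation consists of smooth functions. Shifts of the index
  by one and by two are both allowed: the cosine uses only the first, the functions
  \<open>flat k\<close> use both.\<close>

lemma smooth_on_real_deriv:
  fixes F :: "nat \<Rightarrow> real \<Rightarrow> 'b::real_normed_vector"
  assumes "\<And>k x. (F k has_vector_derivative a k *\<^sub>R F (Suc k) x + b k *\<^sub>R F (Suc (Suc k)) x) (at x)"
  shows "smooth_on UNIV (F k)"
proof -
  have "Ck_on n UNIV (F k)" for n k
  proof (induction n arbitrary: k)
    case 0
    show ?case
      using assms by (auto intro!: continuous_at_imp_continuous_on has_vector_derivative_continuous)
  next
    case (Suc n)
    show ?case
    proof (rule Ck_on_SucI)
      show "(F k has_derivative (\<lambda>v. v *\<^sub>R (a k *\<^sub>R F (Suc k) x + b k *\<^sub>R F (Suc (Suc k)) x))) (at x)" for x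
        using assms unfolding has_vector_derivative_def by blast
      show "Ck_on n UNIV (\<lambda>x. v *\<^sub>R (a k *\<^sub>R F (Suc k) x + b k *\<^sub>R F (Suc (Suc k)) x))" for v
        by (intro Ck_on_linear_comp[OF bounded_linear_scaleR_right] Ck_on_add Suc) auto
    qed auto
  qed
  then show ?thesis unfolding smooth_on_def by blast
qed

lemma smooth_on_cos: "smooth_on UNIV (cos :: real \<Rightarrow> real)"
proof -
  \<comment> \<open>The \<open>k\<close>-th derivative of the cosine is the cosine advanced by
    \<open>k\<close> quarter periods.\<close>
  have "smooth_on UNIV ((\<lambda>k x. cos (x + real k * (pi/2))) 0)"
  proof (rule smooth_on_real_deriv[where a="\<lambda>_. 1" and b="\<lambda>_. 0"])
    show "((\<lambda>x. cos (x + real k * (pi/2))) has_vector_derivative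
           1 *\<^sub>R cos (x + real (Suc k) * (pi / 2)) + 0 *\<^sub>R cos (x + real (Suc (Suc k)) * (pi / 2))) (at x)"
      for k and x :: real
    proof -
      have "x + real (Suc k) * (pi/2) = (x + real k * (pi/2)) + pi/2" by (simp add: algebra_simps)
      then have "cos (x + real (Suc k) * (pi / 2)) = - sin (x + real k * (pi/2))"
        by (simp only: cos_add) simp
      then show ?thesis
        unfolding has_real_derivative_iff_has_vector_derivative[symmetric]
        by (auto intro!: derivative_eq_intros)
    qed
  qed
  then show ?thesis by (simp add: eta_contract_eq)
qed

section \<open>A smooth step\<close>

text \<open>For \<open>k = 0\<close> this is the classical smooth function that vanishes to infinite
  order at the origin. The powers of \<open>1 / x\<close> are included because its derivatives are
  combinations of these functions.\<close>

definition flat :: "nat \<Rightarrow> real \<Rightarrow> real" where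
  "flat k x = (if x > 0 then (1 / x) ^ k * exp (- (1 / x)) else 0)"

lemma flat_has_derivative:
  "(flat k has_vector_derivative (- real k) *\<^sub>R flat (Suc k) x + 1 *\<^sub>R flat (Suc (Suc k)) x) (at x)"
proof (cases "x = 0")
  case False
  show ?thesis
  proof (cases "x > 0")
    case True
    have "((\<lambda>x. (1 / x) ^ k * exp (- (1 / x))) has_real_derivative
        (- real k) * ((1 / x) ^ Suc k * exp (- (1 / x))) + (1 / x) ^ Suc (Suc k) * exp (- (1 / x))) (at x)"
    proof -
      have 1: "((\<lambda>x. 1 / x) has_real_derivative - ((1 / x)\<^sup>2)) (at x)"
        using True by (auto intro!: derivative_eq_intros simp: field_simps power2_eq_square)
      have 2: "((\<lambda>x. exp (- (1 / x))) has_real_derivative exp (- (1 / x)) * (1 / x)\<^sup>2) (at x)"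
        using DERIV_chain2[OF DERIV_exp DERIV_minus[OF 1]] by simp
      \<comment> \<open>The power rule produces the exponent \<open>k - Suc 0\<close>, which is
        truncated at \<open>k = 0\<close>; there the factor \<open>real k\<close> removes the term,
        hence the case distinction.\<close>
      have alg: "real k * (- (y\<^sup>2) * y ^ (k - Suc 0)) * E + E * y\<^sup>2 * y ^ k
          = (- real k) * (y ^ Suc k * E) + y ^ Suc (Suc k) * E" for y E :: real
      proof (cases k)
        case (Suc m)
        have "c * (- (y * y) * z) * E + E * (y * y) * (y * z) = - c * (y * (y * z) * E) + y * (y * (y * z)) * E"
          for c z by (simp add: algebra_simps)
        from this[of "real (Suc m)" "y ^ m"] show ?thesis
          unfolding Suc
          by (simp only: diff_Suc_Suc diff_zero power2_eq_square power_Suc)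
      qed (simp add: power2_eq_square)
      show ?thesis
        using DERIV_mult[OF DERIV_power[OF 1, of k] 2]
        by (rule DERIV_cong) (rule alg)
    qed
    then have "(flat k has_real_derivative
        (- real k) * ((1 / x) ^ Suc k * exp (- (1 / x))) + (1 / x) ^ Suc (Suc k) * exp (- (1 / x))) (at x)"
      by (rule has_field_derivative_transform_within_open[where S="{0<..}"])
        (use True in \<open>auto simp: flat_def\<close>)
    then show ?thesis
      using True by (simp add: has_real_derivative_iff_has_vector_derivative[symmetric] flat_def)
  next
    case neg: False
    have "((\<lambda>x. 0) has_real_derivative 0) (at x)" by simp
    then have "(flat k has_real_derivative 0) (at x)"
      by (rule has_field_derivative_transform_within_open[where S="{..<0}"])
        (use neg False in \<open>auto simp: flat_def\<close>)
    then show ?thesis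
      using neg by (simp add: has_real_derivative_iff_has_vector_derivative[symmetric] flat_def)
  qed
next
  case True
  \<comment> \<open>At the origin the difference quotient is treated from each side: it is zero on
    the left, and on the right the exponential beats every power of \<open>1 / h\<close>.\<close>
  have "((\<lambda>h. flat k h / h) \<longlongrightarrow> 0) (at_left 0)"
    by (rule tendsto_eventually) (auto simp: eventually_at_filter flat_def)
  moreover have "((\<lambda>h. flat k h / h) \<longlongrightarrow> 0) (at_right 0)"
  proof -
    have "((\<lambda>h::real. (1 / h) ^ k * exp (- (1 / h)) / h) \<longlongrightarrow> 0) (at_right 0)"
      by real_asymp
    then show ?thesis
      by (rule Lim_transform_eventually) (auto simp: eventually_at_filter flat_def)
  qed
  ultimately have "((\<lambda>h. flat k h / h) \<longlongrightarrow> 0) (at 0)"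
    by (rule filterlim_split_at)
  then have "(flat k has_real_derivative 0) (at 0)"
    by (simp add: DERIV_def flat_def)
  then show ?thesis
    using True by (simp add: has_real_derivative_iff_has_vector_derivative[symmetric] flat_def)
qed

lemma smooth_on_flat: "smooth_on UNIV (flat k)"
  by (rule smooth_on_real_deriv) (rule flat_has_derivative)

text \<open>The derivative and its bound are parameters because they enter the cutoff estimates as
  explicit quantities: \<open>C\<close> ends up in the constant of the enstrophy bound, and the sign
  of \<open>s'\<close> is used in both time regimes.\<close>

definition smooth_step :: "(real \<Rightarrow> real) \<Rightarrow> (real \<Rightarrow> real) \<Rightarrow> real \<Rightarrow> bool" where
  "smooth_step s s' C \<longleftrightarrow> C > 0 \<and> smooth_on UNIV s \<and> (\<forall>x. (s has_real_derivative s' x) (at x)) \<and>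
    (\<forall>x. 0 \<le> s' x \<and> s' x \<le> C) \<and> (\<forall>x\<le>0. s x = 0) \<and> (\<forall>x\<ge>1. s x = 1) \<and> (\<forall>x. 0 \<le> s x \<and> s x \<le> 1) \<and>
    (\<forall>x. x \<notin> {0..1} \<longrightarrow> s' x = 0) \<and> continuous_on UNIV s'"

lemma smooth_step_exists:
  obtains s s' C where "smooth_step s s' C"
proof -
  \<comment> \<open>Positive exactly on the open unit interval, as each factor vanishes on one side
    of it; the step is its normalized primitive.\<close>
  define b where "b x = flat 0 x * flat 0 (1 - x)" for x
  have smb: "smooth_on UNIV b"
    unfolding b_def
    using smooth_on_compose_affine[OF bounded_linear_minus[OF bounded_linear_ident], of UNIV UNIV 1 "flat 0"]
      smooth_on_flat by (intro smooth_on_mult) auto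
  then have cb: "continuous_on A b" for A
    using smooth_on_continuous continuous_on_subset by blast
  have b0: "b x \<ge> 0" for x by (auto simp: b_def flat_def)
  have bz: "b x = 0" if "x \<le> 0 \<or> x \<ge> 1" for x using that by (auto simp: b_def flat_def)
  define I where "I = integral {0..1} b"
  obtain C0 where C0: "\<And>x. x \<in> {0..1} \<Longrightarrow> b x \<le> C0"
    using continuous_attains_sup[of "{0..1::real}" b] cb by fastforce
  have bC: "b x \<le> max C0 0" for x using C0[of x] bz[of x] by (cases "x \<in> {0..1}") auto
  have "I \<noteq> 0"
  proof
    assume "I = 0"
    then have "\<forall>x\<in>{0..1}. b x = 0"
      using integral_eq_0_iff[of 0 1 b] cb b0 unfolding I_def by auto
    then have "b (1/2) = 0" by auto
    then show False by (simp add: b_def flat_def)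
  qed
  moreover have "I \<ge> 0" unfolding I_def using b0 cb by (intro integral_nonneg integrable_continuous_real) auto
  ultimately have I: "I > 0" by simp
  \<comment> \<open>The lower limit lies strictly to the left of the support of \<open>b\<close>.
    Hence the upper limit moves in a full neighbourhood of every point of the support, and the
    derivative is two-sided; for \<open>x \<le> -1\<close> the function \<open>s\<close> is locally
    constant.\<close>
  define s where "s x = integral {-1..x} b / I" for x
  have sz: "s x = 0" if "x \<le> 0" for x
  proof -
    have "integral {-1..x} b = integral {-1..x} (\<lambda>x. 0)"
      by (rule integral_cong) (use that bz in auto)
    then show ?thesis by (simp add: s_def)
  qed
  have D: "(s has_real_derivative b x / I) (at x)" for x
  proof (cases "x > -1")
    case True
    have "((\<lambda>u. integral {-1..u} b) has_vector_derivative b x) (at x within {-1..x+1})"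
      by (rule integral_has_vector_derivative) (use True cb in auto)
    then have "((\<lambda>u. integral {-1..u} b) has_real_derivative b x) (at x)"
      using True at_within_Icc_at[of "-1" x "x+1"]
      unfolding has_real_derivative_iff_has_vector_derivative by auto
    then show ?thesis unfolding s_def by (rule DERIV_cdivide)
  next
    case False
    have "((\<lambda>x. 0) has_real_derivative 0) (at x)" by simp
    then have "(s has_real_derivative 0) (at x)"
      by (rule has_field_derivative_transform_within_open[where S="{..<0}"]) (use False sz in auto)
    then show ?thesis using bz[of x] False by simp
  qed
  have s1: "s x = 1" if "x \<ge> 1" for x
  proof -
    have int: "b integrable_on {u..v}" for u v using cb by (intro integrable_continuous_real) 
    have 1: "integral {-1..x} b = integral {-1..0} b + integral {0..x} b"
      by (rule Henstock_Kurzweil_Integration.integral_combine[symmetric]) (use that int in auto)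
    have 2: "integral {0..x} b = integral {0..1} b + integral {1..x} b"
      by (rule Henstock_Kurzweil_Integration.integral_combine[symmetric]) (use that int in auto)
    have 3: "integral {1..x} b = integral {1..x} (\<lambda>x::real. 0)" by (rule integral_cong) (use bz in auto)
    have 4: "integral {-1..0} b = integral {-1..0} (\<lambda>x::real. 0)" by (rule integral_cong) (use bz in auto)
    have "integral {-1..x} b = I" unfolding 1 2 3 4 I_def by simp
    then show ?thesis using I unfolding s_def by simp
  qed
  have mono: "s x \<le> s y" if "x \<le> y" for x y
  proof (rule DERIV_nonneg_imp_nondecreasing[OF that])
    show "\<exists>y. (s has_real_derivative y) (at z) \<and> 0 \<le> y" for z
      using D[of z] divide_nonneg_pos[OF b0[of z] I] by blast
  qed
  show ?thesis
  proof (rule that[of s "\<lambda>x. b x / I" "max C0 0 / I + 1"], unfold smooth_step_def, intro conjI allI impI)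
    show "max C0 0 / I + 1 > 0" using I by (simp add: add_nonneg_pos)
    show "b x / I \<le> max C0 0 / I + 1" for x
      using bC[of x] I by (smt (verit) divide_right_mono)
    show "smooth_on UNIV s"
    proof (subst smooth_on_iff, safe)
      show "s differentiable at x" for x using D real_differentiable_def by blast
      show "smooth_on UNIV (dd v s)" for v
      proof -
        have "dd v s = (\<lambda>x. (v / I) * b x)"
          using dd_eqI[OF D[unfolded has_field_derivative_def], of v] by (auto simp: fun_eq_iff mult.commute)
        then show ?thesis using smooth_on_mult[OF open_UNIV smooth_on_const[OF open_UNIV, of "v / I"] smb] by (simp only:)
      qed
    qed
    show "0 \<le> s x" for x using mono[of 0 x] mono[of x 0] sz[of 0] sz[of x] by (cases "x \<le> 0") auto
    show "s x \<le> 1" for x using mono[of x 1] s1[of x] s1[of 1] by (cases "x \<le> 1") auto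
    show "b x / I = 0" if "x \<notin> {0..1}" for x using bz[of x] that by auto
    show "continuous_on UNIV (\<lambda>x. b x / I)" using I by (intro continuous_intros cb) auto
    show "0 \<le> b x / I" for x using divide_nonneg_pos[OF b0[of x] I] .
  qed (rule D sz s1, assumption?)+
qed

section \<open>Integrals of periodic functions\<close>

lemma cell_eq: "x \<in> cell \<longleftrightarrow> 0 \<le> x $ 1 \<and> x $ 1 < 1 \<and> 0 \<le> x $ 2 \<and> x $ 2 < 1"
  unfolding cell_def by (auto simp: forall_2)

lemma cell_borel [measurable]: "cell \<in> sets borel"
proof -
  have [measurable]: "(\<lambda>x::real^2. x $ i) \<in> borel_measurable borel" for i
    by (intro borel_measurable_continuous_onI continuous_intros)
  have "cell = {x \<in> space borel. 0 \<le> x $ 1 \<and> x $ 1 < 1 \<and> 0 \<le> x $ 2 \<and> x $ 2 < 1}"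
    using cell_eq by auto
  also have "\<dots> \<in> sets borel" by measurable
  finally show ?thesis .
qed

lemma cell_subset_cbox: "cell \<subseteq> cbox 0 1"
  unfolding cell_def by (force simp: mem_box_cart intro: less_imp_le)

lemma bounded_cell: "bounded cell"
  using cell_subset_cbox bounded_cbox bounded_subset by blast

lemma emeasure_cell_le: "emeasure lborel cell \<le> 1"
proof -
  have "emeasure lborel cell \<le> emeasure lborel (cbox (0::real^2) 1)"
    by (intro emeasure_mono cell_subset_cbox) auto
  also have "\<dots> = 1"
    by (subst emeasure_lborel_cbox_eq) (auto simp: Basis_vec_def inner_axis intro!: prod.neutral)
  finally show ?thesis .
qed

definition lattice_vec :: "int \<times> int \<Rightarrow> real^2" where
  "lattice_vec k = (\<chi> i. of_int (if i = 1 then fst k else snd k))"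

lemma periodic_lattice_vec: "periodic f \<Longrightarrow> f (x + lattice_vec k) = f x"
  unfolding periodic_def lattice_vec_def by auto

text \<open>The translates of \<open>cell\<close> tile the plane: minus the floors of the
  coordinates is the only lattice vector that moves \<open>x\<close> into \<open>cell\<close>. The
  count is written as an integral over \<open>count_space\<close> so that it can be exchanged with
  Lebesgue integrals.\<close>

lemma nn_integral_lattice_cell:
  "(\<integral>\<^sup>+k. indicator cell (x + lattice_vec k) \<partial>count_space UNIV) = 1"
proof -
  define k0 where "k0 = (- \<lfloor>x $ 1\<rfloor>, - \<lfloor>x $ 2\<rfloor>)"
  have "x + lattice_vec k \<in> cell \<longleftrightarrow> k = k0" for k
  proof -
    have a: "0 \<le> a + of_int m \<and> a + of_int m < 1 \<longleftrightarrow> m = - \<lfloor>a\<rfloor>" for a :: real and m by linarith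
    show ?thesis
      using a[of "x $ 1" "fst k"] a[of "x $ 2" "snd k"]
      by (cases k) (auto simp: cell_eq k0_def lattice_vec_def)
  qed
  then have "(\<lambda>k. indicator cell (x + lattice_vec k)) = (indicator {k0} :: _ \<Rightarrow> ennreal)"
    by (auto simp: indicator_def fun_eq_iff)
  then show ?thesis by simp
qed

lemma nn_integral_lborel_translate:
  fixes c :: "'a::euclidean_space"
  assumes [measurable]: "f \<in> borel_measurable borel"
  shows "(\<integral>\<^sup>+x. f (x + c) \<partial>lborel) = (\<integral>\<^sup>+x. f x \<partial>lborel)"
proof -
  have "(\<integral>\<^sup>+x. f x \<partial>lborel) = (\<integral>\<^sup>+x. f x \<partial>distr lborel borel ((+) c))"
    by (simp add: lborel_distr_plus)
  also have "\<dots> = (\<integral>\<^sup>+x. f (c + x) \<partial>lborel)"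
    by (rule nn_integral_distr) auto
  finally show ?thesis by (simp add: add.commute)
qed

text \<open>Unfolding. The shifted cell is cut along the lattice, every piece is moved back into
  \<open>cell\<close> by periodicity, and the pieces tile it again. Nonnegativity makes each
  exchange of sum and integral legitimate.\<close>

lemma nn_integral_cell_translate:
  fixes f :: "real^2 \<Rightarrow> ennreal"
  assumes [measurable]: "f \<in> borel_measurable borel" and "periodic f"
  shows "(\<integral>\<^sup>+x. f (x + y) * indicator cell x \<partial>lborel) = (\<integral>\<^sup>+x. f x * indicator cell x \<partial>lborel)"
proof -
  let ?C = "count_space (UNIV :: (int \<times> int) set)"
  have "(\<integral>\<^sup>+x. f (x + y) * indicator cell x \<partial>lborel)
      = (\<integral>\<^sup>+x. (\<lambda>z. f z * indicator cell (z - y)) (x + y) \<partial>lborel)" by simp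
  also have "\<dots> = (\<integral>\<^sup>+z. f z * indicator cell (z - y) \<partial>lborel)"
    by (rule nn_integral_lborel_translate) simp
  also have "\<dots> = (\<integral>\<^sup>+z. (\<integral>\<^sup>+k. f z * indicator cell (z - y) * indicator cell (z + lattice_vec k) \<partial>?C) \<partial>lborel)"
    by (simp add: nn_integral_cmult nn_integral_lattice_cell)
  also have "\<dots> = (\<integral>\<^sup>+k. (\<integral>\<^sup>+z. f z * indicator cell (z - y) * indicator cell (z + lattice_vec k) \<partial>lborel) \<partial>?C)"
    by (rule nn_integral_count_space_nn_integral) auto
  also have "\<dots> = (\<integral>\<^sup>+k. (\<integral>\<^sup>+z. f z * indicator cell (z - y + lattice_vec k) * indicator cell z \<partial>lborel) \<partial>?C)"
  proof -
    \<comment> \<open>Translating by \<open>lattice_vec k\<close> leaves \<open>- k\<close> in the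
      first indicator; the reflection \<open>r\<close> reindexes the sum accordingly.\<close>
    define r where "r k = (- fst k, - snd k)" for k :: "int \<times> int"
    have r: "lattice_vec (r k) = - lattice_vec k" for k by (simp add: lattice_vec_def r_def vec_eq_iff)
    have bij: "bij r" by (rule involuntory_imp_bij) (simp add: r_def)
    have "(\<integral>\<^sup>+z. f z * indicator cell (z - y) * indicator cell (z + lattice_vec k) \<partial>lborel)
       = (\<integral>\<^sup>+z. f z * indicator cell (z - y + lattice_vec (r k)) * indicator cell z \<partial>lborel)" for k
    proof -
      have "(\<integral>\<^sup>+z. f z * indicator cell (z - y + lattice_vec (r k)) * indicator cell z \<partial>lborel)
        = (\<integral>\<^sup>+z. (\<lambda>z. f z * indicator cell (z - y + lattice_vec (r k)) * indicator cell z) (z + lattice_vec k) \<partial>lborel)"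
        by (rule nn_integral_lborel_translate[symmetric]) simp
      also have "\<dots> = (\<integral>\<^sup>+z. f z * indicator cell (z - y) * indicator cell (z + lattice_vec k) \<partial>lborel)"
        using periodic_lattice_vec[OF assms(2)]
        by (intro nn_integral_cong) (simp add: r algebra_simps)
      finally show ?thesis by simp
    qed
    then show ?thesis
      using nn_integral_bij_count_space[OF bij,
        of "\<lambda>k. (\<integral>\<^sup>+z. f z * indicator cell (z - y + lattice_vec k) * indicator cell z \<partial>lborel)"]
      by simp
  qed
  also have "\<dots> = (\<integral>\<^sup>+z. (\<integral>\<^sup>+k. f z * indicator cell (z - y + lattice_vec k) * indicator cell z \<partial>?C) \<partial>lborel)"
    by (rule nn_integral_count_space_nn_integral[symmetric]) auto
  also have "\<dots> = (\<integral>\<^sup>+z. (\<integral>\<^sup>+k. (f z * indicator cell z) * indicator cell (z - y + lattice_vec k) \<partial>?C) \<partial>lborel)"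
    by (intro nn_integral_cong) (simp add: mult_ac)
  also have "\<dots> = (\<integral>\<^sup>+z. f z * indicator cell z \<partial>lborel)"
    by (simp add: nn_integral_cmult nn_integral_lattice_cell)
  finally show ?thesis .
qed

text \<open>The nonnegative case is used with \<open>h\<close> equal to \<open>abs\<close>, to the
  identity and to \<open>uminus\<close>; \<open>ennreal\<close> truncates the last two to the
  positive and negative parts. When one side is not integrable, neither is the other, and both
  integrals take the default value zero.\<close>

lemma
  fixes f :: "real^2 \<Rightarrow> real"
  assumes [measurable]: "f \<in> borel_measurable borel" and "periodic f"
  shows set_integrable_cell_translate:
      "set_integrable lborel cell (\<lambda>x. f (x + y)) \<longleftrightarrow> set_integrable lborel cell f"
    and cell_integral_translate:
      "(LINT x:cell|lborel. f (x + y)) = (LINT x:cell|lborel. f x)"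
proof -
  let ?F = "\<lambda>y x. indicator cell x *\<^sub>R f (x + y)"
  have per: "periodic (\<lambda>x. ennreal (h (f x)))" for h :: "real \<Rightarrow> real"
    using assms(2) unfolding periodic_def by auto
  have eq: "ennreal (h (?F y x)) = ennreal (h (f (x + y))) * indicator cell x" if "h 0 = 0" for h :: "real \<Rightarrow> real" and x y
    using that by (auto simp: indicator_def)
  have tr: "(\<integral>\<^sup>+x. ennreal (h (?F y x)) \<partial>lborel) = (\<integral>\<^sup>+x. ennreal (h (?F 0 x)) \<partial>lborel)"
    if [measurable]: "h \<in> borel_measurable borel" and "h 0 = 0" for h :: "real \<Rightarrow> real"
    using nn_integral_cell_translate[OF _ per, of h y] unfolding eq[of h, OF that(2)] by simp
  have I: "integrable lborel (?F y) \<longleftrightarrow> integrable lborel (?F 0)"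
    using tr[of abs] unfolding integrable_iff_bounded by simp
  then show "set_integrable lborel cell (\<lambda>x. f (x + y)) \<longleftrightarrow> set_integrable lborel cell f"
    unfolding set_integrable_def by simp
  show "(LINT x:cell|lborel. f (x + y)) = (LINT x:cell|lborel. f x)"
  proof (cases "integrable lborel (?F 0)")
    case True
    then have "integral\<^sup>L lborel (?F y) = integral\<^sup>L lborel (?F 0)"
      using I tr[of "\<lambda>x. x"] tr[of uminus] by (simp add: real_lebesgue_integral_def)
    then show ?thesis unfolding set_lebesgue_integral_def by simp
  next
    case False
    then show ?thesis
      using I not_integrable_integral_eq[of lborel "?F y"] not_integrable_integral_eq[of lborel "?F 0"]
      unfolding set_lebesgue_integral_def by simp
  qed
qed

section \<open>Vanishing integrals of derivatives and integration by parts\<close>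

lemma set_integrable_bounded_continuous:
  fixes f :: "'a::euclidean_space \<Rightarrow> 'b::{banach, second_countable_topology}"
  assumes "bounded A" "A \<in> sets borel" "continuous_on UNIV f"
  shows "set_integrable lborel A f"
proof -
  obtain a b where ab: "A \<subseteq> cbox a b" using bounded_subset_cbox_symmetric[OF assms(1)] by blast
  have "set_integrable lborel (cbox a b) f"
    unfolding set_integrable_def
    by (rule borel_integrable_compact) (use assms(3) continuous_on_subset in auto)
  then show ?thesis by (rule set_integrable_subset) (use assms ab in auto)
qed

lemma dd_line:
  fixes f :: "'a::real_normed_vector \<Rightarrow> real"
  assumes "f differentiable (at (x + s *\<^sub>R v))"
  shows "((\<lambda>s. f (x + s *\<^sub>R v)) has_real_derivative dd v f (x + s *\<^sub>R v)) (at s)"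
proof -
  have 1: "((\<lambda>s. x + s *\<^sub>R v) has_derivative (\<lambda>r. r *\<^sub>R v)) (at s)"
    by (auto intro!: derivative_eq_intros)
  have 2: "(f has_derivative (\<lambda>w. dd w f (x + s *\<^sub>R v))) (at (x + s *\<^sub>R v))"
    using assms by (rule dd_has_derivative)
  have 3: "dd (r *\<^sub>R v) f (x + s *\<^sub>R v) = dd v f (x + s *\<^sub>R v) * r" for r
    using linear_cmul[OF has_derivative_linear[OF 2], of r v] by simp
  show ?thesis using diff_chain_at[OF 1 2] unfolding has_field_derivative_def by (simp add: o_def 3)
qed

lemma dd_translate_bound:
  fixes f :: "'a::real_normed_vector \<Rightarrow> real"
  assumes "\<And>s. 0 \<le> s \<Longrightarrow> s \<le> h \<Longrightarrow> f differentiable (at (x + s *\<^sub>R v))" "h > 0"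
    "\<And>s. 0 \<le> s \<Longrightarrow> s \<le> h \<Longrightarrow> \<bar>dd v f (x + s *\<^sub>R v)\<bar> \<le> C"
  shows "\<bar>f (x + h *\<^sub>R v) - f x\<bar> \<le> h * C"
proof -
  have "\<exists>z>0. z < h \<and> f (x + h *\<^sub>R v) - f (x + 0 *\<^sub>R v) = (h - 0) * dd v f (x + z *\<^sub>R v)"
    by (rule MVT2[OF assms(2)]) (intro dd_line assms(1))
  then obtain z where "z > 0" "z < h" "f (x + h *\<^sub>R v) - f x = h * dd v f (x + z *\<^sub>R v)" by auto
  then show ?thesis using assms(2) assms(3)[of z] by (simp add: abs_mult)
qed

lemma dd_directional_limit:
  fixes f :: "'a::real_normed_vector \<Rightarrow> real"
  assumes "f differentiable (at x)"
  shows "(\<lambda>n. (f (x + inverse (real (Suc n)) *\<^sub>R v) - f x) / inverse (real (Suc n))) \<longlonglongrightarrow> dd v f x"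
proof -
  have L: "((\<lambda>h. (f (x + h *\<^sub>R v) - f x) / h) \<longlongrightarrow> dd v f x) (at 0)"
    using dd_line[of f x 0 v] assms by (simp add: DERIV_def)
  have "filterlim (\<lambda>n. inverse (real (Suc n))) (at 0) sequentially"
    using LIMSEQ_inverse_real_of_nat by (auto simp: filterlim_at)
  from filterlim_compose[OF L this] show ?thesis .
qed

text \<open>By invariance the difference quotients integrate to zero, and they converge dominatedly
  to the derivative. Invariance is asked only for small \<open>h\<close>, so that the lemma covers
  both space shifts of periodic functions and time shifts of functions supported inside the time
  interval.\<close>

lemma integral_dd_eq_0:
  fixes f :: "'a::euclidean_space \<Rightarrow> real"
  assumes A: "bounded A" "A \<in> sets borel" and f: "smooth_on UNIV f" and "h0 > 0"
    and inv: "\<And>h. 0 < h \<Longrightarrow> h \<le> h0 \<Longrightarrow> (LINT x:A|lborel. f (x + h *\<^sub>R v)) = (LINT x:A|lborel. f x)"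
  shows "(LINT x:A|lborel. dd v f x) = 0"
proof -
  have cf: "continuous_on UNIV f" and cd: "continuous_on UNIV (dd v f)"
    using f smooth_on_continuous smooth_on_dd by blast+
  have [measurable]: "f \<in> borel_measurable borel" "dd v f \<in> borel_measurable borel"
    using cf cd borel_measurable_continuous_onI by auto
  note [measurable] = A(2)
  obtain a b where ab: "A \<subseteq> cbox a b" using bounded_subset_cbox_symmetric[OF A(1)] by blast
  \<comment> \<open>All segments of direction \<open>v\<close> and parameter length one that start
    in \<open>A\<close> lie in a compact set. A bound for the derivative there dominates every
    difference quotient with step at most one, by the mean value theorem.\<close>
  have "compact ((\<lambda>(x, s). x + s *\<^sub>R v) ` (cbox a b \<times> {0..1::real}))"
    by (intro compact_continuous_image compact_Times continuous_intros) (auto simp: case_prod_unfold intro!: continuous_intros)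
  then have "compact (dd v f ` ((\<lambda>(x, s). x + s *\<^sub>R v) ` (cbox a b \<times> {0..1::real})))"
    by (rule compact_continuous_image[rotated]) (rule continuous_on_subset[OF cd], simp)
  then obtain C where "\<And>z. z \<in> dd v f ` ((\<lambda>(x, s). x + s *\<^sub>R v) ` (cbox a b \<times> {0..1::real})) \<Longrightarrow> norm z \<le> C"
    using compact_imp_bounded bounded_iff by metis
  then have C: "\<bar>dd v f (x + s *\<^sub>R v)\<bar> \<le> C" if "x \<in> A" "s \<in> {0..1}" for x s
    using that ab by force
  let ?h = "\<lambda>n. inverse (real (Suc n))"
  let ?q = "\<lambda>n x. (f (x + ?h n *\<^sub>R v) - f x) / ?h n"
  have "(\<lambda>n. LINT x:A|lborel. ?q n x) \<longlonglongrightarrow> (LINT x:A|lborel. dd v f x)"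
    unfolding set_lebesgue_integral_def
  proof (rule integral_dominated_convergence[where w="\<lambda>x. indicator A x *\<^sub>R C"])
    show "integrable lborel (\<lambda>x. indicator A x *\<^sub>R C)"
      using set_integrable_bounded_continuous[OF A continuous_on_const] unfolding set_integrable_def .
    show "AE x in lborel. (\<lambda>n. indicator A x *\<^sub>R ?q n x) \<longlonglongrightarrow> indicator A x *\<^sub>R dd v f x"
      by (intro AE_I2 tendsto_scaleR tendsto_const dd_directional_limit smooth_on_differentiable[OF f]) auto
    show "AE x in lborel. norm (indicator A x *\<^sub>R ?q n x) \<le> indicator A x *\<^sub>R C" for n
    proof (rule AE_I2)
      fix x
      show "norm (indicator A x *\<^sub>R ?q n x) \<le> indicator A x *\<^sub>R C"
      proof (cases "x \<in> A")
        case True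
        have h: "0 < ?h n" "?h n \<le> 1" by (auto simp: inverse_eq_divide)
        have "\<bar>f (x + ?h n *\<^sub>R v) - f x\<bar> \<le> ?h n * C"
          by (rule dd_translate_bound) (use True h C smooth_on_differentiable[OF f] in auto)
        then have "\<bar>?q n x\<bar> \<le> C" using h(1) by (simp only: abs_divide) (simp add: field_simps)
        then show ?thesis using True by simp
      qed simp
    qed
  qed auto
  moreover have "eventually (\<lambda>n. (LINT x:A|lborel. ?q n x) = 0) sequentially"
  proof -
    have "eventually (\<lambda>n. ?h n < h0) sequentially"
      using LIMSEQ_inverse_real_of_nat \<open>h0 > 0\<close> order_tendstoD(2) by blast
    then show ?thesis
    proof eventually_elim
      case (elim n)
      have i1: "set_integrable lborel A f" by (rule set_integrable_bounded_continuous[OF A cf])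
      have "continuous_on UNIV (\<lambda>x. f (x + ?h n *\<^sub>R v))"
        by (rule continuous_on_compose2[OF cf]) (auto intro!: continuous_intros)
      then have i2: "set_integrable lborel A (\<lambda>x. f (x + ?h n *\<^sub>R v))"
        by (rule set_integrable_bounded_continuous[OF A])
      have "(LINT x:A|lborel. ?q n x) = (LINT x:A|lborel. f (x + ?h n *\<^sub>R v) - f x) / ?h n"
        by (rule set_integral_divide_zero)
      also have "(LINT x:A|lborel. f (x + ?h n *\<^sub>R v) - f x) = 0"
        using set_integral_diff(2)[OF i2 i1] inv[of "?h n"] elim by simp
      finally show ?case by simp
    qed
  qed
  ultimately show ?thesis using LIMSEQ_unique[OF _ tendsto_eventually] by blast
qed

lemma dd_mult:
  fixes f g :: "'a::real_normed_vector \<Rightarrow> real"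
  assumes "f differentiable (at x)" "g differentiable (at x)"
  shows "dd v (\<lambda>x. f x * g x) x = f x * dd v g x + dd v f x * g x"
  by (rule dd_eqI[OF has_derivative_mult[OF dd_has_derivative[OF assms(1)] dd_has_derivative[OF assms(2)]]])

lemma cell_integral_by_parts:
  fixes f g :: "real^2 \<Rightarrow> real"
  assumes "smooth_on UNIV f" "smooth_on UNIV g" "periodic f" "periodic g"
  shows "(LINT x:cell|lborel. f x * dd v g x) = - (LINT x:cell|lborel. dd v f x * g x)"
proof -
  have sm: "smooth_on UNIV (\<lambda>x. f x * g x)" using assms by (intro smooth_on_mult) auto
  have "(LINT x:cell|lborel. dd v (\<lambda>x. f x * g x) x) = 0"
  proof (rule integral_dd_eq_0[OF bounded_cell cell_borel sm zero_less_one])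
    show "(LINT x:cell|lborel. f (x + h *\<^sub>R v) * g (x + h *\<^sub>R v)) = (LINT x:cell|lborel. f x * g x)" for h
      using cell_integral_translate[of "\<lambda>x. f x * g x" "h *\<^sub>R v"] smooth_on_continuous[OF sm]
        borel_measurable_continuous_onI assms(3,4) unfolding periodic_def by auto
  qed
  also have "dd v (\<lambda>x. f x * g x) = (\<lambda>x. f x * dd v g x + dd v f x * g x)"
    using assms dd_mult smooth_on_differentiable by blast
  also have "(LINT x:cell|lborel. f x * dd v g x + dd v f x * g x)
     = (LINT x:cell|lborel. f x * dd v g x) + (LINT x:cell|lborel. dd v f x * g x)"
    by (intro set_integral_add set_integrable_bounded_continuous bounded_cell cell_borel smooth_on_continuous
        smooth_on_mult smooth_on_dd assms) auto
  finally show ?thesis by simp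
qed

text \<open>The second difference \<open>\<Delta> v w s\<close> is symmetric in the two directions.
  Two applications of the mean value theorem turn it into \<open>s * s\<close> times the mixed
  derivative at a nearby point; dividing and letting \<open>s\<close> tend to zero gives the mixed
  derivative at \<open>x\<close>, in either order.\<close>

lemma dd_commute:
  fixes f :: "'a::real_normed_vector \<Rightarrow> real"
  assumes f: "smooth_on UNIV f"
  shows "dd v (dd w f) x = dd w (dd v f) x"
proof -
  have line: "((\<lambda>s. g (y + s *\<^sub>R z)) has_real_derivative dd z g (y + s *\<^sub>R z)) (at s)"
    if "smooth_on UNIV g" for g :: "'a \<Rightarrow> real" and y z s
    using that by (intro dd_line smooth_on_differentiable[of UNIV]) auto
  define \<Delta> where "\<Delta> v w s = f (x + s *\<^sub>R v + s *\<^sub>R w) - f (x + s *\<^sub>R v) - f (x + s *\<^sub>R w) + f x" for v w s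
  have mv: "\<exists>\<xi> \<eta>. 0 < \<xi> \<and> \<xi> < s \<and> 0 < \<eta> \<and> \<eta> < s \<and> \<Delta> v w s = s * s * dd w (dd v f) (x + \<xi> *\<^sub>R v + \<eta> *\<^sub>R w)"
    if pos: "s > 0" for s v w
  proof -
    have d: "((\<lambda>r. f (x + s *\<^sub>R w + r *\<^sub>R v) - f (x + r *\<^sub>R v)) has_real_derivative
        dd v f (x + s *\<^sub>R w + r *\<^sub>R v) - dd v f (x + r *\<^sub>R v)) (at r)" for r
      by (intro DERIV_diff line f)
    obtain \<xi> where \<xi>: "0 < \<xi>" "\<xi> < s" and
      e1: "f (x + s *\<^sub>R w + s *\<^sub>R v) - f (x + s *\<^sub>R v) - (f (x + s *\<^sub>R w + 0 *\<^sub>R v) - f (x + 0 *\<^sub>R v))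
        = (s - 0) * (dd v f (x + s *\<^sub>R w + \<xi> *\<^sub>R v) - dd v f (x + \<xi> *\<^sub>R v))"
      using MVT2[OF pos d] by blast
    obtain \<eta> where \<eta>: "0 < \<eta>" "\<eta> < s" and
      e2: "dd v f (x + \<xi> *\<^sub>R v + s *\<^sub>R w) - dd v f (x + \<xi> *\<^sub>R v + 0 *\<^sub>R w)
        = (s - 0) * dd w (dd v f) (x + \<xi> *\<^sub>R v + \<eta> *\<^sub>R w)"
      using MVT2[OF pos line[OF smooth_on_dd[OF f, of v]]] by blast
    have "\<Delta> v w s = s * (dd v f (x + \<xi> *\<^sub>R v + s *\<^sub>R w) - dd v f (x + \<xi> *\<^sub>R v))"
      using e1 unfolding \<Delta>_def by (simp add: add_ac)
    then show ?thesis using e2 \<xi> \<eta> by auto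
  qed
  have lim: "(\<lambda>n. \<Delta> v w (inverse (real (Suc n))) / (inverse (real (Suc n)))^2) \<longlonglongrightarrow> dd w (dd v f) x" for v w
  proof -
    let ?h = "\<lambda>n. inverse (real (Suc n))"
    have "\<exists>\<xi> \<eta>. 0 < \<xi> \<and> \<xi> < ?h n \<and> 0 < \<eta> \<and> \<eta> < ?h n \<and>
        \<Delta> v w (?h n) / (?h n)^2 = dd w (dd v f) (x + \<xi> *\<^sub>R v + \<eta> *\<^sub>R w)" for n
      using mv[of "?h n" v w] by (force simp: power2_eq_square)
    then obtain \<xi> \<eta> where x: "\<And>n. 0 < \<xi> n" "\<And>n. \<xi> n < ?h n" "\<And>n. 0 < \<eta> n" "\<And>n. \<eta> n < ?h n"
      and e: "\<And>n. \<Delta> v w (?h n) / (?h n)^2 = dd w (dd v f) (x + \<xi> n *\<^sub>R v + \<eta> n *\<^sub>R w)"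
      by metis
    have sq: "z \<longlonglongrightarrow> 0" if "\<And>n. 0 < z n" "\<And>n. z n < ?h n" for z
      by (rule tendsto_sandwich[OF always_eventually always_eventually tendsto_const LIMSEQ_inverse_real_of_nat])
        (intro allI less_imp_le that)+
    have "\<xi> \<longlonglongrightarrow> 0" "\<eta> \<longlonglongrightarrow> 0" using x by (intro sq; blast)+
    then have "(\<lambda>n. x + \<xi> n *\<^sub>R v + \<eta> n *\<^sub>R w) \<longlonglongrightarrow> x + 0 *\<^sub>R v + 0 *\<^sub>R w" by (intro tendsto_intros)
    moreover have "isCont (dd w (dd v f)) x"
      using smooth_on_continuous[OF smooth_on_dd[OF smooth_on_dd[OF f]]] continuous_on_eq_continuous_at open_UNIV by blast
    ultimately have "(\<lambda>n. dd w (dd v f) (x + \<xi> n *\<^sub>R v + \<eta> n *\<^sub>R w)) \<longlonglongrightarrow> dd w (dd v f) x"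
      using isCont_tendsto_compose[of x "dd w (dd v f)"] by simp
    then show ?thesis unfolding e .
  qed
  have "\<Delta> v w s = \<Delta> w v s" for s by (simp add: \<Delta>_def add_ac)
  then show ?thesis using LIMSEQ_unique[OF lim[of v w]] lim[of w v] by simp
qed

section \<open>The enstrophy balance\<close>

definition xper :: "(real \<times> (real^2) \<Rightarrow> 'b) \<Rightarrow> bool" where
  "xper F \<longleftrightarrow> (\<forall>t. periodic (\<lambda>x. F (t, x)))"

definition stint :: "real \<Rightarrow> (real \<times> (real^2) \<Rightarrow> real) \<Rightarrow> real" where
  "stint T F = (LINT p:({0..<T} \<times> cell)|lborel. F p)"

lemma xper_mult: "xper F \<Longrightarrow> xper G \<Longrightarrow> xper (\<lambda>p. F p * G p :: real)"
  and xper_add: "xper F \<Longrightarrow> xper G \<Longrightarrow> xper (\<lambda>p. F p + G p :: real)"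
  and xper_diff: "xper F \<Longrightarrow> xper G \<Longrightarrow> xper (\<lambda>p. F p - G p :: real)"
  and xper_uminus: "xper F \<Longrightarrow> xper (\<lambda>p. - F p :: real)"
  and xper_time: "xper (\<lambda>p. X (fst p) :: real)"
  unfolding xper_def periodic_def by auto

lemma dd_translate:
  fixes f :: "'a::real_normed_vector \<Rightarrow> 'b::real_normed_vector"
  shows "dd v (\<lambda>x. f (x + c)) x = dd v f (x + c)"
proof -
  have "((\<lambda>x. f (x + c)) has_derivative D) (at x) \<longleftrightarrow> (f has_derivative D) (at (x + c))" for D
  proof -
    have shift: "((\<lambda>x. g (x + d)) has_derivative D) (at y)" if "(g has_derivative D) (at (y + d))"
      for g :: "'a \<Rightarrow> 'b" and d y
    proof -
      have "((\<lambda>x. x + d) has_derivative (\<lambda>v. v)) (at y)" by (auto intro!: derivative_eq_intros)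
      from has_derivative_compose[OF this that] show ?thesis .
    qed
    show ?thesis using shift[of f x c] shift[of "\<lambda>x. f (x + c)" "x + c" "- c"] by auto
  qed
  then show ?thesis unfolding dd_def frechet_derivative_def by simp
qed

lemma periodic_dd: "periodic f \<Longrightarrow> periodic (dd v f)"
  unfolding periodic_def
proof safe
  fix x k assume f: "\<forall>x k. (\<forall>i. k $ i \<in> \<int>) \<longrightarrow> f (x + k) = f x" and k: "\<forall>i. (k :: real^2) $ i \<in> \<int>"
  then have "(\<lambda>x. f (x + k)) = f" by auto
  then show "dd v f (x + k) = dd v f x" using dd_translate[of v f k x] by simp
qed

lemma xper_dd: "xper F \<Longrightarrow> xper (dd v F)" for F :: "_ \<Rightarrow> 'b::real_normed_vector"
  unfolding xper_def periodic_def
proof safe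
  fix t x k assume F: "\<forall>t x k. (\<forall>i. k $ i \<in> \<int>) \<longrightarrow> F (t, x + k) = F (t, x)" and k: "\<forall>i. (k :: real^2) $ i \<in> \<int>"
  then have "(\<lambda>p. F (p + (0, k))) = F" by auto
  then show "dd v F (t, x + k) = dd v F (t, x)" using dd_translate[of v F "(0, k)" "(t, x)"] by simp
qed

lemma dd_mult_fun:
  fixes f g :: "'a::real_normed_vector \<Rightarrow> real"
  assumes "smooth_on UNIV f" "smooth_on UNIV g"
  shows "dd v (\<lambda>x. f x * g x) = (\<lambda>x. f x * dd v g x + dd v f x * g x)"
  using assms dd_mult smooth_on_differentiable by blast

lemma dd_add_fun:
  assumes "smooth_on UNIV f" "smooth_on UNIV g"
  shows "dd v (\<lambda>x. f x + g x) = (\<lambda>x. dd v f x + dd v g x)"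
  by (rule ext, rule dd_eqI) (intro has_derivative_add smooth_on_has_derivative[OF assms(1)] smooth_on_has_derivative[OF assms(2)] UNIV_I)

lemma dd_diff_fun:
  assumes "smooth_on UNIV f" "smooth_on UNIV g"
  shows "dd v (\<lambda>x. f x - g x) = (\<lambda>x. dd v f x - dd v g x)"
  by (rule ext, rule dd_eqI) (intro has_derivative_diff smooth_on_has_derivative[OF assms(1)] smooth_on_has_derivative[OF assms(2)] UNIV_I)

lemma dd_uminus_fun:
  assumes "smooth_on UNIV f"
  shows "dd v (\<lambda>x. - f x) = (\<lambda>x. - dd v f x)"
  by (rule ext, rule dd_eqI) (intro has_derivative_minus smooth_on_has_derivative[OF assms(1)] UNIV_I)

lemma dd_cmult_fun:
  fixes f :: "'a::real_normed_vector \<Rightarrow> real"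
  assumes "smooth_on UNIV f"
  shows "dd v (\<lambda>x. c * f x) = (\<lambda>x. c * dd v f x)"
  by (rule ext, rule dd_eqI) (intro has_derivative_mult_right smooth_on_has_derivative[OF assms(1)] UNIV_I)

lemma dd_commute_fun:
  fixes f :: "'a::real_normed_vector \<Rightarrow> real"
  shows "smooth_on UNIV f \<Longrightarrow> dd v (dd w f) = dd w (dd v f)"
  using dd_commute by blast

lemma bounded_stcell: "bounded ({0..<T::real} \<times> cell)"
  by (intro bounded_Times bounded_cell) (rule bounded_subset[OF compact_imp_bounded[OF compact_Icc[of 0 T]]], auto)

lemma stcell_borel [measurable]: "{0..<T::real} \<times> cell \<in> sets borel"
  unfolding borel_prod[symmetric] by (intro pair_measureI) auto

lemma stint_iterated:
  assumes "continuous_on UNIV F"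
  shows "stint T F = (LINT t:{0..<T}|lborel. LINT x:cell|lborel. F (t, x))"
    and "set_integrable lborel {0..<T} (\<lambda>t. LINT x:cell|lborel. F (t, x))"
proof -
  have i: "integrable (lborel \<Otimes>\<^sub>M lborel) (\<lambda>p. indicator ({0..<T} \<times> cell) p *\<^sub>R F p)"
    using set_integrable_bounded_continuous[OF bounded_stcell stcell_borel assms]
    unfolding set_integrable_def lborel_prod .
  have eq: "(\<integral>y. indicator ({0..<T} \<times> cell) (t, y) *\<^sub>R F (t, y) \<partial>lborel)
      = indicator {0..<T} t *\<^sub>R (LINT x:cell|lborel. F (t, x))" for t
    by (auto simp: indicator_times set_lebesgue_integral_def indicator_def)
  show "stint T F = (LINT t:{0..<T}|lborel. LINT x:cell|lborel. F (t, x))"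
    using lborel_pair.integral_fst'[OF i]
    unfolding stint_def set_lebesgue_integral_def[of _ "{0..<T} \<times> cell"] eq lborel_prod
    by (simp add: set_lebesgue_integral_def)
  show "set_integrable lborel {0..<T} (\<lambda>t. LINT x:cell|lborel. F (t, x))"
    using lborel_pair.integrable_fst'[OF i] unfolding eq set_integrable_def .
qed

lemma stint_integrable:
  fixes F :: "real \<times> (real^2) \<Rightarrow> real"
  shows "continuous_on UNIV F \<Longrightarrow> set_integrable lborel ({0..<T} \<times> cell) F"
  by (rule set_integrable_bounded_continuous[OF bounded_stcell stcell_borel])

lemma stint_add:
  assumes "continuous_on UNIV F" "continuous_on UNIV G"
  shows "stint T (\<lambda>p. F p + G p) = stint T F + stint T G"
  unfolding stint_def using assms by (intro set_integral_add stint_integrable)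

lemma stint_diff:
  assumes "continuous_on UNIV F" "continuous_on UNIV G"
  shows "stint T (\<lambda>p. F p - G p) = stint T F - stint T G"
  unfolding stint_def using assms by (intro set_integral_diff stint_integrable)

lemma stint_cmult: "stint T (\<lambda>p. c * F p) = c * stint T F"
  unfolding stint_def by simp

lemma stint_dd_space:
  assumes F: "smooth_on UNIV F" "xper F"
  shows "stint T (dd (0, w) F) = 0"
  unfolding stint_def
proof (rule integral_dd_eq_0[OF bounded_stcell stcell_borel F(1) zero_less_one])
  fix h :: real
  have c: "continuous_on UNIV F" by (rule smooth_on_continuous[OF F(1)])
  have c': "continuous_on UNIV (\<lambda>p. F (p + h *\<^sub>R (0, w)))"
    by (rule continuous_on_compose2[OF c]) (auto intro!: continuous_intros)
  have "(LINT x:cell|lborel. F (t, x + h *\<^sub>R w)) = (LINT x:cell|lborel. F (t, x))" for t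
  proof (rule cell_integral_translate)
    have "continuous_on UNIV (\<lambda>x. F (t, x))"
      by (rule continuous_on_compose2[OF c]) (auto intro!: continuous_intros)
    then show "(\<lambda>x. F (t, x)) \<in> borel_measurable borel" by (rule borel_measurable_continuous_onI)
    show "periodic (\<lambda>x. F (t, x))" using F(2) unfolding xper_def by blast
  qed
  then show "(LINT x:{0..<T} \<times> cell|lborel. F (x + h *\<^sub>R (0, w))) = (LINT x:{0..<T} \<times> cell|lborel. F x)"
    using stint_iterated(1)[OF c, of T] stint_iterated(1)[OF c', of T] unfolding stint_def by simp
qed

lemma stint_dd_time:
  assumes F: "smooth_on UNIV F" and ab: "0 < a" "b < T" "\<And>t x. t \<notin> {a..b} \<Longrightarrow> F (t, x) = 0"
  shows "stint T (dd (1, 0) F) = 0"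
  unfolding stint_def
proof (rule integral_dd_eq_0[OF bounded_stcell stcell_borel F])
  show "min a (T - b) > 0" using ab by simp
  fix h :: real assume h: "0 < h" "h \<le> min a (T - b)"
  let ?g = "\<lambda>p. indicator (UNIV \<times> cell) p * F p"
  have c: "continuous_on UNIV F" by (rule smooth_on_continuous[OF F])
  have m: "UNIV \<times> cell \<in> sets (borel :: (real \<times> (real^2)) measure)"
    unfolding borel_prod[symmetric] by (intro pair_measureI) auto
  have [measurable]: "?g \<in> borel_measurable borel"
    using m borel_measurable_continuous_onI[OF c] by (intro borel_measurable_times borel_measurable_indicator) auto
  have 1: "indicator ({0..<T} \<times> cell) p *\<^sub>R F (p + h *\<^sub>R (1, 0)) = ?g ((h, 0) + p)" for p
    using ab(3)[of "fst p + h" "snd p"] h ab(1,2)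
    by (cases p, cases "fst p + h \<in> {a..b}") (auto simp: indicator_def add_ac)
  have 2: "indicator ({0..<T} \<times> cell) p *\<^sub>R F p = ?g p" for p
    using ab(3)[of "fst p" "snd p"] ab(1,2)
    by (cases p, cases "fst p \<in> {a..b}") (auto simp: indicator_def)
  have "(\<integral>p. ?g ((h, 0) + p) \<partial>lborel) = (\<integral>p. ?g p \<partial>distr lborel borel ((+) (h, 0)))"
    by (rule integral_distr[symmetric]) auto
  then show "(LINT x:{0..<T} \<times> cell|lborel. F (x + h *\<^sub>R (1, 0))) = (LINT x:{0..<T} \<times> cell|lborel. F x)"
    unfolding set_lebesgue_integral_def 1 2 lborel_distr_plus .
qed

lemma stint_by_parts_space:
  assumes "smooth_on UNIV F" "smooth_on UNIV G" "xper F" "xper G"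
  shows "stint T (\<lambda>p. F p * dd (0, w) G p) = - stint T (\<lambda>p. dd (0, w) F p * G p)"
proof -
  have "0 = stint T (dd (0, w) (\<lambda>p. F p * G p))"
    by (rule stint_dd_space[symmetric]) (intro smooth_on_mult xper_mult assms open_UNIV)+
  also have "\<dots> = stint T (\<lambda>p. F p * dd (0, w) G p) + stint T (\<lambda>p. dd (0, w) F p * G p)"
    unfolding dd_mult_fun[OF assms(1,2)]
    by (intro stint_add smooth_on_continuous smooth_on_mult smooth_on_dd assms open_UNIV)
  finally show ?thesis by simp
qed

lemma stint_by_parts_time:
  assumes "smooth_on UNIV F" "smooth_on UNIV G"
    and "0 < a" "b < T" "\<And>t x. t \<notin> {a..b} \<Longrightarrow> F (t, x) = 0"
  shows "stint T (\<lambda>p. F p * dd (1, 0) G p) = - stint T (\<lambda>p. dd (1, 0) F p * G p)"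
proof -
  have "0 = stint T (dd (1, 0) (\<lambda>p. F p * G p))"
    by (rule stint_dd_time[OF _ assms(3,4), symmetric])
      (auto intro!: smooth_on_mult assms(1,2) simp: assms(5))
  also have "\<dots> = stint T (\<lambda>p. F p * dd (1, 0) G p) + stint T (\<lambda>p. dd (1, 0) F p * G p)"
    unfolding dd_mult_fun[OF assms(1,2)]
    by (intro stint_add smooth_on_continuous smooth_on_mult smooth_on_dd assms open_UNIV)
  finally show ?thesis by simp
qed

abbreviation "D0 \<equiv> dd (1::real, 0::real^2)"
abbreviation "D1 \<equiv> dd (0::real, axis 1 1::real^2)"
abbreviation "D2 \<equiv> dd (0::real, axis 2 1::real^2)"

lemma smooth_on_time:
  fixes X :: "real \<Rightarrow> 'b::real_normed_vector"
  assumes "smooth_on UNIV X"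
  shows "smooth_on UNIV (\<lambda>p::real \<times> (real^2). X (fst p))"
  using smooth_on_compose_affine[OF bounded_linear_fst, of UNIV UNIV 0 X] assms by simp

lemma dd_time:
  assumes "(X has_real_derivative X') (at (fst p))"
  shows "dd (s, w) (\<lambda>p. X (fst p)) p = s * X'"
proof -
  have "((\<lambda>p. X (fst p)) has_derivative (\<lambda>v. fst v * X')) (at p)"
    using has_derivative_compose[OF has_derivative_fst[OF has_derivative_ident] assms[unfolded has_field_derivative_def]]
    by (simp add: mult.commute)
  from dd_eqI[OF this] show ?thesis by simp
qed

lemmas smooth_intros = smooth_on_mult[OF open_UNIV] smooth_on_add[OF open_UNIV] smooth_on_diff[OF open_UNIV]
  smooth_on_uminus[OF open_UNIV] smooth_on_dd smooth_on_const[OF open_UNIV]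
lemmas xper_intros = xper_mult xper_add xper_diff xper_uminus xper_dd xper_time

text \<open>The pair \<open>(P, Q)\<close> is the rotated gradient of
  \<open>\<theta> \<omega>\<close>, hence divergence-free and admissible. Testing the momentum
  equation with it amounts to testing the vorticity equation with \<open>\<theta> \<omega>\<close>,
  by the formula \<open>curl\<close> in the proof. Since \<open>\<theta>\<close> depends on time
  only, it passes through all space derivatives.\<close>

lemma enstrophy_identity:
  fixes U V :: "real \<times> (real^2) \<Rightarrow> real" and \<theta> \<theta>' :: "real \<Rightarrow> real"
  defines "\<omega> \<equiv> \<lambda>p. D1 V p - D2 U p"
  defines "P \<equiv> \<lambda>p. - (\<theta> (fst p) * D2 (\<lambda>p. D1 V p - D2 U p) p)"
  defines "Q \<equiv> \<lambda>p. \<theta> (fst p) * D1 (\<lambda>p. D1 V p - D2 U p) p"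
  assumes U: "smooth_on UNIV U" "xper U" and V: "smooth_on UNIV V" "xper V"
    and div: "\<And>p. D1 U p + D2 V p = 0"
    and \<theta>: "smooth_on UNIV \<theta>" "\<And>t. (\<theta> has_real_derivative \<theta>' t) (at t)"
    and ab: "0 < a" "b < T" "\<And>t. t \<notin> {a..b} \<Longrightarrow> \<theta> t = 0"
    and weak: "stint T (\<lambda>p. U p * D0 P p + V p * D0 Q p
        + (U p * (U p * D1 P p + V p * D1 Q p) + V p * (U p * D2 P p + V p * D2 Q p))
        + \<nu> * (U p * (D1 (D1 P) p + D2 (D2 P) p) + V p * (D1 (D1 Q) p + D2 (D2 Q) p))) = 0"
  shows "\<nu> * stint T (\<lambda>p. \<theta> (fst p) * ((D1 \<omega> p)\<^sup>2 + (D2 \<omega> p)\<^sup>2)) = 1/2 * stint T (\<lambda>p. \<theta>' (fst p) * (\<omega> p)\<^sup>2)"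
proof -
  define X where "X = (\<lambda>p::real \<times> (real^2). \<theta> (fst p))"
  have X: "smooth_on UNIV X" "xper X" unfolding X_def by (intro smooth_on_time \<theta> xper_time)+
  have X0: "D0 X = (\<lambda>p. \<theta>' (fst p))" and X1: "D1 X = (\<lambda>p. 0)" and X2: "D2 X = (\<lambda>p. 0)"
    unfolding X_def by (intro ext; simp add: dd_time[OF \<theta>(2)])+
  have \<omega>: "smooth_on UNIV \<omega>" "xper \<omega>" unfolding \<omega>_def by (intro smooth_intros xper_intros U V)+
  define g where "g = (\<lambda>p. X p * \<omega> p)"
  have g: "smooth_on UNIV g" "xper g" unfolding g_def by (intro smooth_intros xper_intros X \<omega>)+
  have g1: "D1 g = (\<lambda>p. X p * D1 \<omega> p)" and g2: "D2 g = (\<lambda>p. X p * D2 \<omega> p)"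
    unfolding g_def by (simp_all add: dd_mult_fun X \<omega> X1 X2)
  have gz: "g (t, x) = 0" if "t \<notin> {a..b}" for t x using ab(3)[OF that] by (simp add: g_def X_def)
  have P: "P = (\<lambda>p. - D2 g p)" and Q: "Q = D1 g"
    unfolding P_def Q_def g1 g2 X_def \<omega>_def by auto
  note sm = smooth_intros U(1) V(1) X(1) \<omega>(1) g(1)
  note xp = xper_intros U(2) V(2) X(2) \<omega>(2) g(2)
  note ct = smooth_on_continuous[of UNIV]
  have PQ: "smooth_on UNIV P" "smooth_on UNIV Q" "xper P" "xper Q" unfolding P Q by (intro sm xp)+
  note by_parts = stint_by_parts_space[of _ _ T]

  \<comment> \<open>testing against the rotated gradient of \<open>h\<close>\<close>
  have curl: "stint T (\<lambda>p. V p * D1 h p - U p * D2 h p) = - stint T (\<lambda>p. \<omega> p * h p)"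
    if h: "smooth_on UNIV h" "xper h" for h
  proof -
    have "stint T (\<lambda>p. V p * D1 h p - U p * D2 h p)
        = stint T (\<lambda>p. V p * D1 h p) - stint T (\<lambda>p. U p * D2 h p)"
      by (intro stint_diff ct sm h)
    also have "\<dots> = - stint T (\<lambda>p. D1 V p * h p) + stint T (\<lambda>p. D2 U p * h p)"
      by (subst (1 2) by_parts) (intro U V h | simp)+
    also have "\<dots> = - stint T (\<lambda>p. D1 V p * h p - D2 U p * h p)"
      by (subst stint_diff) (intro ct sm h | simp)+
    finally show ?thesis by (simp add: \<omega>_def algebra_simps)
  qed

  have time: "stint T (\<lambda>p. U p * D0 P p + V p * D0 Q p) = - (1/2) * stint T (\<lambda>p. \<theta>' (fst p) * (\<omega> p)\<^sup>2)"
  proof -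
    have "D0 P = (\<lambda>p. - D2 (D0 g) p)" "D0 Q = D1 (D0 g)"
      unfolding P Q by (auto simp: dd_uminus_fun sm dd_commute_fun[OF g(1), of "(1, 0)"])
    then have "stint T (\<lambda>p. U p * D0 P p + V p * D0 Q p) = - stint T (\<lambda>p. \<omega> p * D0 g p)"
      using curl[OF smooth_on_dd[OF g(1)] xper_dd[OF g(2)]] by (simp add: algebra_simps)
    \<comment> \<open>Integration by parts makes the integrals of \<open>\<omega> * D0 g\<close> and
      \<open>g * D0 \<omega>\<close> opposite, while the difference of the integrands is
      \<open>\<theta>'\<close> times the squared vorticity. Each integral is therefore half of that,
      up to sign.\<close>
    moreover have "stint T (\<lambda>p. g p * D0 \<omega> p) = - stint T (\<lambda>p. D0 g p * \<omega> p)"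
      by (rule stint_by_parts_time[OF g(1) \<omega>(1) ab(1,2) gz])
    moreover have "stint T (\<lambda>p. \<omega> p * D0 g p) - stint T (\<lambda>p. g p * D0 \<omega> p) = stint T (\<lambda>p. \<omega> p * D0 g p - g p * D0 \<omega> p)"
      by (intro stint_diff[symmetric] ct sm)
    moreover have "(\<lambda>p. \<omega> p * D0 g p - g p * D0 \<omega> p) = (\<lambda>p. \<theta>' (fst p) * (\<omega> p)\<^sup>2)"
      unfolding g_def by (simp add: dd_mult_fun sm X0 algebra_simps power2_eq_square)
    ultimately show ?thesis by (simp add: mult.commute)
  qed

  have visc: "stint T (\<lambda>p. U p * (D1 (D1 P) p + D2 (D2 P) p) + V p * (D1 (D1 Q) p + D2 (D2 Q) p))
      = stint T (\<lambda>p. \<theta> (fst p) * ((D1 \<omega> p)\<^sup>2 + (D2 \<omega> p)\<^sup>2))"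
  proof -
    \<comment> \<open>The rotated gradient commutes with the Laplacian, so the viscous term is again
      of the form treated by \<open>curl\<close>, now with the Laplacian \<open>L\<close> of
      \<open>g\<close>.\<close>
    define L where "L = (\<lambda>p. D1 (D1 g) p + D2 (D2 g) p)"
    have L: "smooth_on UNIV L" "xper L" unfolding L_def by (intro sm xp)+
    have c12: "D2 (D1 g) = D1 (D2 g)" by (rule dd_commute_fun[OF g(1)])
    have L1: "D1 L = (\<lambda>p. D1 (D1 (D1 g)) p + D1 (D2 (D2 g)) p)" and
      L2: "D2 L = (\<lambda>p. D2 (D1 (D1 g)) p + D2 (D2 (D2 g)) p)"
      unfolding L_def by (intro dd_add_fun sm)+
    have "D1 (D1 P) p + D2 (D2 P) p = - D2 L p" for p
    proof -
      have "D1 (D1 P) = (\<lambda>p. - D1 (D1 (D2 g)) p)" "D2 (D2 P) = (\<lambda>p. - D2 (D2 (D2 g)) p)"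
        unfolding P by (simp_all add: dd_uminus_fun sm)
      moreover have "D1 (D1 (D2 g)) = D2 (D1 (D1 g))"
        unfolding c12[symmetric] by (rule dd_commute_fun[OF smooth_on_dd[OF g(1)]])
      ultimately show ?thesis using L2 by simp
    qed
    moreover have "D1 (D1 Q) p + D2 (D2 Q) p = D1 L p" for p
    proof -
      have "D2 (D2 (D1 g)) = D1 (D2 (D2 g))"
        unfolding c12 by (rule dd_commute_fun[OF smooth_on_dd[OF g(1)]])
      then show ?thesis using L1 unfolding Q by simp
    qed
    ultimately have "stint T (\<lambda>p. U p * (D1 (D1 P) p + D2 (D2 P) p) + V p * (D1 (D1 Q) p + D2 (D2 Q) p))
        = - stint T (\<lambda>p. \<omega> p * L p)"
      using curl[OF L] by (simp add: algebra_simps)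
    also have "stint T (\<lambda>p. \<omega> p * L p) = stint T (\<lambda>p. \<omega> p * D1 (D1 g) p + \<omega> p * D2 (D2 g) p)"
      by (simp add: L_def algebra_simps)
    also have "\<dots> = stint T (\<lambda>p. \<omega> p * D1 (D1 g) p) + stint T (\<lambda>p. \<omega> p * D2 (D2 g) p)"
      by (intro stint_add ct sm)
    also have "\<dots> = - (stint T (\<lambda>p. D1 \<omega> p * D1 g p) + stint T (\<lambda>p. D2 \<omega> p * D2 g p))"
      by (subst (1 2) by_parts) (intro sm xp | simp)+
    also have "\<dots> = - stint T (\<lambda>p. D1 \<omega> p * D1 g p + D2 \<omega> p * D2 g p)"
      by (subst stint_add) (intro ct sm | simp)+
    finally show ?thesis by (simp add: g1 g2 X_def algebra_simps power2_eq_square)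
  qed

  have nonlin: "stint T (\<lambda>p. U p * (U p * D1 P p + V p * D1 Q p) + V p * (U p * D2 P p + V p * D2 Q p)) = 0"
  proof -
    \<comment> \<open>By incompressibility the convective term is the gradient of the kinetic energy
      density \<open>q\<close> plus \<omega> (-V, U). Against the rotated gradient of
      \<open>g\<close> the first part gives a Jacobian of \<open>q\<close> and \<open>g\<close>,
      which integrates to zero by symmetry of second derivatives. The second gives the transport of
      \<open>r\<close>, half of \<theta> \<omega>^2, which integrates to zero by incompressibility.
      The latter expresses the absence of vortex stretching.\<close>
    define q where "q = (\<lambda>p. 1/2 * (U p * U p + V p * V p))"
    define r where "r = (\<lambda>p. 1/2 * (g p * \<omega> p))"
    have q: "smooth_on UNIV q" "xper q" and r: "smooth_on UNIV r" "xper r"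
      unfolding q_def r_def by (intro sm xp xper_time[where X="\<lambda>_. 1/2"])+
    have q1: "D1 q = (\<lambda>p. U p * D1 U p + V p * D1 V p)" and q2: "D2 q = (\<lambda>p. U p * D2 U p + V p * D2 V p)"
      unfolding q_def by (subst dd_cmult_fun, (intro sm)[1], simp add: dd_add_fun dd_mult_fun sm algebra_simps)+
    have r1: "D1 r = (\<lambda>p. X p * \<omega> p * D1 \<omega> p)" and r2: "D2 r = (\<lambda>p. X p * \<omega> p * D2 \<omega> p)"
      unfolding r_def
      by (subst dd_cmult_fun, (intro sm)[1], simp add: dd_mult_fun sm g1 g2, simp add: g_def algebra_simps)+
    have "stint T (\<lambda>p. U p * (U p * D1 P p + V p * D1 Q p) + V p * (U p * D2 P p + V p * D2 Q p))
      = stint T (\<lambda>p. (U p * U p) * D1 P p + (U p * V p) * D1 Q p + (U p * V p) * D2 P p + (V p * V p) * D2 Q p)"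
      by (simp add: algebra_simps)
    also have "\<dots> = stint T (\<lambda>p. (U p * U p) * D1 P p) + stint T (\<lambda>p. (U p * V p) * D1 Q p)
       + stint T (\<lambda>p. (U p * V p) * D2 P p) + stint T (\<lambda>p. (V p * V p) * D2 Q p)"
      by (subst stint_add, (intro ct sm PQ)[1], (intro ct sm PQ)[1])+ (rule refl)
    also have "\<dots> = - stint T (\<lambda>p. D1 (\<lambda>p. U p * U p) p * P p) - stint T (\<lambda>p. D1 (\<lambda>p. U p * V p) p * Q p)
       - stint T (\<lambda>p. D2 (\<lambda>p. U p * V p) p * P p) - stint T (\<lambda>p. D2 (\<lambda>p. V p * V p) p * Q p)"
      by (simp add: by_parts[of "\<lambda>p. U p * U p"] by_parts[of "\<lambda>p. U p * V p"] by_parts[of "\<lambda>p. V p * V p"] sm xp PQ)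
    also have "\<dots> = - stint T (\<lambda>p. D1 (\<lambda>p. U p * U p) p * P p + D1 (\<lambda>p. U p * V p) p * Q p
       + D2 (\<lambda>p. U p * V p) p * P p + D2 (\<lambda>p. V p * V p) p * Q p)"
      by (subst stint_add, (intro ct sm PQ)[1], (intro ct sm PQ)[1])+ simp
    also have "\<dots> = - stint T (\<lambda>p. (D2 q p * D1 g p - D1 q p * D2 g p) + (U p * D1 r p + V p * D2 r p))"
    proof -
      have "D1 (\<lambda>p. U p * U p) p * P p + D1 (\<lambda>p. U p * V p) p * Q p
         + D2 (\<lambda>p. U p * V p) p * P p + D2 (\<lambda>p. V p * V p) p * Q p
         = (D2 q p * D1 g p - D1 q p * D2 g p) + (U p * D1 r p + V p * D2 r p)" for p
      proof -
        have d: "D2 V p = - D1 U p" using div[of p] by simp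
        show ?thesis
          unfolding dd_mult_fun[OF U(1) U(1)] dd_mult_fun[OF U(1) V(1)] dd_mult_fun[OF V(1) V(1)]
            P Q q1 q2 r1 r2 g1 g2 d
          by (simp add: \<omega>_def algebra_simps)
      qed
      then show ?thesis by (simp only:)
    qed
    also have "stint T (\<lambda>p. (D2 q p * D1 g p - D1 q p * D2 g p) + (U p * D1 r p + V p * D2 r p)) = 0"
    proof -
      have "stint T (\<lambda>p. (D2 q p * D1 g p - D1 q p * D2 g p) + (U p * D1 r p + V p * D2 r p))
        = (stint T (\<lambda>p. D2 q p * D1 g p) - stint T (\<lambda>p. D1 q p * D2 g p))
          + (stint T (\<lambda>p. U p * D1 r p) + stint T (\<lambda>p. V p * D2 r p))"
        by (simp add: stint_add stint_diff ct sm q r)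
      moreover have "stint T (\<lambda>p. D2 q p * D1 g p) = - stint T (\<lambda>p. D1 (D2 q) p * g p)"
        "stint T (\<lambda>p. D1 q p * D2 g p) = - stint T (\<lambda>p. D2 (D1 q) p * g p)"
        "stint T (\<lambda>p. U p * D1 r p) = - stint T (\<lambda>p. D1 U p * r p)"
        "stint T (\<lambda>p. V p * D2 r p) = - stint T (\<lambda>p. D2 V p * r p)"
        by (rule by_parts; intro sm xp q r)+
      moreover have "D2 (D1 q) = D1 (D2 q)" by (rule dd_commute_fun[OF q(1)])
      moreover have "stint T (\<lambda>p. D1 U p * r p) + stint T (\<lambda>p. D2 V p * r p) = stint T (\<lambda>p. D1 U p * r p + D2 V p * r p)"
        by (intro stint_add[symmetric] ct sm r)
      moreover have "D1 U p * r p + D2 V p * r p = 0 * r p" for p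
        using div[of p] by (simp add: distrib_right[symmetric])
      ultimately show ?thesis using stint_cmult[of T 0 r] by simp
    qed
    finally show ?thesis by simp
  qed
  have "stint T (\<lambda>p. U p * D0 P p + V p * D0 Q p)
      + stint T (\<lambda>p. U p * (U p * D1 P p + V p * D1 Q p) + V p * (U p * D2 P p + V p * D2 Q p))
      + \<nu> * stint T (\<lambda>p. U p * (D1 (D1 P) p + D2 (D2 P) p) + V p * (D1 (D1 Q) p + D2 (D2 Q) p)) = 0"
    using weak by (simp only: stint_add stint_cmult ct sm PQ)
  then show ?thesis unfolding time visc nonlin by simp
qed

text \<open>For a divergence-free field the gradient of the vorticity is, up to rotation and sign,
  the Laplacian of the velocity. Expanding its square leaves cross terms of the form D11 W D22 W;
  two integrations by parts turn each into the square of D12 W, which is nonnegative and may be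
  dropped.\<close>

lemma second_derivatives_le:
  fixes U V :: "real \<times> (real^2) \<Rightarrow> real" and \<theta> :: "real \<Rightarrow> real"
  defines "\<omega> \<equiv> \<lambda>p. D1 V p - D2 U p"
  assumes U: "smooth_on UNIV U" "xper U" and V: "smooth_on UNIV V" "xper V"
    and div: "\<And>p. D1 U p + D2 V p = 0"
    and \<theta>: "smooth_on UNIV \<theta>" "\<And>t. (\<theta> has_real_derivative \<theta>' t) (at t)" "\<And>t. 0 \<le> \<theta> t"
  shows "stint T (\<lambda>p. \<theta> (fst p) * ((D1 (D1 U) p)\<^sup>2 + (D2 (D2 U) p)\<^sup>2 + (D1 (D1 V) p)\<^sup>2 + (D2 (D2 V) p)\<^sup>2))
    \<le> stint T (\<lambda>p. \<theta> (fst p) * ((D1 \<omega> p)\<^sup>2 + (D2 \<omega> p)\<^sup>2))"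
proof -
  define X where "X = (\<lambda>p::real \<times> (real^2). \<theta> (fst p))"
  have X: "smooth_on UNIV X" "xper X" unfolding X_def by (intro smooth_on_time \<theta> xper_time)+
  have X1: "D1 X = (\<lambda>p. 0)" and X2: "D2 X = (\<lambda>p. 0)"
    unfolding X_def by (intro ext; simp add: dd_time[OF \<theta>(2)])+
  note sm = smooth_intros U(1) V(1) X(1)
  note ct = smooth_on_continuous[of UNIV]
  have cross: "0 \<le> stint T (\<lambda>p. X p * D1 (D1 W) p * D2 (D2 W) p)" if W: "smooth_on UNIV W" "xper W" for W
  proof -
    have "stint T (\<lambda>p. X p * D1 (D1 W) p * D2 (D2 W) p) = - stint T (\<lambda>p. D2 (\<lambda>p. X p * D1 (D1 W) p) p * D2 W p)"
      by (rule stint_by_parts_space) (intro sm xper_intros X W)+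
    moreover have "D2 (\<lambda>p. X p * D1 (D1 W) p) p * D2 W p = (X p * D2 W p) * D1 (D2 (D1 W)) p" for p
      by (simp add: dd_mult_fun sm W X2 dd_commute_fun[of "D1 W" "(0, axis 2 1)"])
    moreover have "stint T (\<lambda>p. (X p * D2 W p) * D1 (D2 (D1 W)) p) = - stint T (\<lambda>p. D1 (\<lambda>p. X p * D2 W p) p * D2 (D1 W) p)"
      by (rule stint_by_parts_space) (intro sm xper_intros X W)+
    moreover have "D1 (\<lambda>p. X p * D2 W p) p * D2 (D1 W) p = X p * (D1 (D2 W) p)\<^sup>2" for p
      by (simp add: dd_mult_fun sm W X1 dd_commute_fun[OF W(1), of "(0, axis 2 1)"] power2_eq_square)
    moreover have "0 \<le> stint T (\<lambda>p. X p * (D1 (D2 W) p)\<^sup>2)"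
      unfolding stint_def set_lebesgue_integral_def using \<theta>(3)
      by (intro Bochner_Integration.integral_nonneg) (auto simp: X_def indicator_def)
    ultimately show ?thesis by simp
  qed
  have w1: "D1 \<omega> = (\<lambda>p. D1 (D1 V) p + D2 (D2 V) p)" and w2: "D2 \<omega> = (\<lambda>p. - (D1 (D1 U) p + D2 (D2 U) p))"
  proof -
    have e: "(\<lambda>p. D1 U p + D2 V p) = (\<lambda>p. 0)" using div by auto
    have "dd v (\<lambda>p. D1 U p + D2 V p) = (\<lambda>p. dd v (D1 U) p + dd v (D2 V) p)" for v
      by (intro dd_add_fun sm)
    moreover have "dd v (\<lambda>p. D1 U p + D2 V p) = (\<lambda>p. 0)" for v
      unfolding e by (rule ext, rule dd_eqI) simp
    ultimately have z: "dd v (D1 U) p = - dd v (D2 V) p" for v p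
      using fun_cong by (metis add_eq_0_iff2)
    have c: "dd v (dd w W) p = dd w (dd v W) p" if "smooth_on UNIV W" for v w p and W :: "real \<times> (real^2) \<Rightarrow> real"
      using dd_commute[OF that] .
    show "D1 \<omega> = (\<lambda>p. D1 (D1 V) p + D2 (D2 V) p)"
      using z[of "(0, axis 2 1)"] c[OF U(1)] unfolding \<omega>_def by (simp add: dd_diff_fun sm)
    show "D2 \<omega> = (\<lambda>p. - (D1 (D1 U) p + D2 (D2 U) p))"
      using z[of "(0, axis 1 1)"] c[OF V(1)] unfolding \<omega>_def by (simp add: dd_diff_fun sm)
  qed
  have "stint T (\<lambda>p. X p * ((D1 \<omega> p)\<^sup>2 + (D2 \<omega> p)\<^sup>2))
     = stint T (\<lambda>p. X p * ((D1 (D1 U) p)\<^sup>2 + (D2 (D2 U) p)\<^sup>2 + (D1 (D1 V) p)\<^sup>2 + (D2 (D2 V) p)\<^sup>2)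
        + 2 * (X p * D1 (D1 U) p * D2 (D2 U) p) + 2 * (X p * D1 (D1 V) p * D2 (D2 V) p))"
    unfolding w1 w2 by (simp add: algebra_simps power2_eq_square)
  also have "\<dots> = stint T (\<lambda>p. X p * ((D1 (D1 U) p)\<^sup>2 + (D2 (D2 U) p)\<^sup>2 + (D1 (D1 V) p)\<^sup>2 + (D2 (D2 V) p)\<^sup>2))
      + 2 * stint T (\<lambda>p. X p * D1 (D1 U) p * D2 (D2 U) p) + 2 * stint T (\<lambda>p. X p * D1 (D1 V) p * D2 (D2 V) p)"
    unfolding stint_cmult[symmetric] power2_eq_square
    by (subst stint_add, (intro ct sm)[1], (intro ct sm)[1])+ (rule refl)
  finally show ?thesis using cross[OF U] cross[OF V] unfolding X_def by simp
qed

section \<open>Translations and mollification in the square-integrable class\<close>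

lemma square_integrable_truncation:
  fixes f :: "'a \<Rightarrow> real"
  assumes f: "set_integrable M A (\<lambda>x. (f x)\<^sup>2)" and [measurable]: "f \<in> borel_measurable M" "A \<in> sets M"
  shows "(\<lambda>n. LINT x:A|M. (f x - max (- real n) (min (real n) (f x)))\<^sup>2) \<longlonglongrightarrow> 0"
proof -
  have "(\<lambda>n. LINT x:A|M. (f x - max (- real n) (min (real n) (f x)))\<^sup>2) \<longlonglongrightarrow> (\<integral>x. 0 \<partial>M)"
    unfolding set_lebesgue_integral_def
  proof (rule integral_dominated_convergence[where w="\<lambda>x. indicator A x *\<^sub>R (f x)\<^sup>2"])
    show "integrable M (\<lambda>x. indicator A x *\<^sub>R (f x)\<^sup>2)" using f unfolding set_integrable_def .
    show "AE x in M. (\<lambda>n. indicator A x *\<^sub>R (f x - max (- real n) (min (real n) (f x)))\<^sup>2) \<longlonglongrightarrow> 0"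
    proof (rule AE_I2, rule tendsto_eventually)
      fix x
      obtain N where N: "\<bar>f x\<bar> \<le> real N" using real_arch_simple by blast
      show "\<forall>\<^sub>F n in sequentially. indicator A x *\<^sub>R (f x - max (- real n) (min (real n) (f x)))\<^sup>2 = 0"
        using eventually_ge_at_top[of N]
      proof eventually_elim
        case (elim n)
        then have "\<bar>f x\<bar> \<le> real n" using N by linarith
        then have "f x - max (- real n) (min (real n) (f x)) = 0" by (auto simp: max_def min_def)
        then show ?case by simp
      qed
    qed
    show "AE x in M. norm (indicator A x *\<^sub>R (f x - max (- real n) (min (real n) (f x)))\<^sup>2) \<le> indicator A x *\<^sub>R (f x)\<^sup>2" for n
    proof (rule AE_I2)
      fix x
      have "\<bar>f x - max (- real n) (min (real n) (f x))\<bar> \<le> \<bar>f x\<bar>" by (auto simp: max_def min_def)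
      then have "(f x - max (- real n) (min (real n) (f x)))\<^sup>2 \<le> (f x)\<^sup>2" by (rule power_mono_even[rotated]) simp
      then show "norm (indicator A x *\<^sub>R (f x - max (- real n) (min (real n) (f x)))\<^sup>2) \<le> indicator A x *\<^sub>R (f x)\<^sup>2"
        by (auto simp: indicator_def)
    qed
  qed auto
  then show ?thesis by simp
qed

lemma square_sum_le: "(a + b)\<^sup>2 \<le> 2 * a\<^sup>2 + 2 * (b::real)\<^sup>2"
  using sum_squares_ge_zero[of "a - b" 0] by (simp add: power2_eq_square algebra_simps)

lemma square_diff_le: "(a - b)\<^sup>2 \<le> 2 * a\<^sup>2 + 2 * (b::real)\<^sup>2"
  using square_sum_le[of a "- b"] by simp

lemma set_integrable_square_add:
  fixes f g :: "'a \<Rightarrow> real"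
  assumes "set_integrable M A (\<lambda>x. (f x)\<^sup>2)" "set_integrable M A (\<lambda>x. (g x)\<^sup>2)"
    and [measurable]: "f \<in> borel_measurable M" "g \<in> borel_measurable M" "A \<in> sets M"
  shows "set_integrable M A (\<lambda>x. (f x + g x)\<^sup>2)"
proof (rule set_integrable_bound)
  show "set_integrable M A (\<lambda>x. 2 * (f x)\<^sup>2 + 2 * (g x)\<^sup>2)"
    using assms by (intro set_integral_add set_integrable_mult_right) auto
  show "set_borel_measurable M A (\<lambda>x. (f x + g x)\<^sup>2)" unfolding set_borel_measurable_def by measurable
  show "AE x in M. x \<in> A \<longrightarrow> norm ((f x + g x)\<^sup>2) \<le> norm (2 * (f x)\<^sup>2 + 2 * (g x)\<^sup>2)"
    using square_sum_le by auto
qed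

lemma set_integrable_square_diff:
  fixes f g :: "'a \<Rightarrow> real"
  assumes "set_integrable M A (\<lambda>x. (f x)\<^sup>2)" "set_integrable M A (\<lambda>x. (g x)\<^sup>2)"
    and "f \<in> borel_measurable M" "g \<in> borel_measurable M" "A \<in> sets M"
  shows "set_integrable M A (\<lambda>x. (f x - g x)\<^sup>2)"
  using set_integrable_square_add[of M A f "\<lambda>x. - g x"] assms by simp

lemma set_integral_square_add_le:
  fixes f g :: "'a \<Rightarrow> real"
  assumes "set_integrable M A (\<lambda>x. (f x)\<^sup>2)" "set_integrable M A (\<lambda>x. (g x)\<^sup>2)"
    and "f \<in> borel_measurable M" "g \<in> borel_measurable M" "A \<in> sets M"
  shows "(LINT x:A|M. (f x + g x)\<^sup>2) \<le> 2 * (LINT x:A|M. (f x)\<^sup>2) + 2 * (LINT x:A|M. (g x)\<^sup>2)"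
proof -
  have "(LINT x:A|M. (f x + g x)\<^sup>2) \<le> (LINT x:A|M. 2 * (f x)\<^sup>2 + 2 * (g x)\<^sup>2)"
    by (intro set_integral_mono set_integrable_square_add set_integral_add set_integrable_mult_right square_sum_le assms)
  also have "\<dots> = 2 * (LINT x:A|M. (f x)\<^sup>2) + 2 * (LINT x:A|M. (g x)\<^sup>2)"
    using assms by (subst set_integral_add) (auto intro!: set_integrable_mult_right)
  finally show ?thesis .
qed

text \<open>Truncation reduces to a bounded function, which is an almost everywhere limit of
  continuous ones. Clipping these at the same height costs nothing in the limit and supplies a
  constant as dominating function on the bounded set \<open>A\<close>.\<close>

lemma continuous_approx_square_integral:
  fixes f :: "'a::euclidean_space \<Rightarrow> real"
  assumes f: "set_integrable lborel A (\<lambda>x. (f x)\<^sup>2)" and [measurable]: "f \<in> borel_measurable borel" "A \<in> sets borel"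
    and "bounded A" "e > 0"
  obtains g :: "'a \<Rightarrow> real" where "continuous_on UNIV g" "(LINT x:A|lborel. (f x - g x)\<^sup>2) < e"
proof -
  obtain n where n: "(LINT x:A|lborel. (f x - max (- real n) (min (real n) (f x)))\<^sup>2) < e / 4"
    using order_tendstoD(2)[OF square_integrable_truncation[OF f], of "e / 4"] assms(5)
    by (auto simp: eventually_sequentially)
  define h where "h x = max (- real n) (min (real n) (f x))" for x
  have [measurable]: "h \<in> borel_measurable borel" unfolding h_def by measurable
  have "h \<in> borel_measurable lebesgue"
    by (rule measurable_completion) simp
  then have "h measurable_on UNIV" by (rule lebesgue_measurable_imp_measurable_on) simp
  then obtain N g where N: "negligible N" and g: "\<And>k. continuous_on UNIV (g k)"
    and lim: "\<And>x. x \<notin> N \<Longrightarrow> (\<lambda>k. g k x) \<longlonglongrightarrow> h x"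
    unfolding measurable_on_def by auto
  have AEN: "AE x in lborel. x \<notin> N"
    using N AE_not_in negligible_iff_null_sets AE_completion_iff by metis
  define c where "c k x = max (- real n) (min (real n) (g k x))" for k x
  have cc: "continuous_on UNIV (c k)" for k unfolding c_def by (intro continuous_intros g)
  have [measurable]: "c k \<in> borel_measurable borel" for k using cc borel_measurable_continuous_onI by auto
  have hc: "\<bar>h x\<bar> \<le> n" "\<bar>c k x\<bar> \<le> n" for k x unfolding h_def c_def by auto
  have "(\<lambda>k. LINT x:A|lborel. (h x - c k x)\<^sup>2) \<longlonglongrightarrow> (\<integral>x. 0 \<partial>(lborel::'a measure))"
    unfolding set_lebesgue_integral_def
  proof (rule integral_dominated_convergence[where w="\<lambda>x. indicator A x *\<^sub>R (2 * real n)\<^sup>2"])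
    show "integrable lborel (\<lambda>x. indicator A x *\<^sub>R (2 * real n)\<^sup>2)"
      using set_integrable_bounded_continuous[OF assms(4,3) continuous_on_const]
      unfolding set_integrable_def .
    show "AE x in lborel. (\<lambda>k. indicator A x *\<^sub>R (h x - c k x)\<^sup>2) \<longlonglongrightarrow> 0"
      using AEN
    proof eventually_elim
      case (elim x)
      have "(\<lambda>k. c k x) \<longlonglongrightarrow> max (- real n) (min (real n) (h x))"
        unfolding c_def by (intro tendsto_intros lim elim)
      moreover have "max (- real n) (min (real n) (h x)) = h x" by (auto simp: h_def)
      ultimately have "(\<lambda>k. c k x) \<longlonglongrightarrow> h x" by simp
      then have "(\<lambda>k. indicator A x *\<^sub>R (h x - c k x)\<^sup>2) \<longlonglongrightarrow> indicator A x *\<^sub>R (h x - h x)\<^sup>2"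
        by (intro tendsto_intros)
      then show ?case by simp
    qed
    show "AE x in lborel. norm (indicator A x *\<^sub>R (h x - c k x)\<^sup>2) \<le> indicator A x *\<^sub>R (2 * real n)\<^sup>2" for k
    proof (rule AE_I2)
      fix x
      have "\<bar>h x - c k x\<bar> \<le> \<bar>2 * real n\<bar>" using hc(1)[of x] hc(2)[of k x] by linarith
      then have "(h x - c k x)\<^sup>2 \<le> (2 * real n)\<^sup>2" by (rule power_mono_even[rotated]) simp
      then show "norm (indicator A x *\<^sub>R (h x - c k x)\<^sup>2) \<le> indicator A x *\<^sub>R (2 * real n)\<^sup>2"
        by (auto simp: indicator_def)
    qed
  qed auto
  then obtain k where k: "(LINT x:A|lborel. (h x - c k x)\<^sup>2) < e / 4"
    using order_tendstoD(2)[of _ 0 _ "e/4"] assms(5) by (force simp: eventually_sequentially)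
  have i1: "set_integrable lborel A (\<lambda>x. (c k x)\<^sup>2)"
    by (intro set_integrable_bounded_continuous assms continuous_intros cc)
  have i2: "set_integrable lborel A (\<lambda>x. (h x)\<^sup>2)"
  proof (rule set_integrable_bound[OF f])
    show "set_borel_measurable lborel A (\<lambda>x. (h x)\<^sup>2)" unfolding set_borel_measurable_def by measurable
    have "(h x)\<^sup>2 \<le> (f x)\<^sup>2" for x
      by (rule power_mono_even) (auto simp: h_def)
    then show "AE x in lborel. x \<in> A \<longrightarrow> norm ((h x)\<^sup>2) \<le> norm ((f x)\<^sup>2)" by auto
  qed
  have "(LINT x:A|lborel. (f x - c k x)\<^sup>2) = (LINT x:A|lborel. ((f x - h x) + (h x - c k x))\<^sup>2)" by simp
  also have "\<dots> \<le> 2 * (LINT x:A|lborel. (f x - h x)\<^sup>2) + 2 * (LINT x:A|lborel. (h x - c k x)\<^sup>2)"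
    by (intro set_integral_square_add_le set_integrable_square_diff f i1 i2) auto
  also have "\<dots> < e" using n k unfolding h_def by simp
  finally show ?thesis using that[OF cc] by blast
qed

definition half_vec :: "real^2" where "half_vec = (\<chi> i. 1/2)"

text \<open>Sixteen lattice translates of \<open>cell\<close> cover the box. The enlargement gives
  room for translations: the cell moved by a vector of norm less than one stays inside the
  box.\<close>

lemma set_integrable_periodic_bounded:
  fixes f :: "real^2 \<Rightarrow> real"
  assumes [measurable]: "f \<in> borel_measurable borel" and per: "periodic f" and "set_integrable lborel cell f"
  shows "set_integrable lborel (cbox (- 1) 2) f"
proof -
  have tr: "set_integrable lborel ((\<lambda>x. x + c) ` cell) f" for c
  proof -
    have eq: "indicator ((\<lambda>x. x + c) ` cell) x = (indicator cell (x - c) :: real)" for x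
      by (auto simp: indicator_def image_iff algebra_simps intro!: bexI[of _ "x - c"])
    have "integrable lborel (\<lambda>x. indicator cell x *\<^sub>R f (x + c))"
      using set_integrable_cell_translate[OF assms(1) per] assms(3) unfolding set_integrable_def by blast
    then have "integrable (distr lborel borel ((+) c)) (\<lambda>x. indicator cell (x - c) *\<^sub>R f x)"
      by (subst integrable_distr_eq) (auto simp: add.commute)
    then show ?thesis unfolding set_integrable_def eq lborel_distr_plus .
  qed
  let ?I = "{-1..2} \<times> {-1..2} :: (int \<times> int) set"
  have "set_integrable lborel (\<Union>k\<in>?I. (\<lambda>x. x + lattice_vec k) ` cell) f"
  proof (rule set_integrable_UN[OF _ tr])
    have "(\<lambda>x. x + c) ` cell = (\<lambda>x. x - c) -` cell \<inter> space borel" for c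
      by (auto simp: image_iff algebra_simps intro!: bexI[of _ "_ - c"])
    then show "(\<lambda>x. x + lattice_vec k) ` cell \<in> sets lborel" for k
      using measurable_sets[of "\<lambda>x. x - lattice_vec k" borel borel cell] by simp
  qed simp
  then show ?thesis
  proof (rule set_integrable_subset)
    show "cbox (- 1) 2 \<subseteq> (\<Union>k\<in>?I. (\<lambda>x. x + lattice_vec k) ` cell)"
    proof
      fix x :: "real^2" assume "x \<in> cbox (- 1) 2"
      then have x: "-1 \<le> x $ 1" "x $ 1 \<le> 2" "-1 \<le> x $ 2" "x $ 2 \<le> 2" by (auto simp: mem_box_cart)
      define k where "k = (\<lfloor>x $ 1\<rfloor>, \<lfloor>x $ 2\<rfloor>)"
      have "k \<in> ?I" using x unfolding k_def by (auto simp: le_floor_iff floor_le_iff)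
      moreover have "x - lattice_vec k \<in> cell" unfolding cell_eq k_def lattice_vec_def by simp linarith
      then have "x \<in> (\<lambda>x. x + lattice_vec k) ` cell" by (intro image_eqI[of _ _ "x - lattice_vec k"]) auto
      ultimately show "x \<in> (\<Union>k\<in>?I. (\<lambda>x. x + lattice_vec k) ` cell)" by blast
    qed
  qed simp
qed

text \<open>A continuous approximation \<open>g\<close> on the enlarged box is uniformly continuous
  there, so it changes little under short shifts. The errors between \<open>f\<close> and
  \<open>g\<close>, at the original and at the shifted points, are both controlled by the single
  integral over the box.\<close>

lemma translation_continuous_L2:
  fixes f :: "real^2 \<Rightarrow> real"
  assumes [measurable]: "f \<in> borel_measurable borel" and per: "periodic f"
    and f: "set_integrable lborel cell (\<lambda>x. (f x)\<^sup>2)" and "e > 0"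
  obtains d where "d > 0" "\<And>y. norm y < d \<Longrightarrow> (LINT x:cell|lborel. (f (x + y) - f x)\<^sup>2) < e"
proof -
  have per2: "periodic (\<lambda>x. (f x)\<^sup>2)" using per unfolding periodic_def by auto
  let ?W = "cbox (- 1) 2 :: (real^2) set"
  have fW: "set_integrable lborel ?W (\<lambda>x. (f x)\<^sup>2)" by (rule set_integrable_periodic_bounded[OF _ per2 f]) simp
  \<comment> \<open>Applying (a + b)^2 \<le> 2 a^2 + 2 b^2 twice weighs the three errors by 2, 4 and
    4; with \<open>e / 16\<close> for each the total is below 10/16 of \<open>e\<close>.\<close>
  obtain g where g: "continuous_on UNIV g" and gf: "(LINT x:?W|lborel. (f x - g x)\<^sup>2) < e / 16"
    using continuous_approx_square_integral[OF fW, of "e/16"] assms(4) by (auto intro: bounded_cbox)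
  have [measurable]: "g \<in> borel_measurable borel" using g borel_measurable_continuous_onI by auto
  have gW: "set_integrable lborel ?W (\<lambda>x. (g x)\<^sup>2)"
    by (intro set_integrable_bounded_continuous continuous_intros g) auto
  have fgW: "set_integrable lborel ?W (\<lambda>x. (f x - g x)\<^sup>2)" by (intro set_integrable_square_diff fW gW) auto
  have "uniformly_continuous_on ?W g"
    using g continuous_on_subset by (intro compact_uniformly_continuous) auto
  then obtain d where d: "d > 0" "\<And>x y. x \<in> ?W \<Longrightarrow> y \<in> ?W \<Longrightarrow> dist x y < d \<Longrightarrow> dist (g x) (g y) < sqrt (e / 16)"
    using assms(4) unfolding uniformly_continuous_on_def by (metis half_gt_zero real_sqrt_gt_zero zero_less_divide_iff zero_less_numeral)
  show ?thesis
  proof (rule that[of "min d 1"])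
    show "min d 1 > 0" using d by simp
    fix y :: "real^2" assume y: "norm y < min d 1"
    have sub: "x \<in> ?W" "x + y \<in> ?W" if "x \<in> cell" for x
    proof -
      have x: "0 \<le> x $ i" "x $ i < 1" for i using that unfolding cell_def by auto
      have yb: "\<bar>y $ i\<bar> < 1" for i using component_le_norm_cart[of y i] y by simp
      have one: "(1 :: real^2) $ i = 1" "(2 :: real^2) $ i = 2" for i by (rule one_index, rule numeral_index)
      show "x \<in> ?W" unfolding mem_box_cart vector_uminus_component one
      proof
        show "- 1 \<le> x $ i \<and> x $ i \<le> 2" for i using x[of i] by linarith
      qed
      show "x + y \<in> ?W" unfolding mem_box_cart vector_uminus_component one vector_add_component
      proof
        show "- 1 \<le> x $ i + y $ i \<and> x $ i + y $ i \<le> 2" for i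
          using x[of i] yb[of i] unfolding abs_less_iff by linarith
      qed
    qed
    have int_g: "set_integrable lborel cell (\<lambda>x. (g x)\<^sup>2)" "set_integrable lborel cell (\<lambda>x. (g (x + y))\<^sup>2)"
      by (intro set_integrable_bounded_continuous continuous_intros bounded_cell cell_borel g
          continuous_on_compose2[OF g] | simp)+
    have int_f: "set_integrable lborel cell (\<lambda>x. (f (x + y))\<^sup>2)"
      using set_integrable_cell_translate[OF _ per2] f by simp
    have c1: "(LINT x:cell|lborel. (f x - g x)\<^sup>2) \<le> (LINT x:?W|lborel. (f x - g x)\<^sup>2)"
      unfolding set_lebesgue_integral_def
      using fgW set_integrable_subset[OF fgW, of cell] sub
      by (intro integral_mono) (auto simp: set_integrable_def indicator_def)
    have c2: "(LINT x:cell|lborel. (f (x + y) - g (x + y))\<^sup>2) \<le> (LINT x:?W|lborel. (f x - g x)\<^sup>2)"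
    proof -
      have i: "integrable lborel (\<lambda>x. indicator ?W (x + y) *\<^sub>R (f (x + y) - g (x + y))\<^sup>2)"
        using fgW lborel_distr_plus[of y] integrable_distr_eq[of "(+) y" lborel borel "\<lambda>x. indicator ?W x *\<^sub>R (f x - g x)\<^sup>2"]
        unfolding set_integrable_def by (simp add: add.commute)
      have "(LINT x:cell|lborel. (f (x + y) - g (x + y))\<^sup>2) \<le> (\<integral>x. indicator ?W (x + y) *\<^sub>R (f (x + y) - g (x + y))\<^sup>2 \<partial>lborel)"
        unfolding set_lebesgue_integral_def
        using i sub set_integrable_square_diff[OF int_f int_g(2)]
        by (intro integral_mono) (auto simp: set_integrable_def indicator_def)
      also have "\<dots> = (\<integral>x. indicator ?W x *\<^sub>R (f x - g x)\<^sup>2 \<partial>distr lborel borel ((+) y))"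
        by (subst integral_distr) (auto simp: add.commute)
      finally show ?thesis unfolding lborel_distr_plus set_lebesgue_integral_def .
    qed
    have c3: "(LINT x:cell|lborel. (g (x + y) - g x)\<^sup>2) \<le> e / 16"
    proof -
      have "(g (x + y) - g x)\<^sup>2 \<le> e / 16" if "x \<in> cell" for x
      proof -
        have "\<bar>g (x + y) - g x\<bar> \<le> sqrt (e / 16)"
          using d(2)[OF sub(2)[OF that] sub(1)[OF that]] y by (simp add: dist_norm)
        then have "\<bar>g (x + y) - g x\<bar>\<^sup>2 \<le> (sqrt (e / 16))\<^sup>2" by (rule power_mono) simp
        then show ?thesis using assms(4) by simp
      qed
      then have "(LINT x:cell|lborel. (g (x + y) - g x)\<^sup>2) \<le> (LINT x:cell|lborel. e / 16)"
        by (intro set_integral_mono set_integrable_square_diff int_g set_integrable_bounded_continuous bounded_cell) auto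
      also have "\<dots> = measure lborel cell * (e / 16)" by (simp add: set_lebesgue_integral_def)
      also have "\<dots> \<le> 1 * (e / 16)"
        using emeasure_cell_le assms(4)
        by (intro mult_right_mono) (auto simp: measure_def enn2real_leI)
      finally show ?thesis by simp
    qed
    have "(LINT x:cell|lborel. (f (x + y) - f x)\<^sup>2)
       = (LINT x:cell|lborel. ((f (x + y) - g (x + y)) + ((g (x + y) - g x) + (g x - f x)))\<^sup>2)" by simp
    also have "\<dots> \<le> 2 * (LINT x:cell|lborel. (f (x + y) - g (x + y))\<^sup>2)
       + 2 * (LINT x:cell|lborel. ((g (x + y) - g x) + (g x - f x))\<^sup>2)"
      by (intro set_integral_square_add_le set_integrable_square_add set_integrable_square_diff f int_f int_g) auto
    finally have s1: "(LINT x:cell|lborel. (f (x + y) - f x)\<^sup>2)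
      \<le> 2 * (LINT x:cell|lborel. (f (x + y) - g (x + y))\<^sup>2)
       + 2 * (LINT x:cell|lborel. ((g (x + y) - g x) + (g x - f x))\<^sup>2)" .
    have s2: "(LINT x:cell|lborel. ((g (x + y) - g x) + (g x - f x))\<^sup>2)
       \<le> 2 * (LINT x:cell|lborel. (g (x + y) - g x)\<^sup>2) + 2 * (LINT x:cell|lborel. (g x - f x)\<^sup>2)"
      by (intro set_integral_square_add_le set_integrable_square_add set_integrable_square_diff f int_f int_g) auto
    have s3: "(LINT x:cell|lborel. (g x - f x)\<^sup>2) = (LINT x:cell|lborel. (f x - g x)\<^sup>2)"
      by (subst power2_commute) (rule refl)
    have arith: "a < e" if "a \<le> 2 * b + 2 * c" "c \<le> 2 * d + 2 * h" "h = h'" "h' \<le> i" "b \<le> i" "d \<le> e / 16" "i < e / 16"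
      for a b c d h h' i :: real
      using that assms(4) by simp
    show "(LINT x:cell|lborel. (f (x + y) - f x)\<^sup>2) < e"
      by (rule arith[OF s1 s2 s3 c1 c2 c3 gf])
  qed
qed

text \<open>
  For kernels \<open>K (x - z)\<close> of this form a convolution is a finite combination of smooth functions
  with integrals as coefficients, so no differentiation under the integral sign is needed.
\<close>

definition separable :: "(real^2 \<Rightarrow> real^2 \<Rightarrow> real) \<Rightarrow> bool" where
  "separable H \<longleftrightarrow> (\<exists>xs. (\<forall>(p, q)\<in>set xs. smooth_on UNIV p \<and> smooth_on UNIV q) \<and>
     (\<forall>x z. H x z = (\<Sum>(p, q)\<leftarrow>xs. p x * q z)))"

lemma separable_add:
  assumes "separable H" "separable G" shows "separable (\<lambda>x z. H x z + G x z)"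
proof -
  obtain xs where xs: "\<forall>(p, q)\<in>set xs. smooth_on UNIV p \<and> smooth_on UNIV q" "\<forall>x z. H x z = (\<Sum>(p, q)\<leftarrow>xs. p x * q z)"
    using assms(1) unfolding separable_def by blast
  obtain ys where ys: "\<forall>(p, q)\<in>set ys. smooth_on UNIV p \<and> smooth_on UNIV q" "\<forall>x z. G x z = (\<Sum>(p, q)\<leftarrow>ys. p x * q z)"
    using assms(2) unfolding separable_def by blast
  show ?thesis unfolding separable_def
    by (rule exI[of _ "xs @ ys"]) (use xs ys in auto)
qed

lemma separable_mult:
  assumes "separable H" "smooth_on UNIV p" "smooth_on UNIV q" shows "separable (\<lambda>x z. H x z * (p x * q z))"
proof -
  obtain xs where xs: "\<forall>(p, q)\<in>set xs. smooth_on UNIV p \<and> smooth_on UNIV q" "\<forall>x z. H x z = (\<Sum>(p, q)\<leftarrow>xs. p x * q z)"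
    using assms(1) unfolding separable_def by blast
  let ?ys = "map (\<lambda>(p', q'). (\<lambda>x. p' x * p x, \<lambda>z. q' z * q z)) xs"
  have "(\<Sum>(p', q')\<leftarrow>xs. p' x * q' z) * (p x * q z) = (\<Sum>(p, q)\<leftarrow>?ys. p x * q z)" for x z
    by (induction xs) (auto simp: algebra_simps)
  moreover have "\<forall>(p, q)\<in>set ?ys. smooth_on UNIV p \<and> smooth_on UNIV q"
    using xs(1) by (auto intro!: smooth_on_mult assms)
  ultimately show ?thesis unfolding separable_def using xs(2) by (intro exI[of _ ?ys]) simp
qed

lemma smooth_on_cos_component: "smooth_on UNIV (\<lambda>x::real^2. cos (c + 2 * pi * x $ j))"
  by (rule smooth_on_compose_affine[OF _ open_UNIV open_UNIV _ smooth_on_cos])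
    (auto intro!: bounded_linear_const_mult bounded_linear_vec_nth)

text \<open>The addition theorem splits the cosine of a difference into products of functions of
  \<open>x\<close> and of \<open>z\<close> alone; the sine is handled as a shifted cosine.\<close>

lemma separable_mult_cos:
  assumes "separable H"
  shows "separable (\<lambda>x z. H x z * (1 + cos (2 * pi * (x $ j - z $ j))))"
proof -
  have s: "smooth_on UNIV (\<lambda>x::real^2. cos (2 * pi * x $ j))" "smooth_on UNIV (\<lambda>x::real^2. sin (2 * pi * x $ j))"
  proof -
    show "smooth_on UNIV (\<lambda>x::real^2. cos (2 * pi * x $ j))" using smooth_on_cos_component[of 0 j] by simp
    have "sin (2 * pi * y) = cos (- (pi/2) + 2 * pi * y)" for y :: real by (simp add: cos_diff)
    then show "smooth_on UNIV (\<lambda>x::real^2. sin (2 * pi * x $ j))"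
      using smooth_on_cos_component[of "- (pi/2)" j] by presburger
  qed
  have "H x z * (1 + cos (2 * pi * (x $ j - z $ j))) = (H x z + H x z * (cos (2 * pi * x $ j) * cos (2 * pi * z $ j)))
     + H x z * (sin (2 * pi * x $ j) * sin (2 * pi * z $ j))" for x z
    by (simp add: cos_diff right_diff_distrib distrib_left)
  then show ?thesis
    using separable_add[OF separable_add[OF assms separable_mult[OF assms s(1) s(1)]] separable_mult[OF assms s(2) s(2)]]
    by presburger
qed

text \<open>Its powers are, up to normalization, products of de la Vallee Poussin kernels in the two
  coordinates. As trigonometric polynomials they are smooth, periodic and separable, and they
  concentrate at the lattice points, where the maximum \<open>4\<close> is attained.\<close>

definition cosine_bump :: "real^2 \<Rightarrow> real" where
  "cosine_bump w = (1 + cos (2 * pi * w $ 1)) * (1 + cos (2 * pi * w $ 2))"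

lemma separable_cosine_bump: "separable (\<lambda>x z. cosine_bump (x - z) ^ n)"
proof (induction n)
  case 0
  show ?case unfolding separable_def
    by (rule exI[of _ "[(\<lambda>x. 1, \<lambda>z. 1)]"]) (auto intro: smooth_on_const)
next
  case (Suc n)
  from separable_mult_cos[OF separable_mult_cos[OF this, of 1], of 2] show ?case
    by (simp add: cosine_bump_def mult_ac)
qed

lemma cosine_bump_nonneg: "0 \<le> cosine_bump w"
proof -
  have "0 \<le> 1 + cos t" for t :: real using cos_ge_minus_one[of t] by linarith
  then show ?thesis unfolding cosine_bump_def by simp
qed

lemma continuous_cosine_bump: "continuous_on A cosine_bump"
  unfolding cosine_bump_def by (intro continuous_intros)

lemma periodic_cosine_bump: "periodic cosine_bump"
  unfolding periodic_def
proof safe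
  fix x k :: "real^2" assume "\<forall>i. k $ i \<in> \<int>"
  then obtain m n where "k $ 1 = of_int m" "k $ 2 = of_int n" by (metis Ints_cases)
  moreover have "cos (2 * pi * (y + of_int m)) = cos (2 * pi * y)" for y :: real and m
    by (simp add: distrib_left cos_add)
  ultimately show "cosine_bump (x + k) = cosine_bump x" unfolding cosine_bump_def by simp
qed

lemma cosine_bump_lt:
  assumes "w \<in> cbox (- half_vec) half_vec" "w \<noteq> 0"
  shows "cosine_bump w < 4"
proof -
  have lt: "cos (2 * pi * t) < 1" if "\<bar>t\<bar> \<le> 1/2" "t \<noteq> 0" for t :: real
  proof -
    have "cos (2 * pi * t) \<noteq> 1"
    proof
      assume "cos (2 * pi * t) = 1"
      then obtain n :: int where "2 * pi * t = real_of_int n * 2 * pi" using cos_one_2pi_int[of "2 * pi * t"] by auto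
      then have "t = of_int n" by simp
      then show False using that by auto
    qed
    then show ?thesis using cos_le_one[of "2 * pi * t"] by linarith
  qed
  have b: "\<bar>w $ i\<bar> \<le> 1/2" for i using assms(1) unfolding mem_box_cart half_vec_def by (auto simp: abs_le_iff dest!: spec[of _ i])
  have c0: "0 \<le> 1 + cos (2 * pi * t)" "1 + cos (2 * pi * t) \<le> 2" for t :: real
    using cos_ge_minus_one[of "2 * pi * t"] cos_le_one[of "2 * pi * t"] by linarith+
  have "w $ 1 \<noteq> 0 \<or> w $ 2 \<noteq> 0" using assms(2) by (auto simp: vec_eq_iff forall_2)
  then show ?thesis
  proof
    assume "w $ 1 \<noteq> 0"
    then have "1 + cos (2 * pi * w $ 1) < 2" using lt[OF b[of 1]] by linarith
    then have "(1 + cos (2 * pi * w $ 1)) * (1 + cos (2 * pi * w $ 2)) \<le> (1 + cos (2 * pi * w $ 1)) * 2"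
      by (intro mult_left_mono c0)
    then show ?thesis unfolding cosine_bump_def
      by (rule le_less_trans) (use mult_strict_right_mono[OF \<open>1 + cos (2 * pi * w $ 1) < 2\<close>, of 2] in simp)
  next
    assume "w $ 2 \<noteq> 0"
    then have "1 + cos (2 * pi * w $ 2) < 2" using lt[OF b[of 2]] by linarith
    have "(1 + cos (2 * pi * w $ 1)) * (1 + cos (2 * pi * w $ 2)) \<le> 2 * (1 + cos (2 * pi * w $ 2))"
      by (intro mult_right_mono c0)
    then show ?thesis unfolding cosine_bump_def
      by (rule le_less_trans) (use mult_strict_left_mono[OF \<open>1 + cos (2 * pi * w $ 2) < 2\<close>, of 2] in simp)
  qed
qed

text \<open>
  The concentration condition is stated on the cell shifted by \<open>half_vec\<close>, which is centred at the
  origin.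
\<close>

definition concentrated_kernel :: "real \<Rightarrow> real \<Rightarrow> (real^2 \<Rightarrow> real) \<Rightarrow> bool" where
  "concentrated_kernel d e K \<longleftrightarrow> separable (\<lambda>x z. K (x - z)) \<and> smooth_on UNIV K \<and> periodic K \<and> (\<forall>w. 0 \<le> K w) \<and> (\<forall>w. K (- w) = K w) \<and>
     (LINT w:cell|lborel. K w) = 1 \<and> (\<forall>w\<in>cell. d \<le> norm (w - half_vec) \<longrightarrow> K (w - half_vec) \<le> e)"

text \<open>The origin is only a corner of \<open>cell\<close>, so the intersection is no
  neighbourhood of it; it still contains the open set \<open>U\<close>, which the diagonal point
  with coordinates \<open>s\<close> shows to be nonempty.\<close>

lemma measure_cell_Int_ball_pos:
  assumes "r > 0" shows "measure lborel (cell \<inter> ball 0 r) > 0"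
proof -
  have m: "cell \<inter> ball 0 r \<in> sets lborel" by simp
  have fin: "emeasure lborel (cell \<inter> ball 0 r) < \<infinity>"
    by (intro emeasure_bounded_finite bounded_Int) (simp add: bounded_cell)
  define U where "U = {x::real^2. 0 < x $ 1} \<inter> {x. x $ 1 < 1} \<inter> {x. 0 < x $ 2} \<inter> {x. x $ 2 < 1} \<inter> ball 0 r"
  have oU: "open U" unfolding U_def by (intro open_Int open_Collect_less continuous_intros open_ball)
  define s where "s = min (1/2) (r/4)"
  have s: "0 < s" "s < 1" "2 * s < r" using assms by (auto simp: s_def)
  have "norm (\<chi> i. s :: real^2) \<le> (\<Sum>i\<in>UNIV. \<bar>(\<chi> i. s :: real^2) $ i\<bar>)" by (rule norm_le_l1_cart)
  also have "\<dots> = 2 * s" using s by (simp add: sum_2)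
  finally have "(\<chi> i. s) \<in> U" using s unfolding U_def by simp
  then have "\<not> negligible U" using open_not_negligible[OF oU] by blast
  moreover have "U \<subseteq> cell \<inter> ball 0 r" unfolding U_def by (auto simp: cell_eq)
  ultimately have "\<not> negligible (cell \<inter> ball 0 r)" using negligible_subset by blast
  then have "cell \<inter> ball 0 r \<notin> null_sets lborel"
    using null_sets_completionI negligible_iff_null_sets by blast
  then have "emeasure lborel (cell \<inter> ball 0 r) \<noteq> 0" using m by (simp add: null_sets_def)
  moreover have "emeasure lborel (cell \<inter> ball 0 r) = ennreal (measure lborel (cell \<inter> ball 0 r))"
    by (rule emeasure_eq_ennreal_measure) (use fin in auto)
  ultimately have "measure lborel (cell \<inter> ball 0 r) \<noteq> 0" by auto
  then show ?thesis by (simp add: less_le)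
qed

text \<open>Away from the origin the bump is at most \<open>q\<close>, while it is at least
  \<open>q' > q\<close> on a small disk. After normalizing the \<open>n\<close>-th power, the values
  away from the origin are at most \<open>(q / q') ^ n / c\<close>, with \<open>c\<close> the
  measure of the part of that disk in \<open>cell\<close>; this tends to zero as \<open>n\<close>
  grows.\<close>

lemma concentrated_kernel_exists:
  assumes "d > 0" "e > 0"
  obtains K where "concentrated_kernel d e K"
proof -
  define S where "S = {w \<in> cbox (- half_vec) half_vec. d \<le> norm w}"
  have "compact S" unfolding S_def
    by (intro compact_Int_closed[of "cbox (- half_vec) half_vec" "{w. d \<le> norm w}", simplified Int_def mem_Collect_eq] compact_cbox closed_Collect_le continuous_intros)
  have "\<exists>q. 0 \<le> q \<and> q < 4 \<and> (\<forall>w\<in>S. cosine_bump w \<le> q)"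
  proof (cases "S = {}")
    case True
    then show ?thesis by (intro exI[of _ 0]) auto
  next
    case False
    obtain w where w: "w \<in> S" "\<And>y. y \<in> S \<Longrightarrow> cosine_bump y \<le> cosine_bump w"
      using continuous_attains_sup[OF \<open>compact S\<close> False continuous_cosine_bump] by blast
    have "cosine_bump w < 4" using w(1) assms(1) by (intro cosine_bump_lt) (auto simp: S_def)
    then show ?thesis using w cosine_bump_nonneg by blast
  qed
  then obtain q where q: "0 \<le> q" "q < 4" "\<And>w. w \<in> S \<Longrightarrow> cosine_bump w \<le> q" by blast
  \<comment> \<open>Any value strictly between \<open>q\<close> and the peak value \<open>4\<close>
    would serve; the midpoint is positive even when \<open>q = 0\<close>.\<close>
  define q' where "q' = (q + 4) / 2"
  have q': "q < q'" "q' < 4" "0 < q'" using q by (auto simp: q'_def)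
  have "isCont cosine_bump 0" using continuous_cosine_bump[of UNIV] continuous_on_eq_continuous_at open_UNIV by blast
  moreover have "cosine_bump 0 = 4" by (simp add: cosine_bump_def)
  ultimately have "eventually (\<lambda>w. q' < cosine_bump w) (at 0)"
    using q'(2) order_tendstoD(1)[of cosine_bump "cosine_bump 0" "at 0" q'] by (simp add: isCont_def)
  then obtain r where r: "r > 0" "\<And>w. w \<noteq> 0 \<Longrightarrow> norm w < r \<Longrightarrow> q' < cosine_bump w"
    unfolding eventually_at by (auto simp: dist_norm)
  have r': "q' \<le> cosine_bump w" if "norm w < r" for w
    using r(2)[of w] that q' \<open>cosine_bump 0 = 4\<close> by (cases "w = 0") (auto intro: less_imp_le)
  define c where "c = measure lborel (cell \<inter> ball 0 r)"
  have c: "c > 0" unfolding c_def by (rule measure_cell_Int_ball_pos[OF r(1)])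
  have "(\<lambda>n. (q / q') ^ n / c) \<longlonglongrightarrow> 0 / c"
    by (intro tendsto_intros LIMSEQ_power_zero) (use q q' c in auto)
  then have "eventually (\<lambda>n. (q / q') ^ n / c < e) sequentially"
    using assms(2) order_tendstoD(2) by fastforce
  then obtain n where n: "(q / q') ^ n / c < e" by (auto simp: eventually_sequentially)
  define A where "A w = cosine_bump w ^ n" for w
  have cA: "continuous_on UNIV A" unfolding A_def by (intro continuous_intros continuous_cosine_bump)
  have A0: "0 \<le> A w" for w unfolding A_def using cosine_bump_nonneg by simp
  define I where "I = (LINT w:cell|lborel. A w)"
  have iA: "set_integrable lborel cell A" by (intro set_integrable_bounded_continuous bounded_cell cell_borel cA)
  have I: "q' ^ n * c \<le> I"
  proof -
    have fin: "emeasure lborel (cell \<inter> ball 0 r) < \<infinity>"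
      by (intro emeasure_bounded_finite bounded_Int) (simp add: bounded_cell)
    have "q' ^ n * c = (LINT w:(cell \<inter> ball 0 r)|lborel. q' ^ n)"
      by (simp add: set_lebesgue_integral_def c_def)
    also have "\<dots> \<le> (LINT w:(cell \<inter> ball 0 r)|lborel. A w)"
    proof (rule set_integral_mono)
      show "set_integrable lborel (cell \<inter> ball 0 r) (\<lambda>w. q' ^ n)"
        by (intro set_integrable_bounded_continuous bounded_Int) (auto intro: bounded_cell)
      show "set_integrable lborel (cell \<inter> ball 0 r) A" by (rule set_integrable_subset[OF iA]) auto
      show "q' ^ n \<le> A w" if "w \<in> cell \<inter> ball 0 r" for w
        unfolding A_def using that q' r'[of w] by (intro power_mono) auto
    qed
    also have "\<dots> \<le> I" unfolding I_def set_lebesgue_integral_def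
      using iA A0 set_integrable_subset[OF iA, of "cell \<inter> ball 0 r"]
      by (intro integral_mono) (auto simp: set_integrable_def indicator_def)
    finally show ?thesis .
  qed
  then have Ipos: "I > 0" using q' c by (metis less_le_trans mult_pos_pos zero_less_power)
  define K where "K w = A w / I" for w
  have "concentrated_kernel d e K" unfolding concentrated_kernel_def
  proof (intro conjI allI ballI impI)
    have "separable (\<lambda>x z. A (x - z) * (1 / I * 1))"
      unfolding A_def by (intro separable_mult separable_cosine_bump smooth_on_const open_UNIV)
    then show "separable (\<lambda>x z. K (x - z))" by (simp add: K_def)
    have "smooth_on UNIV A"
    proof -
      have "smooth_on UNIV cosine_bump" unfolding cosine_bump_def
        using smooth_on_cos_component[of 0] by (intro smooth_on_mult smooth_on_add smooth_on_const) auto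
      then have "smooth_on UNIV (\<lambda>w. cosine_bump w ^ m)" for m
        by (induction m) (auto intro: smooth_on_mult smooth_on_const)
      then show ?thesis unfolding A_def .
    qed
    from smooth_on_mult[OF open_UNIV smooth_on_const[OF open_UNIV, of "1/I"] this]
    show "smooth_on UNIV K" unfolding K_def by simp
    show "periodic K" using periodic_cosine_bump unfolding K_def A_def periodic_def by auto
    show "0 \<le> K w" for w using A0 Ipos by (simp add: K_def)
    show "K (- w) = K w" for w unfolding K_def A_def cosine_bump_def by simp
    show "(LINT w:cell|lborel. K w) = 1" unfolding K_def using Ipos by (simp add: I_def)
    fix w assume w: "w \<in> cell" "d \<le> norm (w - half_vec)"
    have "w - half_vec \<in> S"
      using w unfolding S_def mem_box_cart half_vec_def cell_def by (auto intro: less_imp_le)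
    then have "A (w - half_vec) \<le> q ^ n" unfolding A_def using q(3) cosine_bump_nonneg by (intro power_mono)
    then have "K (w - half_vec) \<le> q ^ n / (q' ^ n * c)"
      unfolding K_def using I Ipos A0 q' c q(1) by (intro frac_le) auto
    also have "\<dots> = (q / q') ^ n / c" by (simp add: power_divide)
    finally show "K (w - half_vec) \<le> e" using n by simp
  qed
  then show ?thesis by (rule that)
qed

section \<open>Convolution with a concentrated kernel\<close>

definition mollify :: "(real^2 \<Rightarrow> real) \<Rightarrow> (real^2 \<Rightarrow> real) \<Rightarrow> real^2 \<Rightarrow> real" where
  "mollify K f x = (LINT z:cell|lborel. K (x - z) * f z)"

lemma set_integrable_mult_continuous:
  fixes f q :: "'a::euclidean_space \<Rightarrow> real"
  assumes "bounded A" and [measurable]: "A \<in> sets borel" "f \<in> borel_measurable borel"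
    and q: "continuous_on UNIV q" and f: "set_integrable lborel A f"
  shows "set_integrable lborel A (\<lambda>x. q x * f x)"
proof -
  have [measurable]: "q \<in> borel_measurable borel" using q borel_measurable_continuous_onI by auto
  obtain a b where ab: "A \<subseteq> cbox a b" using bounded_subset_cbox_symmetric[OF assms(1)] by blast
  have "compact (q ` cbox a b)" using q continuous_on_subset by (intro compact_continuous_image) auto
  then obtain C where C: "\<And>x. x \<in> cbox a b \<Longrightarrow> norm (q x) \<le> C"
    using compact_imp_bounded bounded_iff by (metis imageI)
  show ?thesis
  proof (rule set_integrable_bound)
    show "set_integrable lborel A (\<lambda>x. C * f x)" using f by (rule set_integrable_mult_right)
    show "set_borel_measurable lborel A (\<lambda>x. q x * f x)" unfolding set_borel_measurable_def by measurable
    have "norm (q x * f x) \<le> norm (C * f x)" if "x \<in> A" for x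
      using C[of x] that ab by (auto simp: abs_mult intro!: mult_right_mono)
    then show "AE x in lborel. x \<in> A \<longrightarrow> norm (q x * f x) \<le> norm (C * f x)" by auto
  qed
qed

lemma set_integrable_of_square:
  fixes f :: "'a::euclidean_space \<Rightarrow> real"
  assumes "bounded A" and [measurable]: "A \<in> sets borel" "f \<in> borel_measurable borel"
    and "set_integrable lborel A (\<lambda>x. (f x)\<^sup>2)"
  shows "set_integrable lborel A f"
proof (rule set_integrable_bound)
  show "set_integrable lborel A (\<lambda>x. 1 + (f x)\<^sup>2)"
    by (rule set_integral_add(1)[OF set_integrable_bounded_continuous[OF assms(1,2) continuous_on_const] assms(4)])
  show "set_borel_measurable lborel A f" unfolding set_borel_measurable_def by measurable
  have "\<bar>t\<bar> \<le> 1 + t\<^sup>2" for t :: real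
    using zero_le_power2[of "\<bar>t\<bar> - 1/2"] by (simp add: power2_eq_square algebra_simps)
  then show "AE x in lborel. x \<in> A \<longrightarrow> norm (f x) \<le> norm (1 + (f x)\<^sup>2)"
    by simp
qed

lemma set_integral_sum_list:
  fixes g :: "'i \<Rightarrow> 'a \<Rightarrow> real"
  assumes "\<And>i. i \<in> set xs \<Longrightarrow> set_integrable M A (g i)"
  shows "(LINT z:A|M. (\<Sum>i\<leftarrow>xs. g i z)) = (\<Sum>i\<leftarrow>xs. LINT z:A|M. g i z)"
    and "set_integrable M A (\<lambda>z. \<Sum>i\<leftarrow>xs. g i z)"
proof -
  have "(LINT z:A|M. (\<Sum>i\<leftarrow>xs. g i z)) = (\<Sum>i\<leftarrow>xs. LINT z:A|M. g i z) \<and> set_integrable M A (\<lambda>z. \<Sum>i\<leftarrow>xs. g i z)"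
    using assms
  proof (induction xs)
    case Nil
    then show ?case by (simp add: set_integrable_def)
  next
    case (Cons a xs)
    then show ?case by (auto intro!: set_integral_add)
  qed
  then show "(LINT z:A|M. (\<Sum>i\<leftarrow>xs. g i z)) = (\<Sum>i\<leftarrow>xs. LINT z:A|M. g i z)"
    and "set_integrable M A (\<lambda>z. \<Sum>i\<leftarrow>xs. g i z)" by auto
qed

lemma has_derivative_sum_list:
  assumes "\<And>i. i \<in> set xs \<Longrightarrow> (f i has_derivative f' i) F"
  shows "((\<lambda>x. \<Sum>i\<leftarrow>xs. f i x) has_derivative (\<lambda>v. \<Sum>i\<leftarrow>xs. f' i v)) F"
  using assms by (induction xs) (auto intro!: has_derivative_add)

lemma smooth_on_sum_list:
  assumes "open S" "\<And>i. i \<in> set xs \<Longrightarrow> smooth_on S (f i)"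
  shows "smooth_on S (\<lambda>x. \<Sum>i\<leftarrow>xs. f i x)"
  using assms by (induction xs) (auto intro!: smooth_on_add smooth_on_const)

lemma
  assumes sep: "separable (\<lambda>x z. K (x - z))"
    and [measurable]: "f \<in> borel_measurable borel" and f: "set_integrable lborel cell f"
  shows smooth_on_mollify: "smooth_on UNIV (mollify K f)"
    and dd_mollify: "dd v (mollify K f) x = (LINT z:cell|lborel. dd v K (x - z) * f z)"
proof -
  obtain xs where xs: "\<And>i. i \<in> set xs \<Longrightarrow> smooth_on UNIV (fst i)" "\<And>i. i \<in> set xs \<Longrightarrow> smooth_on UNIV (snd i)"
    and K: "\<And>x z. K (x - z) = (\<Sum>i\<leftarrow>xs. fst i x * snd i z)"
    using sep unfolding separable_def by (auto simp: case_prod_beta' split_beta)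
  have int: "set_integrable lborel cell (\<lambda>z. snd i z * f z)" if "i \<in> set xs" for i
    by (intro set_integrable_mult_continuous bounded_cell f smooth_on_continuous xs that) auto
  have l: "(LINT z:cell|lborel. (\<Sum>i\<leftarrow>xs. c i * snd i z) * f z) = (\<Sum>i\<leftarrow>xs. c i * (LINT z:cell|lborel. snd i z * f z))" for c
  proof -
    have "(\<Sum>i\<leftarrow>xs. c i * snd i z) * f z = (\<Sum>i\<leftarrow>xs. c i * (snd i z * f z))" for z
      by (induction xs) (auto simp: algebra_simps)
    then show ?thesis using set_integral_sum_list(1)[of xs lborel cell "\<lambda>i z. c i * (snd i z * f z)"] int by simp
  qed
  have m: "mollify K f = (\<lambda>x. \<Sum>i\<leftarrow>xs. fst i x * (LINT z:cell|lborel. snd i z * f z))"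
    unfolding mollify_def K l ..
  show "smooth_on UNIV (mollify K f)" unfolding m
    by (intro smooth_on_sum_list smooth_on_mult smooth_on_const xs open_UNIV)
  have dK: "dd v K (x - z) = (\<Sum>i\<leftarrow>xs. dd v (fst i) x * snd i z)" for z
  proof -
    have "dd v (\<lambda>y. K (y + - z)) x = dd v K (x + - z)" by (rule dd_translate)
    moreover have "dd v (\<lambda>y. K (y + - z)) x = (\<Sum>i\<leftarrow>xs. dd v (fst i) x * snd i z)"
    proof (rule dd_eqI)
      show "((\<lambda>y. K (y + - z)) has_derivative (\<lambda>v. \<Sum>i\<leftarrow>xs. dd v (fst i) x * snd i z)) (at x)"
      proof -
        have "(\<lambda>y. K (y + - z)) = (\<lambda>y. \<Sum>i\<leftarrow>xs. fst i y * snd i z)" using K[of _ z] by (simp add: fun_eq_iff)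
        moreover have "((\<lambda>y. \<Sum>i\<leftarrow>xs. fst i y * snd i z) has_derivative (\<lambda>v. \<Sum>i\<leftarrow>xs. dd v (fst i) x * snd i z)) (at x)"
          by (rule has_derivative_sum_list, rule has_derivative_mult_left, rule smooth_on_has_derivative, erule xs, rule UNIV_I)
        ultimately show ?thesis by simp
      qed
    qed
    ultimately show ?thesis by simp
  qed
  have "dd v (mollify K f) x = (\<Sum>i\<leftarrow>xs. dd v (fst i) x * (LINT z:cell|lborel. snd i z * f z))"
    unfolding m
    by (rule dd_eqI, rule has_derivative_sum_list, rule has_derivative_mult_left, rule smooth_on_has_derivative, erule xs, rule UNIV_I)
  also have "\<dots> = (LINT z:cell|lborel. (\<Sum>i\<leftarrow>xs. dd v (fst i) x * snd i z) * f z)"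
    by (rule l[symmetric])
  also have "\<dots> = (LINT z:cell|lborel. dd v K (x - z) * f z)"
    by (simp only: dK)
  finally show "dd v (mollify K f) x = (LINT z:cell|lborel. dd v K (x - z) * f z)" .
qed

lemma L2_square_integrable: "f \<in> L2 \<Longrightarrow> set_integrable lborel cell (\<lambda>x. (norm (f x))\<^sup>2)"
  and L2_periodic: "f \<in> L2 \<Longrightarrow> periodic f"
  and L2_measurable: "f \<in> L2 \<Longrightarrow> f \<in> borel_measurable borel"
  unfolding L2_def by auto

lemma L2_continuous:
  fixes f :: "real^2 \<Rightarrow> 'b::euclidean_space"
  shows "continuous_on UNIV f \<Longrightarrow> periodic f \<Longrightarrow> f \<in> L2"
  unfolding L2_def
  by (auto intro!: borel_measurable_continuous_onI set_integrable_bounded_continuous bounded_cell continuous_intros)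

lemma L2_linear_image:
  fixes f :: "real^2 \<Rightarrow> 'b::euclidean_space" and L :: "'b \<Rightarrow> 'c::euclidean_space"
  assumes "f \<in> L2" "bounded_linear L" shows "(\<lambda>x. L (f x)) \<in> L2"
proof -
  note [measurable] = L2_measurable[OF assms(1)]
  obtain C where C: "\<And>x. norm (L x) \<le> norm x * C"
    using bounded_linear.bounded[OF assms(2)] by blast
  have [measurable]: "L \<in> borel_measurable borel"
    by (intro borel_measurable_continuous_onI linear_continuous_on assms(2))
  have "set_integrable lborel cell (\<lambda>x. (norm (L (f x)))\<^sup>2)"
  proof (rule set_integrable_bound)
    show "set_integrable lborel cell (\<lambda>x. (norm (f x))\<^sup>2 * C\<^sup>2)"
      by (intro set_integrable_mult_left impI L2_square_integrable assms)
    show "set_borel_measurable lborel cell (\<lambda>x. (norm (L (f x)))\<^sup>2)"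
      unfolding set_borel_measurable_def by measurable
    have "norm ((norm (L (f x)))\<^sup>2) \<le> norm ((norm (f x))\<^sup>2 * C\<^sup>2)" for x
      using power_mono[OF C[of "f x"] norm_ge_zero, of 2] by (simp add: power_mult_distrib)
    then show "AE x in lborel. x \<in> cell \<longrightarrow> norm ((norm (L (f x)))\<^sup>2) \<le> norm ((norm (f x))\<^sup>2 * C\<^sup>2)" by simp
  qed
  moreover have "periodic (\<lambda>x. L (f x))" using L2_periodic[OF assms(1)] unfolding periodic_def by simp
  ultimately show ?thesis unfolding L2_def by simp
qed

lemma L2norm_sq: "(L2norm f)\<^sup>2 = (LINT x:cell|lborel. (norm (f x))\<^sup>2)"
  unfolding L2norm_def set_lebesgue_integral_def
  by (intro real_sqrt_pow2 Bochner_Integration.integral_nonneg) (simp add: indicator_def)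

lemma norm_sq_vec2: "(norm (v::real^2))\<^sup>2 = (v $ 1)\<^sup>2 + (v $ 2)\<^sup>2"
  unfolding power2_norm_eq_inner inner_vec_def sum_2 by (simp add: power2_eq_square)

lemma norm_sq_mat2: "(norm (A::real^2^2))\<^sup>2 = ((A $ 1 $ 1)\<^sup>2 + (A $ 1 $ 2)\<^sup>2) + ((A $ 2 $ 1)\<^sup>2 + (A $ 2 $ 2)\<^sup>2)"
  unfolding power2_norm_eq_inner[of A] inner_vec_def[of A] sum_2
  by (simp only: power2_norm_eq_inner[symmetric] norm_sq_vec2)

text \<open>Jensen's inequality for the probability density \<open>K (x - z)\<close>, obtained from
  the nonnegative variance: \<open>m\<close> is the mean of \<open>f z - f x\<close>, and expanding
  the square of \<open>f z - f x - m\<close> leaves the second moment minus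
  \<open>m^2\<close>.\<close>

lemma kernel_integral_square_le:
  fixes f :: "real^2 \<Rightarrow> real"
  assumes K: "concentrated_kernel d e K" and f: "f \<in> L2"
  shows "(mollify K f x - f x)\<^sup>2 \<le> (LINT z:cell|lborel. K (x - z) * (f z - f x)\<^sup>2)"
    and "set_integrable lborel cell (\<lambda>z. K (x - z) * (f z - f x)\<^sup>2)"
proof -
  note [measurable] = L2_measurable[OF f]
  have smK: "continuous_on UNIV K" using K smooth_on_continuous unfolding concentrated_kernel_def by blast
  have cK: "continuous_on UNIV (\<lambda>z. K (x - z))"
    by (rule continuous_on_compose2[OF smK]) (auto intro!: continuous_intros)
  have [measurable]: "K \<in> borel_measurable borel" using smK borel_measurable_continuous_onI by auto
  have iK: "set_integrable lborel cell (\<lambda>z. K (x - z))"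
    by (intro set_integrable_bounded_continuous bounded_cell cK cell_borel)
  have K1: "(LINT z:cell|lborel. K (x - z)) = 1"
  proof -
    have "(LINT z:cell|lborel. K (x - z)) = (LINT z:cell|lborel. K (z + - x))"
    proof -
      have "K (x - z) = K (z + - x)" for z
      proof -
        have "K (- (z + - x)) = K (z + - x)" using K unfolding concentrated_kernel_def by blast
        then show ?thesis by simp
      qed
      then show ?thesis by (simp only:)
    qed
    also have "\<dots> = (LINT z:cell|lborel. K z)"
      by (rule cell_integral_translate) (use K in \<open>auto simp: concentrated_kernel_def\<close>)
    finally show ?thesis using K unfolding concentrated_kernel_def by simp
  qed
  have f2: "set_integrable lborel cell (\<lambda>z. (f z)\<^sup>2)" using L2_square_integrable[OF f] by simp
  have f1: "set_integrable lborel cell f" by (rule set_integrable_of_square[OF bounded_cell _ _ f2]) auto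
  have c: "set_integrable lborel cell (\<lambda>z. b)" for b :: real
    by (intro set_integrable_bounded_continuous bounded_cell cell_borel continuous_on_const)
  have h2: "set_integrable lborel cell (\<lambda>z. (f z - b)\<^sup>2)" for b
    by (intro set_integrable_square_diff f2 c) auto
  have h1: "set_integrable lborel cell (\<lambda>z. f z - b)" for b
    by (intro set_integral_diff f1 c)
  have kh2: "set_integrable lborel cell (\<lambda>z. K (x - z) * (f z - b)\<^sup>2)" for b
    by (intro set_integrable_mult_continuous bounded_cell cK h2) auto
  have kh1: "set_integrable lborel cell (\<lambda>z. K (x - z) * (f z - b))" for b
    by (intro set_integrable_mult_continuous bounded_cell cK h1) auto
  have kf: "set_integrable lborel cell (\<lambda>z. K (x - z) * f z)"
    by (intro set_integrable_mult_continuous bounded_cell cK f1) auto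
  show "set_integrable lborel cell (\<lambda>z. K (x - z) * (f z - f x)\<^sup>2)" by (rule kh2)
  define m where "m = mollify K f x - f x"
  have m: "(LINT z:cell|lborel. K (x - z) * (f z - f x)) = m"
  proof -
    have "(LINT z:cell|lborel. K (x - z) * (f z - f x)) = (LINT z:cell|lborel. K (x - z) * f z - K (x - z) * f x)"
      by (simp add: right_diff_distrib)
    also have "\<dots> = (LINT z:cell|lborel. K (x - z) * f z) - (LINT z:cell|lborel. K (x - z) * f x)"
      by (intro set_integral_diff kf set_integrable_mult_left iK impI)
    finally show ?thesis using K1 by (simp add: m_def mollify_def)
  qed
  have "0 \<le> (LINT z:cell|lborel. K (x - z) * (f z - f x - m)\<^sup>2)"
    unfolding set_lebesgue_integral_def using K
    by (intro Bochner_Integration.integral_nonneg) (auto simp: concentrated_kernel_def indicator_def)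
  also have "\<dots> = (LINT z:cell|lborel. (K (x - z) * (f z - f x)\<^sup>2 - 2 * m * (K (x - z) * (f z - f x))) + m\<^sup>2 * K (x - z))"
    by (simp add: power2_eq_square algebra_simps)
  also have "\<dots> = (LINT z:cell|lborel. (K (x - z) * (f z - f x)\<^sup>2 - 2 * m * (K (x - z) * (f z - f x)))) + (LINT z:cell|lborel. m\<^sup>2 * K (x - z))"
    by (intro set_integral_add set_integral_diff kh2 kh1 set_integrable_mult_right iK impI)
  also have "(LINT z:cell|lborel. (K (x - z) * (f z - f x)\<^sup>2 - 2 * m * (K (x - z) * (f z - f x))))
      = (LINT z:cell|lborel. K (x - z) * (f z - f x)\<^sup>2) - (LINT z:cell|lborel. 2 * m * (K (x - z) * (f z - f x)))"
    by (intro set_integral_diff kh2 kh1 set_integrable_mult_right iK impI)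
  finally have "0 \<le> (LINT z:cell|lborel. K (x - z) * (f z - f x)\<^sup>2) - 2 * m * m + m\<^sup>2 * 1"
    by (simp only: set_integral_mult_right m K1)
  then show "(mollify K f x - f x)\<^sup>2 \<le> (LINT z:cell|lborel. K (x - z) * (f z - f x)\<^sup>2)"
    unfolding m_def[symmetric] by (simp add: power2_eq_square)
qed

text \<open>The error is at most the average of the translation error \<open>T\<close> against the
  kernel. Near the origin \<open>T\<close> is small by continuity of translations; elsewhere
  \<open>T\<close> is bounded and the kernel is small. The lemma returns thresholds instead of a
  kernel, so that one kernel can serve several functions at once.\<close>

lemma mollify_approx:
  fixes f :: "real^2 \<Rightarrow> real"
  assumes f: "f \<in> L2" and "e > 0"
  obtains d \<delta> where "d > 0" "\<delta> > 0"
    "\<And>K d' \<delta>'. d' \<le> d \<Longrightarrow> \<delta>' \<le> \<delta> \<Longrightarrow> concentrated_kernel d' \<delta>' K \<Longrightarrow> (LINT x:cell|lborel. (mollify K f x - f x)\<^sup>2) < e"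
proof -
  note [measurable] = L2_measurable[OF f]
  have f2: "set_integrable lborel cell (\<lambda>z. (f z)\<^sup>2)" using L2_square_integrable[OF f] by simp
  have per2: "periodic (\<lambda>x. (f x)\<^sup>2)" using L2_periodic[OF f] unfolding periodic_def by simp
  obtain d where d: "d > 0" "\<And>y. norm y < d \<Longrightarrow> (LINT x:cell|lborel. (f (x + y) - f x)\<^sup>2) < e / 4"
    using translation_continuous_L2[OF L2_measurable[OF f] L2_periodic[OF f] f2, of "e / 4"] assms(2) by auto
  define T where "T y = (LINT x:cell|lborel. (f (x + y) - f x)\<^sup>2)" for y
  define B where "B = 4 * (LINT x:cell|lborel. (f x)\<^sup>2)"
  have fy2: "set_integrable lborel cell (\<lambda>x. (f (x + y))\<^sup>2)" for y
    using set_integrable_cell_translate[OF _ per2] f2 by simp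
  have iT: "set_integrable lborel cell (\<lambda>x. (f (x + y) - f x)\<^sup>2)" for y
    by (intro set_integrable_square_diff fy2 f2) auto
  have T0: "0 \<le> T y" for y unfolding T_def set_lebesgue_integral_def
    by (intro Bochner_Integration.integral_nonneg) (simp add: indicator_def)
  have TB: "T y \<le> B" for y
  proof -
    have "T y \<le> 2 * (LINT x:cell|lborel. (f (x + y))\<^sup>2) + 2 * (LINT x:cell|lborel. (- f x)\<^sup>2)"
      using set_integral_square_add_le[of lborel cell "\<lambda>x. f (x + y)" "\<lambda>x. - f x"] fy2 f2 unfolding T_def by simp
    then show ?thesis using cell_integral_translate[OF _ per2, of y] unfolding B_def by simp
  qed
  have B0: "0 \<le> B" using T0 TB order_trans by blast
  \<comment> \<open>Chosen so that \<open>\<delta> * B\<close> is at most \<open>e / 4\<close>; the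
    \<open>+ 1\<close> avoids division by zero when \<open>f\<close> vanishes.\<close>
  define \<delta> where "\<delta> = e / (4 * (B + 1))"
  have \<delta>: "\<delta> > 0" "\<delta> * B \<le> e / 4" using assms(2) B0 by (auto simp: \<delta>_def field_simps)
  show ?thesis
  proof (rule that[OF d(1) \<delta>(1)])
    fix K d' \<delta>' assume dd': "d' \<le> d" "\<delta>' \<le> \<delta>" and K: "concentrated_kernel d' \<delta>' K"
    have smK: "continuous_on UNIV K" using K smooth_on_continuous unfolding concentrated_kernel_def by blast
    have [measurable]: "K \<in> borel_measurable borel" using smK borel_measurable_continuous_onI by auto
    have K0: "0 \<le> K w" "K (- w) = K w" for w using K unfolding concentrated_kernel_def by auto
    have f1: "set_integrable lborel cell f" by (rule set_integrable_of_square[OF bounded_cell _ _ f2]) auto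
    have "smooth_on UNIV (mollify K f)"
      by (rule smooth_on_mollify[OF _ L2_measurable[OF f] f1]) (use K in \<open>simp add: concentrated_kernel_def\<close>)
    then have cm: "continuous_on UNIV (mollify K f)" by (rule smooth_on_continuous)
    then have [measurable]: "mollify K f \<in> borel_measurable borel" by (rule borel_measurable_continuous_onI)
    have im: "set_integrable lborel cell (\<lambda>x. (mollify K f x - f x)\<^sup>2)"
      by (intro set_integrable_square_diff f2 set_integrable_bounded_continuous bounded_cell continuous_intros cm) auto
    \<comment> \<open>From here the computation runs in \<open>ennreal\<close>: Tonelli's theorem
      then exchanges the two integrals with no integrability on the product to check.\<close>
    have "ennreal (LINT x:cell|lborel. (mollify K f x - f x)\<^sup>2) = (\<integral>\<^sup>+x. ennreal (indicator cell x *\<^sub>R (mollify K f x - f x)\<^sup>2) \<partial>lborel)"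
      unfolding set_lebesgue_integral_def
      by (rule nn_integral_eq_integral[symmetric]) (use im in \<open>auto simp: set_integrable_def indicator_def\<close>)
    also have "\<dots> \<le> (\<integral>\<^sup>+x. (\<integral>\<^sup>+z. ennreal (K (x - z) * (f z - f x)\<^sup>2) * indicator cell z \<partial>lborel) * indicator cell x \<partial>lborel)"
    proof (rule nn_integral_mono)
      fix x
      have "ennreal ((mollify K f x - f x)\<^sup>2) \<le> ennreal (LINT z:cell|lborel. K (x - z) * (f z - f x)\<^sup>2)"
        by (intro ennreal_leI kernel_integral_square_le[OF K f])
      also have "\<dots> = (\<integral>\<^sup>+z. ennreal (indicator cell z *\<^sub>R (K (x - z) * (f z - f x)\<^sup>2)) \<partial>lborel)"
        unfolding set_lebesgue_integral_def
        by (rule nn_integral_eq_integral[symmetric])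
          (use kernel_integral_square_le(2)[OF K f, of x] K0 in \<open>auto simp: set_integrable_def indicator_def\<close>)
      also have "\<dots> = (\<integral>\<^sup>+z. ennreal (K (x - z) * (f z - f x)\<^sup>2) * indicator cell z \<partial>lborel)"
        by (intro nn_integral_cong) (simp add: indicator_def)
      finally show "ennreal (indicator cell x *\<^sub>R (mollify K f x - f x)\<^sup>2)
          \<le> (\<integral>\<^sup>+z. ennreal (K (x - z) * (f z - f x)\<^sup>2) * indicator cell z \<partial>lborel) * indicator cell x"
        by (simp add: indicator_def)
    qed
    \<comment> \<open>Substitution \<open>z = x + (w - half_vec)\<close>. Periodicity lets
      \<open>w\<close> range over \<open>cell\<close> again, so that \<open>w - half_vec\<close>
      ranges over the cell centred at the origin, where the kernel is known to concentrate.\<close>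
    also have "\<dots> = (\<integral>\<^sup>+x. (\<integral>\<^sup>+w. ennreal (K (w - half_vec) * (f (x + (w - half_vec)) - f x)\<^sup>2) * indicator cell w \<partial>lborel) * indicator cell x \<partial>lborel)"
    proof (rule nn_integral_cong)
      fix x
      have "(\<integral>\<^sup>+z. ennreal (K (x - z) * (f z - f x)\<^sup>2) * indicator cell z \<partial>lborel)
         = (\<integral>\<^sup>+w. ennreal (K (x - (w + (x - half_vec))) * (f (w + (x - half_vec)) - f x)\<^sup>2) * indicator cell w \<partial>lborel)"
      proof (rule nn_integral_cell_translate[symmetric])
        have pf: "f (z + k) = f z" if "\<forall>i. k $ i \<in> \<int>" for z k
          using L2_periodic[OF f] that unfolding periodic_def by blast
        have pK: "K (x - (z + k)) = K (x - z)" if "\<forall>i. k $ i \<in> \<int>" for z k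
        proof -
          have "K (z - x + k) = K (z - x)" using K that unfolding concentrated_kernel_def periodic_def by blast
          then show ?thesis using K0(2)[of "z - x + k"] K0(2)[of "z - x"] by (simp add: algebra_simps)
        qed
        show "periodic (\<lambda>z. ennreal (K (x - z) * (f z - f x)\<^sup>2))" unfolding periodic_def using pf pK by simp
      qed simp
      also have "\<dots> = (\<integral>\<^sup>+w. ennreal (K (w - half_vec) * (f (x + (w - half_vec)) - f x)\<^sup>2) * indicator cell w \<partial>lborel)"
      proof (rule nn_integral_cong)
        fix w
        have "x - (w + (x - half_vec)) = - (w - half_vec)" "w + (x - half_vec) = x + (w - half_vec)" by auto
        then show "ennreal (K (x - (w + (x - half_vec))) * (f (w + (x - half_vec)) - f x)\<^sup>2) * indicator cell w
            = ennreal (K (w - half_vec) * (f (x + (w - half_vec)) - f x)\<^sup>2) * indicator cell w"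
          by (simp only: K0(2))
      qed
      finally show "(\<integral>\<^sup>+z. ennreal (K (x - z) * (f z - f x)\<^sup>2) * indicator cell z \<partial>lborel) * indicator cell x
         = (\<integral>\<^sup>+w. ennreal (K (w - half_vec) * (f (x + (w - half_vec)) - f x)\<^sup>2) * indicator cell w \<partial>lborel) * indicator cell x"
        by simp
    qed
    also have "\<dots> = (\<integral>\<^sup>+x. (\<integral>\<^sup>+w. ennreal (K (w - half_vec) * (f (x + (w - half_vec)) - f x)\<^sup>2) * indicator cell w * indicator cell x \<partial>lborel) \<partial>lborel)"
      by (subst nn_integral_multc) auto
    also have "\<dots> = (\<integral>\<^sup>+w. (\<integral>\<^sup>+x. ennreal (K (w - half_vec) * (f (x + (w - half_vec)) - f x)\<^sup>2) * indicator cell w * indicator cell x \<partial>lborel) \<partial>lborel)"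
      by (rule lborel_pair.Fubini') measurable
    also have "\<dots> = (\<integral>\<^sup>+w. ennreal (indicator cell w *\<^sub>R (K (w - half_vec) * T (w - half_vec))) \<partial>lborel)"
    proof (rule nn_integral_cong)
      fix w
      have "(\<integral>\<^sup>+x. ennreal (K (w - half_vec) * (f (x + (w - half_vec)) - f x)\<^sup>2) * indicator cell w * indicator cell x \<partial>lborel)
        = (\<integral>\<^sup>+x. (ennreal (K (w - half_vec)) * indicator cell w) * ennreal (indicator cell x *\<^sub>R (f (x + (w - half_vec)) - f x)\<^sup>2) \<partial>lborel)"
        by (intro nn_integral_cong) (auto simp: ennreal_mult K0 indicator_def)
      also have "\<dots> = (ennreal (K (w - half_vec)) * indicator cell w) * (\<integral>\<^sup>+x. ennreal (indicator cell x *\<^sub>R (f (x + (w - half_vec)) - f x)\<^sup>2) \<partial>lborel)"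
        by (rule nn_integral_cmult) measurable
      also have "(\<integral>\<^sup>+x. ennreal (indicator cell x *\<^sub>R (f (x + (w - half_vec)) - f x)\<^sup>2) \<partial>lborel) = ennreal (T (w - half_vec))"
        unfolding T_def set_lebesgue_integral_def
        by (rule nn_integral_eq_integral) (use iT[of "w - half_vec"] in \<open>auto simp: set_integrable_def indicator_def\<close>)
      finally show "(\<integral>\<^sup>+x. ennreal (K (w - half_vec) * (f (x + (w - half_vec)) - f x)\<^sup>2) * indicator cell w * indicator cell x \<partial>lborel)
         = ennreal (indicator cell w *\<^sub>R (K (w - half_vec) * T (w - half_vec)))"
        by (auto simp: ennreal_mult K0 T0 indicator_def)
    qed
    \<comment> \<open>The sum of the bounds for short and for long shifts is used everywhere, which
      avoids splitting the domain.\<close>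
    also have "\<dots> \<le> (\<integral>\<^sup>+w. ennreal (indicator cell w *\<^sub>R (K (w - half_vec) * (e / 4) + e / 4)) \<partial>lborel)"
    proof (rule nn_integral_mono, rule ennreal_leI)
      fix w
      have "K (w - half_vec) * T (w - half_vec) \<le> K (w - half_vec) * (e / 4) + e / 4" if "w \<in> cell"
      proof (cases "norm (w - half_vec) < d")
        case True
        then have "T (w - half_vec) \<le> e / 4" using d(2) unfolding T_def by (simp add: less_imp_le)
        then have "K (w - half_vec) * T (w - half_vec) \<le> K (w - half_vec) * (e / 4)" by (intro mult_left_mono K0)
        then show ?thesis using assms(2) by simp
      next
        case False
        then have "d' \<le> norm (w - half_vec)" using dd' by linarith
        then have "K (w - half_vec) \<le> \<delta>'" using K that unfolding concentrated_kernel_def by blast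
        then have "K (w - half_vec) \<le> \<delta>" using dd' by linarith
        then have "K (w - half_vec) * T (w - half_vec) \<le> \<delta> * B" using \<delta>(1) by (intro mult_mono TB T0) auto
        moreover have "0 \<le> K (w - half_vec) * (e / 4)" using K0 assms(2) by simp
        ultimately show ?thesis using \<delta>(2) by linarith
      qed
      then show "indicator cell w *\<^sub>R (K (w - half_vec) * T (w - half_vec)) \<le> indicator cell w *\<^sub>R (K (w - half_vec) * (e / 4) + e / 4)"
        by (simp add: indicator_def)
    qed
    also have "\<dots> = ennreal (LINT w:cell|lborel. K (w - half_vec) * (e / 4) + e / 4)"
    proof -
      have "continuous_on UNIV (\<lambda>w. K (w - half_vec) * (e / 4) + e / 4)"
        by (intro continuous_intros continuous_on_compose2[OF smK]) auto
      then have "set_integrable lborel cell (\<lambda>w. K (w - half_vec) * (e / 4) + e / 4)"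
        by (intro set_integrable_bounded_continuous bounded_cell cell_borel)
      then show ?thesis unfolding set_lebesgue_integral_def using K0 assms(2)
        by (intro nn_integral_eq_integral) (auto simp: set_integrable_def indicator_def)
    qed
    also have "(LINT w:cell|lborel. K (w - half_vec) * (e / 4) + e / 4)
       = (LINT w:cell|lborel. K (w + - half_vec) * (e / 4)) + (LINT w:cell|lborel. e / 4)"
    proof -
      have "continuous_on UNIV (\<lambda>w. K (w + - half_vec) * (e / 4))"
        by (intro continuous_intros continuous_on_compose2[OF smK]) auto
      then have i1: "set_integrable lborel cell (\<lambda>w. K (w + - half_vec) * (e / 4))"
        by (intro set_integrable_bounded_continuous bounded_cell cell_borel)
      have i2: "set_integrable lborel cell (\<lambda>w::real^2. e / 4)"
        by (intro set_integrable_bounded_continuous bounded_cell cell_borel continuous_on_const)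
      show ?thesis using set_integral_add(2)[OF i1 i2] by (simp only: diff_conv_add_uminus)
    qed
    also have "(LINT w:cell|lborel. K (w + - half_vec) * (e / 4)) = e / 4"
    proof -
      have "(LINT w:cell|lborel. K (w + - half_vec)) = (LINT w:cell|lborel. K w)"
        by (rule cell_integral_translate) (use K in \<open>auto simp: concentrated_kernel_def\<close>)
      then show ?thesis using K unfolding concentrated_kernel_def by simp
    qed
    finally have "(LINT x:cell|lborel. (mollify K f x - f x)\<^sup>2) \<le> e / 4 + (LINT w:cell|lborel. e / 4)"
      using assms(2) by (subst (asm) ennreal_le_iff) (auto simp: set_lebesgue_integral_def)
    moreover have "(LINT w:cell|lborel. e / 4) \<le> e / 4"
    proof -
      have "measure lborel cell \<le> 1" using emeasure_cell_le by (simp add: measure_def enn2real_leI)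
      then have "measure lborel cell * (e / 4) \<le> 1 * (e / 4)" using assms(2) by (intro mult_right_mono) auto
      then show ?thesis by (simp add: set_lebesgue_integral_def)
    qed
    ultimately show "(LINT x:cell|lborel. (mollify K f x - f x)\<^sup>2) < e" using assms(2) by linarith
  qed
qed

lemma periodic_mollify: "periodic K \<Longrightarrow> periodic (mollify K f)"
  unfolding periodic_def mollify_def
proof safe
  fix x k assume K: "\<forall>x k. (\<forall>i. k $ i \<in> \<int>) \<longrightarrow> K (x + k) = K x" and k: "\<forall>i. (k :: real^2) $ i \<in> \<int>"
  have "K (x + k - z) = K (x - z)" for z
  proof -
    have "x + k - z = (x - z) + k" by simp
    then show ?thesis using K k by metis
  qed
  then show "(LINT z:cell|lborel. K (x + k - z) * f z) = (LINT z:cell|lborel. K (x - z) * f z)" by (simp only:)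
qed

lemma smooth_periodic_approx:
  fixes f :: "real^2 \<Rightarrow> real"
  assumes f: "f \<in> L2" and "e > 0"
  obtains \<psi> where "smooth_on UNIV \<psi>" "periodic \<psi>" "(LINT x:cell|lborel. (\<psi> x - f x)\<^sup>2) < e"
proof -
  obtain d \<delta> where d: "d > 0" "\<delta> > 0" and
    app: "\<And>K d' \<delta>'. d' \<le> d \<Longrightarrow> \<delta>' \<le> \<delta> \<Longrightarrow> concentrated_kernel d' \<delta>' K \<Longrightarrow> (LINT x:cell|lborel. (mollify K f x - f x)\<^sup>2) < e"
    using mollify_approx[OF assms] by blast
  obtain K where K: "concentrated_kernel d \<delta> K" using concentrated_kernel_exists[OF d] by blast
  have f2: "set_integrable lborel cell (\<lambda>z. (f z)\<^sup>2)" using L2_square_integrable[OF f] by simp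
  have f1: "set_integrable lborel cell f"
    by (rule set_integrable_of_square[OF bounded_cell _ _ f2]) (auto intro: L2_measurable[OF f])
  show ?thesis
  proof (rule that[of "mollify K f"])
    show "smooth_on UNIV (mollify K f)"
      by (rule smooth_on_mollify[OF _ L2_measurable[OF f] f1]) (use K in \<open>simp add: concentrated_kernel_def\<close>)
    show "periodic (mollify K f)" using K periodic_mollify unfolding concentrated_kernel_def by blast
  qed (rule app[OF order_refl order_refl K])
qed

lemma smooth_on_vec:
  fixes v :: "'a::real_normed_vector \<Rightarrow> real^2"
  assumes "open S" "\<And>i. smooth_on S (\<lambda>x. v x $ i)" shows "smooth_on S v"
proof -
  have "v = (\<lambda>x. v x $ 1 *\<^sub>R axis 1 1 + v x $ 2 *\<^sub>R axis 2 1)"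
    by (rule ext) (simp add: vec_eq_iff forall_2 axis_def)
  moreover have "smooth_on S (\<lambda>x. v x $ 1 *\<^sub>R axis 1 1 + v x $ 2 *\<^sub>R axis 2 1 :: real^2)"
    by (intro smooth_on_add smooth_on_scaleR smooth_on_const assms)
  ultimately show ?thesis by simp
qed

lemma pd_eq_dd: "pd j f x = dd (axis j 1) f x"
  unfolding pd_def dd_def ..

lemma dd_vec_nth:
  fixes v :: "'a::real_normed_vector \<Rightarrow> real^2"
  assumes "v differentiable (at x)" shows "dd w v x $ i = dd w (\<lambda>x. v x $ i) x"
  using dd_eqI[OF bounded_linear.has_derivative[OF bounded_linear_vec_nth dd_has_derivative[OF assms]]] by metis

section \<open>Divergence-free approximation and weak gradients\<close>

text \<open>Convolution commutes with derivatives, so smoothing preserves the weak constraint: the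
  divergence of the smoothed field at \<open>x\<close> is minus the pairing of \<open>u\<close> with
  the gradient of the test function \<open>\<psi>\<close>, the kernel centred at \<open>x\<close>,
  and that pairing vanishes.\<close>

lemma divergence_free_approx:
  fixes u :: "real^2 \<Rightarrow> real^2"
  assumes u: "u \<in> L2" "divergence_free u" and "e > 0"
  obtains v where "smooth_on UNIV v" "periodic v" "\<And>x. divergence v x = 0"
    "(LINT x:cell|lborel. (norm (u x - v x))\<^sup>2) < e"
proof -
  let ?u = "\<lambda>i x. u x $ i"
  have ui: "?u i \<in> L2" for i using L2_linear_image[OF u(1) bounded_linear_vec_nth] .
  have um[measurable]: "?u i \<in> borel_measurable borel" for i using L2_measurable[OF ui] .
  have u2: "set_integrable lborel cell (\<lambda>z. (?u i z)\<^sup>2)" for i using L2_square_integrable[OF ui] by simp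
  have u1: "set_integrable lborel cell (?u i)" for i
    by (rule set_integrable_of_square[OF bounded_cell _ _ u2]) auto
  obtain d \<delta> where d: "d > 0" "\<delta> > 0" and
    app1: "\<And>K d' \<delta>'. d' \<le> d \<Longrightarrow> \<delta>' \<le> \<delta> \<Longrightarrow> concentrated_kernel d' \<delta>' K \<Longrightarrow> (LINT x:cell|lborel. (mollify K (?u 1) x - ?u 1 x)\<^sup>2) < e / 2"
    using mollify_approx[OF ui half_gt_zero[OF assms(3)], of 1] by blast
  obtain d2 \<delta>2 where d2: "d2 > 0" "\<delta>2 > 0" and
    app2: "\<And>K d' \<delta>'. d' \<le> d2 \<Longrightarrow> \<delta>' \<le> \<delta>2 \<Longrightarrow> concentrated_kernel d' \<delta>' K \<Longrightarrow> (LINT x:cell|lborel. (mollify K (?u 2) x - ?u 2 x)\<^sup>2) < e / 2"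
    using mollify_approx[OF ui half_gt_zero[OF assms(3)], of 2] by blast
  \<comment> \<open>Both components are smoothed by the same kernel, since the two partial
    derivatives have to combine into a pairing with the gradient of one test function.\<close>
  obtain K where K: "concentrated_kernel (min d d2) (min \<delta> \<delta>2) K"
    using concentrated_kernel_exists[of "min d d2" "min \<delta> \<delta>2"] d d2 by auto
  have sep: "separable (\<lambda>x z. K (x - z))" and smK: "smooth_on UNIV K" and pK: "periodic K" and evK: "\<And>w. K (- w) = K w"
    using K unfolding concentrated_kernel_def by auto
  define v where "v x = (\<chi> i. mollify K (?u i) x)" for x
  have vi: "(\<lambda>x. v x $ i) = mollify K (?u i)" for i by (simp add: v_def)
  have sm: "smooth_on UNIV (mollify K (?u i))" for i by (rule smooth_on_mollify[OF sep um u1])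
  show ?thesis
  proof (rule that)
    show smv: "smooth_on UNIV v" by (rule smooth_on_vec) (auto simp: vi sm)
    show "periodic v" using periodic_mollify[OF pK] unfolding periodic_def v_def by (simp add: vec_eq_iff)
    show "divergence v x = 0" for x
    proof -
      have dK: "set_integrable lborel cell (\<lambda>z. dd (axis j 1) K (x - z) * ?u j z)" for j
        by (intro set_integrable_mult_continuous bounded_cell u1
            continuous_on_compose2[OF smooth_on_continuous[OF smooth_on_dd[OF smK]]] continuous_intros) auto
      define \<psi> where "\<psi> z = K (x - z)" for z
      have \<psi>: "\<psi> = (\<lambda>z. K (z + - x))" 
      proof
        show "\<psi> z = K (z + - x)" for z using evK[of "x - z"] by (simp add: \<psi>_def)
      qed
      have "smooth_on UNIV \<psi>" unfolding \<psi>
        using smooth_on_compose_affine[OF bounded_linear_ident open_UNIV open_UNIV _ smK, of "- x"] by (simp add: add.commute)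
      moreover have "periodic \<psi>" unfolding periodic_def
      proof safe
        fix z k assume "\<forall>i. (k :: real^2) $ i \<in> \<int>"
        then have "K ((z + - x) + k) = K (z + - x)" using pK unfolding periodic_def by blast
        moreover have "(z + - x) + k = (z + k) + - x" by simp
        ultimately show "\<psi> (z + k) = \<psi> z" unfolding \<psi> by (simp only:)
      qed
      ultimately have z: "(LINT z:cell|lborel. (\<Sum>j\<in>UNIV. u z $ j * pd j \<psi> z)) = 0"
        using u(2) unfolding divergence_free_def by blast
      have p: "pd j \<psi> z = - dd (axis j 1) K (x - z)" for j z
      proof -
        have "((\<lambda>z. x - z) has_derivative (\<lambda>h. - h)) (at z)" by (auto intro!: derivative_eq_intros)
        from has_derivative_compose[OF this smooth_on_has_derivative[OF smK UNIV_I]]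
        have "((\<lambda>z. K (x - z)) has_derivative (\<lambda>h. dd (- h) K (x - z))) (at z)" .
        then have "dd (axis j 1) \<psi> z = dd (- axis j 1) K (x - z)" unfolding \<psi>_def by (rule dd_eqI)
        also have "\<dots> = - dd (axis j 1) K (x - z)"
          using linear_neg[OF has_derivative_linear[OF smooth_on_has_derivative[OF smK UNIV_I]]] .
        finally show ?thesis unfolding pd_eq_dd .
      qed
      have "divergence v x = (\<Sum>j\<in>UNIV. dd (axis j 1) (mollify K (?u j)) x)"
        unfolding divergence_def pd_eq_dd using dd_vec_nth[OF smooth_on_differentiable[OF smv UNIV_I]] vi by simp
      also have "\<dots> = (LINT z:cell|lborel. dd (axis 1 1) K (x - z) * ?u 1 z) + (LINT z:cell|lborel. dd (axis 2 1) K (x - z) * ?u 2 z)"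
        by (simp add: sum_2 dd_mollify[OF sep um u1])
      also have "\<dots> = (LINT z:cell|lborel. dd (axis 1 1) K (x - z) * ?u 1 z + dd (axis 2 1) K (x - z) * ?u 2 z)"
        by (rule set_integral_add(2)[OF dK dK, symmetric])
      also have "\<dots> = (LINT z:cell|lborel. - (\<Sum>j\<in>UNIV. u z $ j * pd j \<psi> z))"
        unfolding p by (simp add: sum_2 mult.commute add.commute)
      also have "\<dots> = 0" using z unfolding set_lebesgue_integral_def by simp
      finally show ?thesis .
    qed
    have i: "set_integrable lborel cell (\<lambda>x. (mollify K (?u i) x - ?u i x)\<^sup>2)" for i
    proof -
      have c: "continuous_on UNIV (mollify K (?u i))" by (rule smooth_on_continuous[OF sm])
      then have [measurable]: "mollify K (?u i) \<in> borel_measurable borel" by (rule borel_measurable_continuous_onI)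
      show ?thesis
        by (intro set_integrable_square_diff u2 set_integrable_bounded_continuous bounded_cell continuous_intros c) auto
    qed
    have "(LINT x:cell|lborel. (norm (u x - v x))\<^sup>2)
      = (LINT x:cell|lborel. (mollify K (?u 1) x - ?u 1 x)\<^sup>2 + (mollify K (?u 2) x - ?u 2 x)\<^sup>2)"
    proof -
      have "(u x $ i - v x $ i)\<^sup>2 = (mollify K (?u i) x - ?u i x)\<^sup>2" for i x
        unfolding v_def vec_lambda_beta by (rule power2_commute)
      then show ?thesis unfolding norm_sq_vec2 vector_minus_component by (simp only:)
    qed
    also have "\<dots> = (LINT x:cell|lborel. (mollify K (?u 1) x - ?u 1 x)\<^sup>2) + (LINT x:cell|lborel. (mollify K (?u 2) x - ?u 2 x)\<^sup>2)"
      by (rule set_integral_add(2)[OF i i])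
    also have "\<dots> < e" using app1[OF min.cobounded1 min.cobounded1 K] app2[OF min.cobounded2 min.cobounded2 K] by simp
    finally show "(LINT x:cell|lborel. (norm (u x - v x))\<^sup>2) < e" .
  qed
qed

text \<open>The square of \<open>h\<close> is at most the square of \<open>\<psi> - h\<close> plus
  twice the product of \<open>\<psi>\<close> and \<open>h\<close>. The product integrates to zero,
  and the first term is arbitrarily small for a suitable smooth \<open>\<psi>\<close>.\<close>

lemma L2_orthogonal_smooth_imp_zero:
  fixes h :: "real^2 \<Rightarrow> real"
  assumes h: "h \<in> L2" and orth: "\<And>\<psi>. smooth_on UNIV \<psi> \<Longrightarrow> periodic \<psi> \<Longrightarrow> (LINT x:cell|lborel. h x * \<psi> x) = 0"
  shows "AE x in lborel. x \<in> cell \<longrightarrow> h x = 0"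
proof -
  note [measurable] = L2_measurable[OF h]
  have h2: "set_integrable lborel cell (\<lambda>z. (h z)\<^sup>2)" using L2_square_integrable[OF h] by simp
  have h1: "set_integrable lborel cell h" by (rule set_integrable_of_square[OF bounded_cell _ _ h2]) auto
  have "(LINT x:cell|lborel. (h x)\<^sup>2) \<le> e" if e: "e > 0" for e
  proof -
    obtain \<psi> where \<psi>: "smooth_on UNIV \<psi>" "periodic \<psi>" "(LINT x:cell|lborel. (\<psi> x - h x)\<^sup>2) < e"
      using smooth_periodic_approx[OF h e] by blast
    have c: "continuous_on UNIV \<psi>" by (rule smooth_on_continuous[OF \<psi>(1)])
    then have [measurable]: "\<psi> \<in> borel_measurable borel" by (rule borel_measurable_continuous_onI)
    have i1: "set_integrable lborel cell (\<lambda>x. (\<psi> x)\<^sup>2)"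
      by (intro set_integrable_bounded_continuous bounded_cell continuous_intros c) auto
    have i2: "set_integrable lborel cell (\<lambda>x. (\<psi> x - h x)\<^sup>2)"
      by (intro set_integrable_square_diff i1 h2) auto
    have i3: "set_integrable lborel cell (\<lambda>x. \<psi> x * h x)"
      by (rule set_integrable_mult_continuous[OF bounded_cell _ _ c h1]) auto
    have "(LINT x:cell|lborel. (h x)\<^sup>2) \<le> (LINT x:cell|lborel. (\<psi> x - h x)\<^sup>2 + 2 * (\<psi> x * h x))"
    proof (rule set_integral_mono[OF h2])
      show "set_integrable lborel cell (\<lambda>x. (\<psi> x - h x)\<^sup>2 + 2 * (\<psi> x * h x))"
        by (intro set_integral_add i2 set_integrable_mult_right i3)
      show "(h x)\<^sup>2 \<le> (\<psi> x - h x)\<^sup>2 + 2 * (\<psi> x * h x)" for x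
        using zero_le_power2[of "\<psi> x"] by (simp add: power2_eq_square algebra_simps)
    qed
    also have "\<dots> = (LINT x:cell|lborel. (\<psi> x - h x)\<^sup>2) + (LINT x:cell|lborel. 2 * (\<psi> x * h x))"
      by (intro set_integral_add(2) i2 set_integrable_mult_right i3)
    also have "\<dots> \<le> e" using \<psi>(3) orth[OF \<psi>(1,2)] by (simp add: mult.commute)
    finally show ?thesis .
  qed
  then have "(LINT x:cell|lborel. (h x)\<^sup>2) \<le> 0" by (rule field_le_epsilon) simp
  then have "(\<integral>x. indicator cell x *\<^sub>R (h x)\<^sup>2 \<partial>lborel) = 0"
    unfolding set_lebesgue_integral_def
    by (intro antisym Bochner_Integration.integral_nonneg) (auto simp: indicator_def)
  then have "AE x in lborel. indicator cell x *\<^sub>R (h x)\<^sup>2 = 0"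
    using integral_nonneg_eq_0_iff_AE[of lborel "\<lambda>x. indicator cell x *\<^sub>R (h x)\<^sup>2"] h2
    unfolding set_integrable_def by (auto simp: indicator_def)
  then show ?thesis by eventually_elim (auto simp: indicator_def)
qed

text \<open>Entry by entry, the difference of two weak gradients is orthogonal to all smooth
  periodic functions. This makes the choice behind \<open>weak_gradient\<close> harmless: its norm
  can be computed from any convenient representative.\<close>

lemma weak_gradient_unique:
  assumes "has_weak_gradient v G" "has_weak_gradient v G'"
  shows "L2norm G = L2norm G'"
proof -
  have G: "G \<in> L2" "G' \<in> L2" using assms unfolding has_weak_gradient_def by auto
  note [measurable] = L2_measurable[OF G(1)] L2_measurable[OF G(2)]
  have lin: "bounded_linear (\<lambda>A::real^2^2. A $ i $ j)" for i j
    by (intro bounded_linear_compose[OF bounded_linear_vec_nth bounded_linear_vec_nth])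
  have Gij: "(\<lambda>x. G x $ i $ j) \<in> L2" "(\<lambda>x. G' x $ i $ j) \<in> L2" for i j
    using L2_linear_image[OF G(1) lin] L2_linear_image[OF G(2) lin] by auto
  have AE1: "AE x in lborel. x \<in> cell \<longrightarrow> G x $ i $ j = G' x $ i $ j" for i j
  proof -
    let ?g = "\<lambda>x. G x $ i $ j" and ?g' = "\<lambda>x. G' x $ i $ j"
    note [measurable] = L2_measurable[OF Gij(1)[of i j]] L2_measurable[OF Gij(2)[of i j]]
    have s: "set_integrable lborel cell (\<lambda>x. (?g x)\<^sup>2)" "set_integrable lborel cell (\<lambda>x. (?g' x)\<^sup>2)"
      using L2_square_integrable[OF Gij(1)[of i j]] L2_square_integrable[OF Gij(2)[of i j]] by auto
    have s1: "set_integrable lborel cell ?g" "set_integrable lborel cell ?g'"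
      by (rule set_integrable_of_square[OF bounded_cell _ _ s(1)], auto)
        (rule set_integrable_of_square[OF bounded_cell _ _ s(2)], auto)
    have "AE x in lborel. x \<in> cell \<longrightarrow> ?g x - ?g' x = 0"
    proof (rule L2_orthogonal_smooth_imp_zero)
      have "set_integrable lborel cell (\<lambda>x. (?g x - ?g' x)\<^sup>2)" by (intro set_integrable_square_diff s) auto
      then show "(\<lambda>x. ?g x - ?g' x) \<in> L2"
        using L2_periodic[OF Gij(1)[of i j]] L2_periodic[OF Gij(2)[of i j]] unfolding L2_def periodic_def by simp
      fix \<psi> :: "real^2 \<Rightarrow> real" assume \<psi>: "smooth_on UNIV \<psi>" "periodic \<psi>"
      have c: "continuous_on UNIV \<psi>" by (rule smooth_on_continuous[OF \<psi>(1)])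
      have i: "set_integrable lborel cell (\<lambda>x. \<psi> x * ?g x)" "set_integrable lborel cell (\<lambda>x. \<psi> x * ?g' x)"
        by (rule set_integrable_mult_continuous[OF bounded_cell _ _ c s1(1)], auto)
          (rule set_integrable_mult_continuous[OF bounded_cell _ _ c s1(2)], auto)
      have "(LINT x:cell|lborel. (?g x - ?g' x) * \<psi> x) = (LINT x:cell|lborel. \<psi> x * ?g x - \<psi> x * ?g' x)"
        by (simp add: algebra_simps)
      also have "\<dots> = (LINT x:cell|lborel. \<psi> x * ?g x) - (LINT x:cell|lborel. \<psi> x * ?g' x)"
        by (rule set_integral_diff(2)[OF i])
      also have "\<dots> = 0"
      proof -
        have "(LINT x:cell|lborel. v x $ i * pd j \<psi> x) = - (LINT x:cell|lborel. ?g x * \<psi> x)"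
          "(LINT x:cell|lborel. v x $ i * pd j \<psi> x) = - (LINT x:cell|lborel. ?g' x * \<psi> x)"
          using assms \<psi> unfolding has_weak_gradient_def by blast+
        then show ?thesis by (simp add: mult.commute)
      qed
      finally show "(LINT x:cell|lborel. (?g x - ?g' x) * \<psi> x) = 0" .
    qed
    then show ?thesis by eventually_elim auto
  qed
  have "AE x in lborel. x \<in> cell \<longrightarrow> G x = G' x"
    using AE1[of 1 1] AE1[of 1 2] AE1[of 2 1] AE1[of 2 2]
    by eventually_elim (auto simp: vec_eq_iff forall_2)
  then have "(LINT x:cell|lborel. (norm (G x))\<^sup>2) = (LINT x:cell|lborel. (norm (G' x))\<^sup>2)"
    unfolding set_lebesgue_integral_def
    by (intro integral_cong_AE) (auto simp: indicator_def elim: eventually_mono)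
  then show ?thesis unfolding L2norm_def by simp
qed

lemma L2norm_weak_gradient:
  assumes "has_weak_gradient v G" shows "L2norm (weak_gradient v) = L2norm G"
  using weak_gradient_unique[OF _ assms] someI[of "has_weak_gradient v", OF assms]
  unfolding weak_gradient_def by blast

lemma
  fixes F :: "'a::euclidean_space \<times> 'b::euclidean_space \<Rightarrow> real"
  assumes c: "continuous_on UNIV F" and A: "bounded A" "A \<in> sets borel" and B: "bounded B" "B \<in> sets borel"
  shows set_integral_iterated_swap:
      "(LINT x:A|lborel. LINT y:B|lborel. F (x, y)) = (LINT y:B|lborel. LINT x:A|lborel. F (x, y))"
    and set_integrable_iterated: "set_integrable lborel A (\<lambda>x. LINT y:B|lborel. F (x, y))"
    and set_integrable_iterated_snd: "set_integrable lborel B (\<lambda>y. LINT x:A|lborel. F (x, y))"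
proof -
  have AB: "bounded (A \<times> B)" "A \<times> B \<in> sets borel"
    using A B unfolding borel_prod[symmetric] by (auto intro: bounded_Times pair_measureI)
  have i: "integrable (lborel \<Otimes>\<^sub>M lborel) (\<lambda>p. indicator (A \<times> B) p *\<^sub>R F p)"
    using set_integrable_bounded_continuous[OF AB c]
    unfolding set_integrable_def lborel_prod .
  then have i': "integrable (lborel \<Otimes>\<^sub>M lborel) (\<lambda>(x, y). indicator (A \<times> B) (x, y) *\<^sub>R F (x, y))"
    by (simp add: case_prod_beta')
  have eq: "(\<integral>y. indicator (A \<times> B) (x, y) *\<^sub>R F (x, y) \<partial>lborel)
      = indicator A x *\<^sub>R (LINT y:B|lborel. F (x, y))" for x
    by (auto simp: indicator_times set_lebesgue_integral_def indicator_def)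
  have eq': "(\<integral>x. indicator (A \<times> B) (x, y) *\<^sub>R F (x, y) \<partial>lborel)
      = indicator B y *\<^sub>R (LINT x:A|lborel. F (x, y))" for y
    by (auto simp: indicator_times set_lebesgue_integral_def indicator_def)
  show "(LINT x:A|lborel. LINT y:B|lborel. F (x, y)) = (LINT y:B|lborel. LINT x:A|lborel. F (x, y))"
    using lborel_pair.Fubini_integral[OF i'] unfolding eq eq'
    by (simp add: set_lebesgue_integral_def)
  show "set_integrable lborel A (\<lambda>x. LINT y:B|lborel. F (x, y))"
    using lborel_pair.integrable_fst'[OF i] unfolding eq set_integrable_def .
  show "set_integrable lborel B (\<lambda>y. LINT x:A|lborel. F (x, y))"
    using lborel_pair.integrable_snd[OF i'] unfolding eq' set_integrable_def .
qed

lemma set_integral_nonneg_real: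
  fixes f :: "'a \<Rightarrow> real"
  shows "(\<And>x. x \<in> A \<Longrightarrow> 0 \<le> f x) \<Longrightarrow> 0 \<le> (LINT x:A|M. f x)"
  unfolding set_lebesgue_integral_def
  by (intro Bochner_Integration.integral_nonneg) (auto simp: indicator_def)

section \<open>Increments, gradients and interpolation\<close>

text \<open>Nonnegativity of the variance of \<open>g\<close> on an interval of length one.\<close>

lemma unit_interval_square_le:
  fixes g :: "real \<Rightarrow> real"
  assumes "continuous_on UNIV g"
  shows "(LINT s:{0..<1}|lborel. g s)\<^sup>2 \<le> (LINT s:{0..<1}|lborel. (g s)\<^sup>2)"
proof -
  have b: "bounded {0..<1::real}" by (rule bounded_subset[OF compact_imp_bounded[OF compact_Icc[of 0 1]]]) auto
  define m where "m = (LINT s:{0..<1}|lborel. g s)"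
  have i: "set_integrable lborel {0..<1} h" if "continuous_on UNIV h" for h :: "real \<Rightarrow> real"
    by (rule set_integrable_bounded_continuous[OF b _ that]) simp
  have i1: "set_integrable lborel {0..<1} (\<lambda>s. (g s)\<^sup>2)" by (intro i continuous_intros assms)
  have i2: "set_integrable lborel {0..<1} (\<lambda>s. 2 * m * g s)" by (intro i continuous_intros assms)
  have i3: "set_integrable lborel {0..<1} (\<lambda>s::real. m\<^sup>2)" by (intro i continuous_intros)
  have "0 \<le> (LINT s:{0..<1}|lborel. (g s - m)\<^sup>2)" by (rule set_integral_nonneg_real) simp
  also have "\<dots> = (LINT s:{0..<1}|lborel. ((g s)\<^sup>2 - 2 * m * g s) + m\<^sup>2)"
    by (simp add: power2_eq_square algebra_simps)
  also have "\<dots> = (LINT s:{0..<1}|lborel. (g s)\<^sup>2 - 2 * m * g s) + (LINT s:{0..<1::real}|lborel. m\<^sup>2)"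
    by (intro set_integral_add(2) set_integral_diff(1) i1 i2 i3)
  finally have "0 \<le> (LINT s:{0..<1}|lborel. (g s)\<^sup>2) - 2 * m * m + m\<^sup>2"
    using set_integral_diff(2)[OF i1 i2] by (simp add: m_def set_lebesgue_integral_def)
  then show ?thesis unfolding m_def[symmetric] by (simp add: power2_eq_square)
qed

lemma difference_eq_integral_dd:
  fixes f :: "real^2 \<Rightarrow> real"
  assumes "smooth_on UNIV f"
  shows "f (x + y) - f x = (LINT s:{0..<1}|lborel. dd y f (x + s *\<^sub>R y))"
proof -
  have c: "continuous_on UNIV (\<lambda>s. dd y f (x + s *\<^sub>R y))"
    by (rule continuous_on_compose2[OF smooth_on_continuous[OF smooth_on_dd[OF assms]]])
      (auto intro!: continuous_intros)
  have "(\<integral>s. dd y f (x + s *\<^sub>R y) * indicator {0..1} s \<partial>lborel) = f (x + 1 *\<^sub>R y) - f (x + 0 *\<^sub>R y)"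
  proof (rule integral_FTC_Icc_real)
    show "((\<lambda>s. f (x + s *\<^sub>R y)) has_real_derivative dd y f (x + s *\<^sub>R y)) (at s)" for s
      by (rule dd_line[OF smooth_on_differentiable[OF assms UNIV_I]])
    show "isCont (\<lambda>s. dd y f (x + s *\<^sub>R y)) s" for s
      using c continuous_on_eq_continuous_at open_UNIV by blast
  qed simp
  moreover have "(LINT s:{0..<1}|lborel. dd y f (x + s *\<^sub>R y)) = (LINT s:{0..1}|lborel. dd y f (x + s *\<^sub>R y))"
    by (rule set_integral_discrete_difference[where X="{1}"]) auto
  ultimately show ?thesis by (simp add: set_lebesgue_integral_def mult.commute)
qed

text \<open>The constant \<open>c\<close> covers two uses at once: \<open>c = 0\<close> bounds
  increments by first derivatives, and \<open>c = 1\<close> bounds the first-order Taylor remainder.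
  In both, the left side is the mean of the integrand over the segment from \<open>x\<close> to
  \<open>x + y\<close>, and Jensen's inequality with an exchange of integrals reduces to a fixed
  \<open>s\<close>.\<close>

lemma taylor_square_integral_le:
  fixes f :: "real^2 \<Rightarrow> real"
  assumes f: "smooth_on UNIV f"
    and K: "\<And>s. s \<in> {0..<1} \<Longrightarrow> (LINT x:cell|lborel. (dd y f (x + s *\<^sub>R y) - c * dd y f x)\<^sup>2) \<le> K"
  shows "(LINT x:cell|lborel. (f (x + y) - f x - c * dd y f x)\<^sup>2) \<le> K"
proof -
  have b: "bounded {0..<1::real}" by (rule bounded_subset[OF compact_imp_bounded[OF compact_Icc[of 0 1]]]) auto
  have cf: "continuous_on UNIV f" by (rule smooth_on_continuous[OF f])
  have cd: "continuous_on UNIV (dd y f)" by (rule smooth_on_continuous[OF smooth_on_dd[OF f]])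
  let ?g = "\<lambda>x s. dd y f (x + s *\<^sub>R y) - c * dd y f x"
  have cg: "continuous_on UNIV (\<lambda>s. ?g x s)" for x
    by (intro continuous_intros continuous_on_compose2[OF cd]) auto
  have cG: "continuous_on UNIV (\<lambda>p. (?g (fst p) (snd p))\<^sup>2)"
    by (intro continuous_intros continuous_on_compose2[OF cd]) auto
  have eq: "f (x + y) - f x - c * dd y f x = (LINT s:{0..<1}|lborel. ?g x s)" for x
  proof -
    have i1: "set_integrable lborel {0..<1} (\<lambda>s. dd y f (x + s *\<^sub>R y))"
      by (rule set_integrable_bounded_continuous[OF b])
        (auto intro!: continuous_intros continuous_on_compose2[OF cd])
    have i2: "set_integrable lborel {0..<1::real} (\<lambda>s. c * dd y f x)"
      by (rule set_integrable_bounded_continuous[OF b]) auto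
    show ?thesis unfolding difference_eq_integral_dd[OF f] set_integral_diff(2)[OF i1 i2]
      by (simp add: set_lebesgue_integral_def)
  qed
  have "(LINT x:cell|lborel. (f (x + y) - f x - c * dd y f x)\<^sup>2)
     \<le> (LINT x:cell|lborel. LINT s:{0..<1}|lborel. (?g x s)\<^sup>2)"
  proof (rule set_integral_mono)
    show "set_integrable lborel cell (\<lambda>x. (f (x + y) - f x - c * dd y f x)\<^sup>2)"
      by (intro set_integrable_bounded_continuous bounded_cell cell_borel continuous_intros cf cd continuous_on_compose2[OF cf]) auto
    show "set_integrable lborel cell (\<lambda>x. LINT s:{0..<1}|lborel. (?g x s)\<^sup>2)"
      using set_integrable_iterated[OF cG bounded_cell cell_borel b] by simp
    show "(f (x + y) - f x - c * dd y f x)\<^sup>2 \<le> (LINT s:{0..<1}|lborel. (?g x s)\<^sup>2)" for x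
      unfolding eq by (rule unit_interval_square_le[OF cg])
  qed
  also have "\<dots> = (LINT s:{0..<1}|lborel. LINT x:cell|lborel. (?g x s)\<^sup>2)"
    using set_integral_iterated_swap[OF cG bounded_cell cell_borel b] by simp
  also have "\<dots> \<le> (LINT s:{0..<1::real}|lborel. K)"
  proof (rule set_integral_mono)
    show "set_integrable lborel {0..<1} (\<lambda>s. LINT x:cell|lborel. (?g x s)\<^sup>2)"
      using set_integrable_iterated_snd[OF cG bounded_cell cell_borel b] by simp
    show "set_integrable lborel {0..<1::real} (\<lambda>s. K)"
      by (rule set_integrable_bounded_continuous[OF b]) auto
  qed (rule K)
  also have "\<dots> = K" by (simp add: set_lebesgue_integral_def)
  finally show ?thesis .
qed

lemma translation_difference_le:
  fixes f :: "real^2 \<Rightarrow> real"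
  assumes f: "smooth_on UNIV f" "periodic f"
  shows "(LINT x:cell|lborel. (f (x + y) - f x)\<^sup>2) \<le> (LINT x:cell|lborel. (dd y f x)\<^sup>2)"
proof -
  have cd: "continuous_on UNIV (dd y f)" by (rule smooth_on_continuous[OF smooth_on_dd[OF f(1)]])
  have "(LINT x:cell|lborel. (f (x + y) - f x - 0 * dd y f x)\<^sup>2) \<le> (LINT x:cell|lborel. (dd y f x)\<^sup>2)"
  proof (rule taylor_square_integral_le[OF f(1)])
    fix s :: real
    have "(LINT x:cell|lborel. (dd y f (x + s *\<^sub>R y))\<^sup>2) = (LINT x:cell|lborel. (dd y f x)\<^sup>2)"
    proof (rule cell_integral_translate)
      show "(\<lambda>x. (dd y f x)\<^sup>2) \<in> borel_measurable borel"
        by (intro borel_measurable_continuous_onI continuous_intros cd)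
      show "periodic (\<lambda>x. (dd y f x)\<^sup>2)" using periodic_dd[OF f(2)] unfolding periodic_def by simp
    qed
    then show "(LINT x:cell|lborel. (dd y f (x + s *\<^sub>R y) - 0 * dd y f x)\<^sup>2) \<le> (LINT x:cell|lborel. (dd y f x)\<^sup>2)"
      by simp
  qed
  then show ?thesis by simp
qed

lemma dd_scaleR:
  fixes f :: "'a::real_normed_vector \<Rightarrow> real"
  assumes "f differentiable (at x)" shows "dd (s *\<^sub>R y) f x = s * dd y f x"
  using linear_cmul[OF has_derivative_linear[OF dd_has_derivative[OF assms]], of s y] by simp

lemma dd_vec_sum:
  fixes f :: "real^2 \<Rightarrow> real"
  assumes "f differentiable (at x)"
  shows "dd y f x = y $ 1 * dd (axis 1 1) f x + y $ 2 * dd (axis 2 1) f x"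
proof -
  have l: "linear (\<lambda>w. dd w f x)" by (rule has_derivative_linear[OF dd_has_derivative[OF assms]])
  have y: "y = y $ 1 *\<^sub>R axis 1 1 + y $ 2 *\<^sub>R axis 2 1" by (simp add: vec_eq_iff forall_2 axis_def)
  have "dd y f x = dd (y $ 1 *\<^sub>R axis 1 1 + y $ 2 *\<^sub>R axis 2 1) f x" using y by simp
  also have "\<dots> = y $ 1 * dd (axis 1 1) f x + y $ 2 * dd (axis 2 1) f x"
    using linear_add[OF l] linear_cmul[OF l] by simp
  finally show ?thesis .
qed

text \<open>The derivative is the increment minus the Taylor remainder. The remainder is an average
  of increments of \<open>dd y f\<close> by \<open>s *\<^sub>R y\<close>, which
  \<open>translation_difference_le\<close> bounds by the second derivative in the same
  direction.\<close>

lemma first_derivative_le: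
  fixes f :: "real^2 \<Rightarrow> real"
  assumes f: "smooth_on UNIV f" "periodic f"
  shows "(LINT x:cell|lborel. (dd y f x)\<^sup>2)
    \<le> 2 * (LINT x:cell|lborel. (f (x + y) - f x)\<^sup>2) + 2 * (LINT x:cell|lborel. (dd y (dd y f) x)\<^sup>2)"
proof -
  have cf: "continuous_on UNIV f" by (rule smooth_on_continuous[OF f(1)])
  have cd: "continuous_on UNIV (dd y f)" by (rule smooth_on_continuous[OF smooth_on_dd[OF f(1)]])
  have sm: "smooth_on UNIV (dd y f)" by (rule smooth_on_dd[OF f(1)])
  let ?K = "LINT x:cell|lborel. (dd y (dd y f) x)\<^sup>2"
  have "(LINT x:cell|lborel. (f (x + y) - f x - 1 * dd y f x)\<^sup>2) \<le> ?K"
  proof (rule taylor_square_integral_le[OF f(1)])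
    fix s :: real assume s: "s \<in> {0..<1}"
    have "(LINT x:cell|lborel. (dd y f (x + s *\<^sub>R y) - dd y f x)\<^sup>2) \<le> (LINT x:cell|lborel. (dd (s *\<^sub>R y) (dd y f) x)\<^sup>2)"
      by (rule translation_difference_le[OF sm periodic_dd[OF f(2)]])
    also have "\<dots> = s\<^sup>2 * ?K"
      by (simp add: dd_scaleR[OF smooth_on_differentiable[OF sm UNIV_I]] power_mult_distrib)
    also have "\<dots> \<le> 1 * ?K"
      using s by (intro mult_right_mono set_integral_nonneg_real) (auto intro: power_le_one)
    finally show "(LINT x:cell|lborel. (dd y f (x + s *\<^sub>R y) - 1 * dd y f x)\<^sup>2) \<le> ?K" by simp
  qed
  moreover have "(f (x + y) - f x - 1 * dd y f x)\<^sup>2 = (dd y f x + - (f (x + y) - f x))\<^sup>2" for x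
    by (simp add: power2_eq_square algebra_simps)
  ultimately have K: "(LINT x:cell|lborel. (dd y f x + - (f (x + y) - f x))\<^sup>2) \<le> ?K"
    by (simp only:)
  have i1: "set_integrable lborel cell (\<lambda>x. (f (x + y) - f x)\<^sup>2)"
    by (intro set_integrable_bounded_continuous bounded_cell cell_borel continuous_intros cf continuous_on_compose2[OF cf]) auto
  have i2: "set_integrable lborel cell (\<lambda>x. (dd y f x + - (f (x + y) - f x))\<^sup>2)"
    by (intro set_integrable_bounded_continuous bounded_cell cell_borel continuous_intros cf cd continuous_on_compose2[OF cf]) auto
  have m: "(\<lambda>x. f (x + y) - f x) \<in> borel_measurable lborel"
    "(\<lambda>x. dd y f x + - (f (x + y) - f x)) \<in> borel_measurable lborel"
    using borel_measurable_continuous_onI[OF cf] borel_measurable_continuous_onI[OF cd] by auto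
  have "(LINT x:cell|lborel. ((f (x + y) - f x) + (dd y f x + - (f (x + y) - f x)))\<^sup>2)
     \<le> 2 * (LINT x:cell|lborel. (f (x + y) - f x)\<^sup>2) + 2 * (LINT x:cell|lborel. (dd y f x + - (f (x + y) - f x))\<^sup>2)"
    by (rule set_integral_square_add_le[OF i1 i2 m]) simp
  then show ?thesis using K by simp
qed

section \<open>Quadratic energies of gradients, second derivatives and increments\<close>

definition grad_energy :: "(real^2 \<Rightarrow> real^2) \<Rightarrow> real" where
  "grad_energy v = (LINT x:cell|lborel. ((dd (axis 1 1) (\<lambda>x. v x $ 1) x)\<^sup>2 + (dd (axis 2 1) (\<lambda>x. v x $ 1) x)\<^sup>2)
      + ((dd (axis 1 1) (\<lambda>x. v x $ 2) x)\<^sup>2 + (dd (axis 2 1) (\<lambda>x. v x $ 2) x)\<^sup>2))"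

text \<open>Only pure second derivatives occur: the interpolation proceeds along the coordinate
  directions separately, and the same four terms are what \<open>second_derivatives_le\<close>
  controls.\<close>

definition second_energy :: "(real^2 \<Rightarrow> real^2) \<Rightarrow> real" where
  "second_energy v = (LINT x:cell|lborel.
      (dd (axis 1 1) (dd (axis 1 1) (\<lambda>x. v x $ 1)) x)\<^sup>2 + (dd (axis 2 1) (dd (axis 2 1) (\<lambda>x. v x $ 1)) x)\<^sup>2
      + (dd (axis 1 1) (dd (axis 1 1) (\<lambda>x. v x $ 2)) x)\<^sup>2 + (dd (axis 2 1) (dd (axis 2 1) (\<lambda>x. v x $ 2)) x)\<^sup>2)"

definition translation_energy :: "(real^2 \<Rightarrow> real^2) \<Rightarrow> real^2 \<Rightarrow> real" where
  "translation_energy v y = (L2norm (\<lambda>x. v (x + y) - v x))\<^sup>2"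

lemma translation_energy_eq: "translation_energy v y = (LINT x:cell|lborel. (norm (v (x + y) - v x))\<^sup>2)"
  unfolding translation_energy_def L2norm_sq ..

lemma translation_energy_nonneg: "0 \<le> translation_energy v y"
  unfolding translation_energy_def by simp

lemma grad_energy_nonneg: "0 \<le> grad_energy v" and second_energy_nonneg: "0 \<le> second_energy v"
  unfolding grad_energy_def second_energy_def by (rule set_integral_nonneg_real, simp)+

lemma square_norm_sum_le: "(norm (a + b))\<^sup>2 \<le> 2 * (norm a)\<^sup>2 + 2 * (norm b)\<^sup>2" for a b :: "'a::real_inner"
proof -
  have "(norm (a + b))\<^sup>2 \<le> (norm a + norm b)\<^sup>2" by (intro power_mono norm_triangle_ineq) simp
  also have "\<dots> \<le> 2 * (norm a)\<^sup>2 + 2 * (norm b)\<^sup>2" by (rule square_sum_le)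
  finally show ?thesis .
qed

lemma set_integrable_translation:
  fixes v :: "real^2 \<Rightarrow> real^2"
  assumes c: "continuous_on UNIV v"
  shows "set_integrable lborel cell (\<lambda>x. (norm (v (x + a) - v (x + b)))\<^sup>2)"
  by (intro set_integrable_bounded_continuous bounded_cell cell_borel continuous_intros continuous_on_compose2[OF c]) auto

text \<open>The increment by \<open>h\<close> is passed through the point \<open>x + h + y\<close>.
  The second leg is an increment by \<open>y\<close> that starts at \<open>x + h\<close>, and its
  energy does not depend on the starting shift by periodicity.\<close>

lemma translation_energy_subadditive:
  fixes v :: "real^2 \<Rightarrow> real^2"
  assumes c: "continuous_on UNIV v" and per: "periodic v"
  shows "translation_energy v h \<le> 2 * translation_energy v (h + y) + 2 * translation_energy v y"
proof -
  have i: "set_integrable lborel cell (\<lambda>x. (norm (v (x + a) - v (x + b)))\<^sup>2)" for a b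
    by (rule set_integrable_translation[OF c])
  have "translation_energy v h = (LINT x:cell|lborel. (norm ((v (x + (h + y)) - v (x + 0)) + (v (x + h) - v (x + (h + y)))))\<^sup>2)"
    unfolding translation_energy_eq by simp
  also have "\<dots> \<le> (LINT x:cell|lborel. 2 * (norm (v (x + (h + y)) - v (x + 0)))\<^sup>2 + 2 * (norm (v (x + h) - v (x + (h + y))))\<^sup>2)"
  proof (rule set_integral_mono)
    show "set_integrable lborel cell (\<lambda>x. (norm ((v (x + (h + y)) - v (x + 0)) + (v (x + h) - v (x + (h + y)))))\<^sup>2)"
      using i[of h 0] by simp
  qed (intro set_integral_add(1) set_integrable_mult_right i impI square_norm_sum_le)+
  also have "\<dots> = (LINT x:cell|lborel. 2 * (norm (v (x + (h + y)) - v (x + 0)))\<^sup>2) + (LINT x:cell|lborel. 2 * (norm (v (x + h) - v (x + (h + y))))\<^sup>2)"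
    by (intro set_integral_add(2) set_integrable_mult_right i impI)
  also have "\<dots> = 2 * translation_energy v (h + y) + 2 * (LINT x:cell|lborel. (norm (v (x + h + y) - v (x + h)))\<^sup>2)"
    unfolding translation_energy_eq by (simp add: norm_minus_commute add.assoc)
  also have "(LINT x:cell|lborel. (norm (v (x + h + y) - v (x + h)))\<^sup>2) = translation_energy v y"
    unfolding translation_energy_eq
  proof (rule cell_integral_translate[where f="\<lambda>x. (norm (v (x + y) - v x))\<^sup>2"])
    show "(\<lambda>x. (norm (v (x + y) - v x))\<^sup>2) \<in> borel_measurable borel"
      by (intro borel_measurable_continuous_onI continuous_intros c continuous_on_compose2[OF c]) auto
    have "v (x + k + y) = v (x + y)" if "\<forall>i. k $ i \<in> \<int>" for x k
    proof -
      have "x + k + y = (x + y) + k" by simp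
      then show ?thesis using per that unfolding periodic_def by metis
    qed
    then show "periodic (\<lambda>x. (norm (v (x + y) - v x))\<^sup>2)" using per unfolding periodic_def by simp
  qed
  finally show ?thesis .
qed

lemma set_integrable_translation_energy:
  fixes v :: "real^2 \<Rightarrow> real^2"
  assumes c: "continuous_on UNIV v" and B: "bounded B" "B \<in> sets borel"
  shows "set_integrable lborel B (\<lambda>y. translation_energy v (h + y))"
proof -
  have "continuous_on UNIV (\<lambda>p. (norm (v (snd p + (h + fst p)) - v (snd p)))\<^sup>2)"
    by (intro continuous_intros continuous_on_compose2[OF c]) auto
  from set_integrable_iterated[OF this B bounded_cell cell_borel]
  show ?thesis unfolding translation_energy_eq by simp
qed

lemma measure_ball_real2:
  assumes "r > 0" shows "measure lborel (ball (0::real^2) (r / 2)) = measure lborel (ball (0::real^2) r) / 4"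
  using content_ball_conv_unit_ball[of r "0::real^2"] content_ball_conv_unit_ball[of "r/2" "0::real^2"] assms
  by (simp add: power_divide)

lemma measure_ball_pos: "r > 0 \<Longrightarrow> 0 < measure lborel (ball (0::real^2) r)"
  using content_ball_gt_0_iff[of "0::real^2" r] by (simp add: measure_completion)

text \<open>Converts an average over a disk into a bound for each single short shift. Subadditivity
  is averaged over \<open>y\<close> in the disk of radius \<open>r / 2\<close>, for which both
  \<open>y\<close> and \<open>h + y\<close> lie in the disk of radius \<open>r\<close>. The constant
  16 is 2 + 2 from subadditivity times the ratio 4 of the two areas.\<close>

lemma translation_energy_le_average:
  fixes v :: "real^2 \<Rightarrow> real^2"
  assumes c: "continuous_on UNIV v" and per: "periodic v" and "r > 0" "norm h \<le> r / 2"
  shows "translation_energy v h \<le> 16 * (1 / measure lborel (ball (0::real^2) r) * (LINT y:ball 0 r|lborel. translation_energy v y))"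
proof -
  let ?T = "translation_energy v" and ?m = "measure lborel (ball (0::real^2) r)"
  let ?I = "LINT y:ball 0 r|lborel. ?T y"
  have i: "set_integrable lborel (ball 0 s) (\<lambda>y. ?T (k + y))" for k s
    by (rule set_integrable_translation_energy[OF c]) auto
  have "?m / 4 * ?T h = (LINT y:ball (0::real^2) (r/2)|lborel. ?T h)"
    using assms(3) by (simp add: set_lebesgue_integral_def measure_ball_real2)
  also have "\<dots> \<le> (LINT y:ball 0 (r/2)|lborel. 2 * ?T (h + y) + 2 * ?T (0 + y))"
  proof (rule set_integral_mono)
    show "set_integrable lborel (ball (0::real^2) (r/2)) (\<lambda>y. ?T h)"
      by (rule set_integrable_bounded_continuous) auto
    show "?T h \<le> 2 * ?T (h + y) + 2 * ?T (0 + y)" for y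
      using translation_energy_subadditive[OF c per, of h y] by simp
  qed (intro set_integral_add(1) set_integrable_mult_right i impI)
  also have "\<dots> = (LINT y:ball 0 (r/2)|lborel. 2 * ?T (h + y)) + (LINT y:ball 0 (r/2)|lborel. 2 * ?T (0 + y))"
    by (intro set_integral_add(2) set_integrable_mult_right i impI)
  also have "\<dots> = 2 * (LINT y:ball 0 (r/2)|lborel. ?T (h + y)) + 2 * (LINT y:ball 0 (r/2)|lborel. ?T y)" by simp
  finally have 1: "?m / 4 * ?T h \<le> 2 * (LINT y:ball 0 (r/2)|lborel. ?T (h + y)) + 2 * (LINT y:ball 0 (r/2)|lborel. ?T y)" .
  have 2: "(LINT y:ball 0 (r/2)|lborel. ?T y) \<le> ?I"
    unfolding set_lebesgue_integral_def using i[of "r/2" 0] i[of r 0] assms(3) translation_energy_nonneg[of v]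
    by (intro integral_mono) (auto simp: set_integrable_def indicator_def)
  have 3: "(LINT y:ball 0 (r/2)|lborel. ?T (h + y)) \<le> ?I"
  proof -
    have i': "integrable lborel (\<lambda>y. indicator (ball 0 r) (h + y) *\<^sub>R ?T (h + y))"
    proof -
      have "integrable (distr lborel borel ((+) h)) (\<lambda>y. indicator (ball 0 r) y *\<^sub>R ?T y)"
        using i[of r 0] unfolding set_integrable_def lborel_distr_plus by simp
      then show ?thesis by (rule integrable_distr[rotated]) simp
    qed
    have "(LINT y:ball 0 (r/2)|lborel. ?T (h + y)) \<le> (\<integral>y. indicator (ball 0 r) (h + y) *\<^sub>R ?T (h + y) \<partial>lborel)"
      unfolding set_lebesgue_integral_def
    proof (rule integral_mono)
      show "integrable lborel (\<lambda>y. indicator (ball 0 (r/2)) y *\<^sub>R ?T (h + y))" using i unfolding set_integrable_def .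
      show "indicator (ball 0 (r/2)) y *\<^sub>R ?T (h + y) \<le> indicator (ball 0 r) (h + y) *\<^sub>R ?T (h + y)" for y
      proof (cases "y \<in> ball 0 (r/2)")
        case True
        have "norm (h + y) \<le> norm h + norm y" by (rule norm_triangle_ineq)
        then have "h + y \<in> ball 0 r" using True assms(4) by simp
        then show ?thesis using True by simp
      next
        case False
        then show ?thesis using translation_energy_nonneg[of v "h + y"] by (simp add: indicator_def)
      qed
    qed (rule i')
    also have "\<dots> = (\<integral>y. indicator (ball 0 r) y *\<^sub>R ?T y \<partial>distr lborel borel ((+) h))"
    proof (rule integral_distr[symmetric])
      show "(\<lambda>y. indicator (ball 0 r) y *\<^sub>R ?T y) \<in> borel_measurable borel"
        using borel_measurable_integrable[OF i[of r 0, unfolded set_integrable_def]] by simp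
    qed simp
    finally show ?thesis unfolding lborel_distr_plus set_lebesgue_integral_def .
  qed
  have m: "?m > 0" by (rule measure_ball_pos[OF assms(3)])
  have "?m / 4 * ?T h \<le> 4 * ?I" using 1 2 3 by linarith
  then have "?T h \<le> 16 * ?I / ?m" using m by (simp add: field_simps)
  then show ?thesis by simp
qed

lemma periodic_vec_nth: "periodic v \<Longrightarrow> periodic (\<lambda>x. v x $ i)"
  unfolding periodic_def by simp

lemma translation_energy_components:
  fixes v :: "real^2 \<Rightarrow> real^2"
  assumes c: "continuous_on UNIV v"
  shows "translation_energy v y = (LINT x:cell|lborel. (v (x + y) $ 1 - v x $ 1)\<^sup>2) + (LINT x:cell|lborel. (v (x + y) $ 2 - v x $ 2)\<^sup>2)"
proof -
  have i: "set_integrable lborel cell (\<lambda>x. (v (x + y) $ i - v x $ i)\<^sup>2)" for i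
    by (intro set_integrable_bounded_continuous bounded_cell cell_borel continuous_intros c continuous_on_compose2[OF c]) auto
  show ?thesis unfolding translation_energy_eq norm_sq_vec2 vector_minus_component
    by (rule set_integral_add(2)[OF i i])
qed

lemma set_integrable_cell_continuous:
  fixes f :: "real^2 \<Rightarrow> real"
  shows "continuous_on UNIV f \<Longrightarrow> set_integrable lborel cell f"
  by (rule set_integrable_bounded_continuous[OF bounded_cell cell_borel])

lemma grad_energy_components:
  fixes v :: "real^2 \<Rightarrow> real^2"
  assumes sm: "smooth_on UNIV v"
  shows "grad_energy v = ((LINT x:cell|lborel. (dd (axis 1 1) (\<lambda>x. v x $ 1) x)\<^sup>2) + (LINT x:cell|lborel. (dd (axis 2 1) (\<lambda>x. v x $ 1) x)\<^sup>2))
      + ((LINT x:cell|lborel. (dd (axis 1 1) (\<lambda>x. v x $ 2) x)\<^sup>2) + (LINT x:cell|lborel. (dd (axis 2 1) (\<lambda>x. v x $ 2) x)\<^sup>2))"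
proof -
  have i: "set_integrable lborel cell (\<lambda>x. (dd w (\<lambda>x. v x $ i) x)\<^sup>2)" for i w
    by (intro set_integrable_cell_continuous continuous_intros smooth_on_continuous smooth_on_dd smooth_on_vec_nth sm open_UNIV)
  show ?thesis unfolding grad_energy_def
    by (simp only: set_integral_add(2)[OF set_integral_add(1)[OF i i] set_integral_add(1)[OF i i]] set_integral_add(2)[OF i i])
qed

lemma second_energy_components:
  fixes v :: "real^2 \<Rightarrow> real^2"
  assumes sm: "smooth_on UNIV v"
  shows "second_energy v = (LINT x:cell|lborel. (dd (axis 1 1) (dd (axis 1 1) (\<lambda>x. v x $ 1)) x)\<^sup>2) + (LINT x:cell|lborel. (dd (axis 2 1) (dd (axis 2 1) (\<lambda>x. v x $ 1)) x)\<^sup>2)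
      + (LINT x:cell|lborel. (dd (axis 1 1) (dd (axis 1 1) (\<lambda>x. v x $ 2)) x)\<^sup>2) + (LINT x:cell|lborel. (dd (axis 2 1) (dd (axis 2 1) (\<lambda>x. v x $ 2)) x)\<^sup>2)"
proof -
  have i: "set_integrable lborel cell (\<lambda>x. (dd w (dd w (\<lambda>x. v x $ i)) x)\<^sup>2)" for i w
    by (intro set_integrable_cell_continuous continuous_intros smooth_on_continuous smooth_on_dd smooth_on_vec_nth sm open_UNIV)
  show ?thesis unfolding second_energy_def
    by (simp only: set_integral_add(2)[OF set_integral_add(1)[OF set_integral_add(1)[OF i i] i] i]
        set_integral_add(2)[OF set_integral_add(1)[OF i i] i] set_integral_add(2)[OF i i])
qed

lemma translation_energy_le_grad_energy:
  fixes v :: "real^2 \<Rightarrow> real^2"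
  assumes sm: "smooth_on UNIV v" and per: "periodic v"
  shows "translation_energy v y \<le> (norm y)\<^sup>2 * grad_energy v"
proof -
  have smi: "smooth_on UNIV (\<lambda>x. v x $ i)" for i by (rule smooth_on_vec_nth[OF open_UNIV sm])
  have i: "set_integrable lborel cell (\<lambda>x. (dd w (\<lambda>x. v x $ i) x)\<^sup>2)" for i w
    by (intro set_integrable_cell_continuous continuous_intros smooth_on_continuous smooth_on_dd smi)
  have b: "(LINT x:cell|lborel. (v (x + y) $ i - v x $ i)\<^sup>2)
     \<le> (norm y)\<^sup>2 * ((LINT x:cell|lborel. (dd (axis 1 1) (\<lambda>x. v x $ i) x)\<^sup>2) + (LINT x:cell|lborel. (dd (axis 2 1) (\<lambda>x. v x $ i) x)\<^sup>2))" for i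
  proof -
    have "(LINT x:cell|lborel. (v (x + y) $ i - v x $ i)\<^sup>2) \<le> (LINT x:cell|lborel. (dd y (\<lambda>x. v x $ i) x)\<^sup>2)"
      by (rule translation_difference_le[OF smi periodic_vec_nth[OF per]])
    also have "\<dots> \<le> (LINT x:cell|lborel. (norm y)\<^sup>2 * ((dd (axis 1 1) (\<lambda>x. v x $ i) x)\<^sup>2 + (dd (axis 2 1) (\<lambda>x. v x $ i) x)\<^sup>2))"
    proof (rule set_integral_mono[OF i])
      show "set_integrable lborel cell (\<lambda>x. (norm y)\<^sup>2 * ((dd (axis 1 1) (\<lambda>x. v x $ i) x)\<^sup>2 + (dd (axis 2 1) (\<lambda>x. v x $ i) x)\<^sup>2))"
        by (intro set_integrable_mult_right set_integral_add(1) i impI)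
      have cs: "(a * p + b * q)\<^sup>2 \<le> (a\<^sup>2 + b\<^sup>2) * (p\<^sup>2 + q\<^sup>2)" for a b p q :: real
        using zero_le_power2[of "a * q - b * p"] by (simp add: power2_eq_square algebra_simps)
      show "(dd y (\<lambda>x. v x $ i) x)\<^sup>2 \<le> (norm y)\<^sup>2 * ((dd (axis 1 1) (\<lambda>x. v x $ i) x)\<^sup>2 + (dd (axis 2 1) (\<lambda>x. v x $ i) x)\<^sup>2)" for x
        unfolding dd_vec_sum[OF smooth_on_differentiable[OF smi UNIV_I], of y] norm_sq_vec2 by (rule cs)
    qed
    also have "\<dots> = (norm y)\<^sup>2 * ((LINT x:cell|lborel. (dd (axis 1 1) (\<lambda>x. v x $ i) x)\<^sup>2) + (LINT x:cell|lborel. (dd (axis 2 1) (\<lambda>x. v x $ i) x)\<^sup>2))"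
      by (simp only: set_integral_mult_right set_integral_add(2)[OF i i])
    finally show ?thesis .
  qed
  show ?thesis
    unfolding translation_energy_components[OF smooth_on_continuous[OF sm]] grad_energy_components[OF sm] distrib_left[of "(norm y)\<^sup>2" "_ + _" "_ + _"]
    by (rule add_mono[OF b b])
qed

lemma average_translation_energy_le:
  fixes v :: "real^2 \<Rightarrow> real^2"
  assumes sm: "smooth_on UNIV v" and per: "periodic v" and "r > 0"
  shows "1 / measure lborel (ball (0::real^2) r) * (LINT y:ball 0 r|lborel. translation_energy v y) \<le> r\<^sup>2 * grad_energy v"
proof -
  let ?m = "measure lborel (ball (0::real^2) r)"
  have m: "?m > 0" by (rule measure_ball_pos[OF assms(3)])
  have "(LINT y:ball 0 r|lborel. translation_energy v y) \<le> (LINT y:ball (0::real^2) r|lborel. r\<^sup>2 * grad_energy v)"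
  proof (rule set_integral_mono)
    show "set_integrable lborel (ball 0 r) (translation_energy v)"
      using set_integrable_translation_energy[OF smooth_on_continuous[OF sm], of "ball 0 r" 0] by simp
    show "set_integrable lborel (ball (0::real^2) r) (\<lambda>y. r\<^sup>2 * grad_energy v)"
      by (rule set_integrable_bounded_continuous) auto
    fix y :: "real^2" assume "y \<in> ball 0 r"
    then have "(norm y)\<^sup>2 \<le> r\<^sup>2" by (intro power_mono) auto
    then have "(norm y)\<^sup>2 * grad_energy v \<le> r\<^sup>2 * grad_energy v" by (intro mult_right_mono grad_energy_nonneg)
    then show "translation_energy v y \<le> r\<^sup>2 * grad_energy v"
      using translation_energy_le_grad_energy[OF sm per, of y] by linarith
  qed
  also have "\<dots> = ?m * (r\<^sup>2 * grad_energy v)" by (simp add: set_lebesgue_integral_def)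
  finally show ?thesis using m by (simp add: field_simps)
qed

text \<open>Each coordinate direction uses the shift of length \<open>h\<close> along its axis, so
  first derivatives are controlled by the increments there and by the pure second derivatives. The
  factor 64 is 2 from \<open>first_derivative_le\<close>, times two directions, times 16 from the
  comparison with the average.\<close>

lemma grad_energy_interpolation:
  fixes v :: "real^2 \<Rightarrow> real^2"
  assumes sm: "smooth_on UNIV v" and per: "periodic v" and "r > 0" "h > 0" "h \<le> r / 2"
  shows "grad_energy v \<le> 64 / h\<^sup>2 * (1 / measure lborel (ball (0::real^2) r) * (LINT y:ball 0 r|lborel. translation_energy v y))
     + 2 * h\<^sup>2 * second_energy v"
proof -
  have smi: "smooth_on UNIV (\<lambda>x. v x $ i)" for i by (rule smooth_on_vec_nth[OF open_UNIV sm])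
  define A where "A = 1 / measure lborel (ball (0::real^2) r) * (LINT y:ball 0 r|lborel. translation_energy v y)"
  define e where "e j = h *\<^sub>R (axis j 1 :: real^2)" for j
  define g where "g i j = (LINT x:cell|lborel. (dd (axis j 1) (\<lambda>x. v x $ i) x)\<^sup>2)" for i j
  define s where "s i j = (LINT x:cell|lborel. (dd (axis j 1) (dd (axis j 1) (\<lambda>x. v x $ i)) x)\<^sup>2)" for i j
  define t where "t i j = (LINT x:cell|lborel. (v (x + e j) $ i - v x $ i)\<^sup>2)" for i j
  have "h\<^sup>2 * g i j \<le> 2 * t i j + 2 * (h\<^sup>2 * (h\<^sup>2 * s i j))" for i j
  proof -
    have d1: "dd (e j) (\<lambda>x. v x $ i) = (\<lambda>x. h * dd (axis j 1) (\<lambda>x. v x $ i) x)"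
      unfolding e_def by (rule ext, rule dd_scaleR[OF smooth_on_differentiable[OF smi UNIV_I]])
    have "dd (e j) (dd (e j) (\<lambda>x. v x $ i)) = (\<lambda>x. h * dd (e j) (dd (axis j 1) (\<lambda>x. v x $ i)) x)"
      unfolding d1 by (rule dd_cmult_fun[OF smooth_on_dd[OF smi]])
    also have "\<dots> = (\<lambda>x. h * (h * dd (axis j 1) (dd (axis j 1) (\<lambda>x. v x $ i)) x))"
      unfolding e_def by (simp add: dd_scaleR[OF smooth_on_differentiable[OF smooth_on_dd[OF smi] UNIV_I]])
    finally have d2: "dd (e j) (dd (e j) (\<lambda>x. v x $ i)) = (\<lambda>x. h * (h * dd (axis j 1) (dd (axis j 1) (\<lambda>x. v x $ i)) x))" .
    have "(LINT x:cell|lborel. (dd (e j) (\<lambda>x. v x $ i) x)\<^sup>2) \<le> 2 * t i j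
       + 2 * (LINT x:cell|lborel. (dd (e j) (dd (e j) (\<lambda>x. v x $ i)) x)\<^sup>2)"
      unfolding t_def by (rule first_derivative_le[OF smi periodic_vec_nth[OF per]])
    then show ?thesis unfolding d2 unfolding d1 g_def s_def by (simp add: power_mult_distrib mult.assoc)
  qed
  from this[of 1 1] this[of 1 2] this[of 2 1] this[of 2 2]
  have "h\<^sup>2 * (g 1 1 + g 1 2 + (g 2 1 + g 2 2)) \<le> 2 * ((t 1 1 + t 2 1) + (t 1 2 + t 2 2)) + 2 * (h\<^sup>2 * (h\<^sup>2 * (s 1 1 + s 1 2 + s 2 1 + s 2 2)))"
    unfolding distrib_left by linarith
  also have "s 1 1 + s 1 2 + s 2 1 + s 2 2 = second_energy v"
    unfolding second_energy_components[OF sm] s_def ..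
  also have "g 1 1 + g 1 2 + (g 2 1 + g 2 2) = grad_energy v"
    unfolding grad_energy_components[OF sm] g_def ..
  finally have 1: "h\<^sup>2 * grad_energy v \<le> 2 * ((t 1 1 + t 2 1) + (t 1 2 + t 2 2)) + 2 * (h\<^sup>2 * (h\<^sup>2 * second_energy v))" .
  have "t 1 j + t 2 j \<le> 16 * A" for j
  proof -
    have "norm (e j) \<le> r / 2" using assms(4,5) by (simp add: e_def)
    from translation_energy_le_average[OF smooth_on_continuous[OF sm] per assms(3) this]
    show ?thesis unfolding translation_energy_components[OF smooth_on_continuous[OF sm]] t_def A_def .
  qed
  note t = this[of 1] this[of 2]
  have arith: "X \<le> 64 * A + 2 * Y" if "a \<le> 16 * A" "b \<le> 16 * A" "X \<le> 2 * (a + b) + 2 * Y" for a b X Y :: real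
    using that by simp
  have "h\<^sup>2 * grad_energy v \<le> 64 * A + 2 * (h\<^sup>2 * (h\<^sup>2 * second_energy v))" by (rule arith[OF t 1])
  also have "\<dots> = h\<^sup>2 * (64 / h\<^sup>2 * A + 2 * h\<^sup>2 * second_energy v)"
  proof -
    have "64 * A + 2 * (k * (k * y)) = k * (64 / k * A + 2 * k * y)" if "k \<noteq> 0" for k y :: real
      using that by (simp add: field_simps)
    moreover have "h\<^sup>2 \<noteq> 0" using assms(4) by simp
    ultimately show ?thesis .
  qed
  finally have "h\<^sup>2 * grad_energy v \<le> h\<^sup>2 * (64 / h\<^sup>2 * A + 2 * h\<^sup>2 * second_energy v)" .
  then have "grad_energy v \<le> 64 / h\<^sup>2 * A + 2 * h\<^sup>2 * second_energy v"
    using assms(4) by (rule_tac mult_left_le_imp_le[of "h\<^sup>2"]) auto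
  then show ?thesis unfolding A_def .
qed

section \<open>Energy of Leray--Hopf solutions\<close>

lemma continuous_AE_zero_imp_zero:
  fixes g :: "'a::euclidean_space \<Rightarrow> real"
  assumes "open S" "continuous_on S g" "AE x in lborel. x \<in> S \<longrightarrow> g x = 0" "x \<in> S"
  shows "g x = 0"
proof (rule ccontr)
  assume "g x \<noteq> 0"
  define U where "U = S \<inter> g -` (- {0})"
  have U: "open U" unfolding U_def by (rule continuous_open_preimage[OF assms(2,1)]) auto
  have "x \<in> U" using \<open>g x \<noteq> 0\<close> assms(4) by (simp add: U_def)
  then have "\<not> negligible U" using open_not_negligible[OF U] by blast
  moreover have "AE x in lborel. x \<notin> U" using assms(3) by eventually_elim (auto simp: U_def)
  then have "U \<in> null_sets lborel" using AE_iff_null_sets[of U lborel] U by simp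
  then have "negligible U" using null_sets_completionI negligible_iff_null_sets by blast
  ultimately show False by blast
qed

text \<open>Points on the boundary of \<open>cell\<close> are out of reach of a statement about open
  sets. Translating by \<open>x0 - half_vec\<close> brings the point in question to the centre of
  the cell first.\<close>

lemma periodic_AE_zero_imp_zero:
  fixes h :: "real^2 \<Rightarrow> real"
  assumes c: "continuous_on UNIV h" and per: "periodic h" and AE0: "AE x in lborel. x \<in> cell \<longrightarrow> h x = 0"
  shows "h x0 = 0"
proof -
  define y where "y = x0 - half_vec"
  have [measurable]: "h \<in> borel_measurable borel" by (rule borel_measurable_continuous_onI[OF c])
  have "(LINT x:cell|lborel. (h (x + y))\<^sup>2) = (LINT x:cell|lborel. (h x)\<^sup>2)"
    by (rule cell_integral_translate) (use per in \<open>auto simp: periodic_def\<close>)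
  also have "\<dots> = (\<integral>x. 0 \<partial>(lborel :: (real^2) measure))"
    unfolding set_lebesgue_integral_def
    by (rule integral_cong_AE) (use AE0 in \<open>auto simp: indicator_def\<close>)
  finally have z: "(\<integral>x. indicator cell x *\<^sub>R (h (x + y))\<^sup>2 \<partial>lborel) = 0"
    by (simp add: set_lebesgue_integral_def)
  have cy: "continuous_on UNIV (\<lambda>x. h (x + y))"
    by (intro continuous_intros continuous_on_compose2[OF c]) auto
  have "integrable lborel (\<lambda>x. indicator cell x *\<^sub>R (h (x + y))\<^sup>2)"
    using set_integrable_cell_continuous[of "\<lambda>x. (h (x + y))\<^sup>2"] cy
    unfolding set_integrable_def by (simp add: continuous_on_power)
  then have "AE x in lborel. indicator cell x *\<^sub>R (h (x + y))\<^sup>2 = 0"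
    using z integral_nonneg_eq_0_iff_AE[of lborel "\<lambda>x. indicator cell x *\<^sub>R (h (x + y))\<^sup>2"]
    by (auto simp: indicator_def)
  then have AE1: "AE x in lborel. x \<in> box 0 1 \<longrightarrow> h (x + y) = 0"
  proof eventually_elim
    case (elim x)
    have "x \<in> cell" if "x \<in> box 0 1" using that unfolding cell_def mem_box_cart by (auto intro: less_imp_le)
    then show ?case using elim by (auto simp: indicator_def)
  qed
  have "half_vec \<in> box 0 1" unfolding half_vec_def mem_box_cart by simp
  then have "h (half_vec + y) = 0"
    using continuous_AE_zero_imp_zero[OF open_box continuous_on_subset[OF cy subset_UNIV] AE1] by blast
  then show ?thesis by (simp add: y_def)
qed

definition classical_gradient :: "(real^2 \<Rightarrow> real^2) \<Rightarrow> real^2 \<Rightarrow> real^2^2" where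
  "classical_gradient v x = (\<chi> i j. dd (axis j 1) (\<lambda>x. v x $ i) x)"

lemma has_weak_gradient_classical:
  assumes sm: "smooth_on UNIV v" and per: "periodic v"
  shows "has_weak_gradient v (classical_gradient v)"
proof -
  have smi: "smooth_on UNIV (\<lambda>x. v x $ i)" for i by (rule smooth_on_vec_nth[OF open_UNIV sm])
  have cd: "continuous_on UNIV (dd w (\<lambda>x. v x $ i))" for w i
    by (rule smooth_on_continuous[OF smooth_on_dd[OF smi]])
  show ?thesis unfolding has_weak_gradient_def
  proof (intro conjI allI impI)
    show "v \<in> L2" by (rule L2_continuous[OF smooth_on_continuous[OF sm] per])
    show "classical_gradient v \<in> L2"
    proof (rule L2_continuous)
      show "continuous_on UNIV (classical_gradient v)"
        unfolding classical_gradient_def[abs_def] by (intro continuous_on_vec_lambda cd)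
      show "periodic (classical_gradient v)"
        using periodic_dd[OF periodic_vec_nth[OF per]] unfolding periodic_def classical_gradient_def by simp
    qed
    fix \<psi> :: "real^2 \<Rightarrow> real" and i j assume \<psi>: "smooth_on UNIV \<psi> \<and> periodic \<psi>"
    show "(LINT x:cell|lborel. v x $ i * pd j \<psi> x) = - (LINT x:cell|lborel. classical_gradient v x $ i $ j * \<psi> x)"
      unfolding pd_eq_dd classical_gradient_def
      using cell_integral_by_parts[OF smi, of \<psi> i "axis j 1"] \<psi> periodic_vec_nth[OF per] by simp
  qed
qed

lemma L2norm_classical_gradient: "(L2norm (classical_gradient v))\<^sup>2 = grad_energy v"
  unfolding L2norm_sq norm_sq_mat2 grad_energy_def classical_gradient_def by simp

lemma L2norm_weak_gradient_smooth:
  assumes "smooth_on UNIV v" "periodic v"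
  shows "(L2norm (weak_gradient v))\<^sup>2 = grad_energy v"
  using L2norm_weak_gradient[OF has_weak_gradient_classical[OF assms]] L2norm_classical_gradient by simp

section \<open>Measurability of slice integrals and smoothness of time slices\<close>

lemma borel_measurable_slice_integral:
  fixes F :: "'a::euclidean_space \<times> 'b::euclidean_space \<Rightarrow> real"
  assumes F: "F \<in> borel_measurable borel" and [measurable]: "B \<in> sets borel"
  shows "(\<lambda>q. LINT x:B|lborel. F (q, x)) \<in> borel_measurable borel"
proof -
  have [measurable]: "F \<in> borel_measurable (lborel \<Otimes>\<^sub>M lborel)" using F unfolding lborel_prod by simp
  have "(\<lambda>q. \<integral>x. indicator B x *\<^sub>R F (q, x) \<partial>lborel) \<in> borel_measurable lborel"
    by (rule lborel.borel_measurable_lebesgue_integral) measurable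
  then show ?thesis unfolding set_lebesgue_integral_def by simp
qed

lemma borel_measurable_slice_integral_continuous:
  fixes F :: "'a::euclidean_space \<times> 'b::euclidean_space \<Rightarrow> real"
  assumes "open S" "continuous_on (S \<times> UNIV) F" and [measurable]: "B \<in> sets borel"
  shows "(\<lambda>q. indicator S q *\<^sub>R (LINT x:B|lborel. F (q, x))) \<in> borel_measurable borel"
proof -
  have "(\<lambda>p. indicator (S \<times> UNIV) p *\<^sub>R F p) \<in> borel_measurable borel"
    by (rule borel_measurable_continuous_on_indicator[OF borel_open[OF open_Times[OF assms(1) open_UNIV]] assms(2)])
  from borel_measurable_slice_integral[OF this assms(3)]
  have "(\<lambda>q. LINT x:B|lborel. indicator (S \<times> UNIV) (q, x) *\<^sub>R F (q, x)) \<in> borel_measurable borel" .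
  also have "(\<lambda>q. LINT x:B|lborel. indicator (S \<times> UNIV) (q, x) *\<^sub>R F (q, x)) = (\<lambda>q. indicator S q *\<^sub>R (LINT x:B|lborel. F (q, x)))"
    by (auto simp: indicator_def)
  finally show ?thesis .
qed

lemma dd_slice:
  fixes F :: "real \<times> (real^2) \<Rightarrow> 'b::real_normed_vector"
  assumes "F differentiable (at (t, x))"
  shows "dd w (\<lambda>x. F (t, x)) x = dd (0, w) F (t, x)"
proof (rule dd_eqI)
  have "((\<lambda>x. (t, x)) has_derivative (\<lambda>w. (0, w))) (at x)"
    by (intro has_derivative_Pair has_derivative_const has_derivative_ident)
  from has_derivative_compose[OF this dd_has_derivative[OF assms]]
  show "((\<lambda>x. F (t, x)) has_derivative (\<lambda>w. dd (0, w) F (t, x))) (at x)" .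
qed

lemma smooth_on_slice:
  fixes F :: "real \<times> (real^2) \<Rightarrow> 'b::real_normed_vector"
  assumes "open S" "smooth_on (S \<times> UNIV) F" "t \<in> S"
  shows "smooth_on UNIV (\<lambda>x. F (t, x))"
proof -
  have "bounded_linear (\<lambda>x::real^2. (0::real, x))" by (intro bounded_linear_Pair bounded_linear_zero bounded_linear_ident)
  from smooth_on_compose_affine[OF this open_Times[OF assms(1) open_UNIV] open_UNIV _ assms(2), of "(t, 0)"]
  show ?thesis using assms(3) by simp
qed

text \<open>A single viscosity and its solution. The estimates proved here depend on
  \<open>\<nu>\<close>, the data and the solution only through the displayed quantities, which makes
  them uniform over the family in the final argument.\<close>

locale leray_hopf_flow =
  fixes T \<nu> :: real and u0 :: "real^2 \<Rightarrow> real^2" and u :: "real \<Rightarrow> real^2 \<Rightarrow> real^2"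
  assumes T_pos: "T > 0" and nu_pos: "\<nu> > 0" and LH: "leray_hopf T \<nu> u0 u" and u0_L2: "u0 \<in> L2"
begin

definition w :: "2 \<Rightarrow> real \<times> (real^2) \<Rightarrow> real" where "w i p = u (fst p) (snd p) $ i"

lemma open_slab: "open ({0<..<T} \<times> (UNIV :: (real^2) set))" by (intro open_Times) auto

lemma smooth_u: "smooth_on ({0<..<T} \<times> UNIV) (\<lambda>p. u (fst p) (snd p))"
  using LH unfolding leray_hopf_def by (simp add: case_prod_beta')

lemma smooth_w: "smooth_on ({0<..<T} \<times> UNIV) (w i)"
  unfolding w_def by (rule smooth_on_vec_nth[OF open_slab smooth_u])

lemma slice_w: "(\<lambda>x. u t x $ i) = (\<lambda>x. w i (t, x))" by (simp add: w_def)

lemma smooth_slice: "t \<in> {0<..<T} \<Longrightarrow> smooth_on UNIV (u t)"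
  using smooth_on_slice[OF _ smooth_u] by simp

lemma dd_slice_w: "t \<in> {0<..<T} \<Longrightarrow> dd v (\<lambda>x. u t x $ i) x = dd (0, v) (w i) (t, x)"
  unfolding slice_w by (rule dd_slice) (rule smooth_on_differentiable[OF smooth_w], simp)

lemma continuous_in_time:
  fixes F :: "real \<times> (real^2) \<Rightarrow> real"
  shows "continuous_on ({0<..<T} \<times> UNIV) F \<Longrightarrow> continuous_on {0<..<T} (\<lambda>t. F (t, x))"
  by (rule continuous_on_compose2[of "{0<..<T} \<times> UNIV" F]) (auto intro!: continuous_intros)

lemma weak: "weak_solution T \<nu> u0 u" using LH unfolding leray_hopf_def by blast

lemma AE_L2: "AE t in lborel. t \<in> {0<..<T} \<longrightarrow> u t \<in> L2"
proof -
  obtain C where "AE t in lborel. t \<in> {0..<T} \<longrightarrow> u t \<in> L2 \<and> L2norm (u t) \<le> C"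
    using weak unfolding weak_solution_def Linf_L2_def by blast
  then show ?thesis by eventually_elim auto
qed

text \<open>The definition of a weak solution gives periodicity for almost every time only;
  continuity in time at each fixed point extends it to all interior times.\<close>

lemma periodic_slice: assumes t: "t \<in> {0<..<T}" shows "periodic (u t)"
  unfolding periodic_def
proof safe
  fix x k :: "real^2" assume k: "\<forall>i. k $ i \<in> \<int>"
  have "w i (t, x + k) - w i (t, x) = 0" for i
  proof (rule continuous_AE_zero_imp_zero[of "{0<..<T}" "\<lambda>t. w i (t, x + k) - w i (t, x)"])
    show "continuous_on {0<..<T} (\<lambda>t. w i (t, x + k) - w i (t, x))"
      by (intro continuous_on_diff continuous_in_time smooth_on_continuous[OF smooth_w])
    show "AE t in lborel. t \<in> {0<..<T} \<longrightarrow> w i (t, x + k) - w i (t, x) = 0"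
      using AE_L2
    proof eventually_elim
      case (elim t)
      then show ?case using L2_periodic[of "u t"] k unfolding periodic_def w_def by auto
    qed
  qed (use t in auto)
  then show "u t (x + k) = u t x" by (simp add: vec_eq_iff w_def)
qed

text \<open>At almost every time the slice is weakly divergence-free; being smooth and periodic, its
  divergence is then orthogonal to all test functions and vanishes everywhere. Continuity in time
  covers the remaining times.\<close>

lemma divergence_slice:
  assumes t: "t \<in> {0<..<T}"
  shows "dd (0, axis 1 1) (w 1) (t, x) + dd (0, axis 2 1) (w 2) (t, x) = 0"
proof (rule continuous_AE_zero_imp_zero[of "{0<..<T}" "\<lambda>t. dd (0, axis 1 1) (w 1) (t, x) + dd (0, axis 2 1) (w 2) (t, x)"])
  show "continuous_on {0<..<T} (\<lambda>t. dd (0, axis 1 1) (w 1) (t, x) + dd (0, axis 2 1) (w 2) (t, x))"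
    by (intro continuous_on_add continuous_in_time smooth_on_continuous[OF smooth_on_dd[OF smooth_w]])
  have "AE t in lborel. t \<in> {0..<T} \<longrightarrow> divergence_free (u t)"
    using weak unfolding weak_solution_def by blast
  then show "AE t in lborel. t \<in> {0<..<T} \<longrightarrow> dd (0, axis 1 1) (w 1) (t, x) + dd (0, axis 2 1) (w 2) (t, x) = 0"
  proof (eventually_elim, intro impI)
    fix t assume "t \<in> {0..<T} \<longrightarrow> divergence_free (u t)" and t: "t \<in> {0<..<T}"
    then have df: "divergence_free (u t)" by auto
    have sm: "smooth_on UNIV (\<lambda>x. u t x $ i)" for i by (rule smooth_on_vec_nth[OF open_UNIV smooth_slice[OF t]])
    have per: "periodic (\<lambda>x. u t x $ i)" for i by (rule periodic_vec_nth[OF periodic_slice[OF t]])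
    define d where "d x = dd (axis 1 1) (\<lambda>x. u t x $ 1) x + dd (axis 2 1) (\<lambda>x. u t x $ 2) x" for x
    have smd: "smooth_on UNIV d" unfolding d_def by (intro smooth_on_add smooth_on_dd sm open_UNIV)
    have perd: "periodic d" using periodic_dd[OF per, of "axis 1 1" 1] periodic_dd[OF per, of "axis 2 1" 2]
      unfolding periodic_def d_def by simp
    have "d x = 0"
    proof (rule periodic_AE_zero_imp_zero[OF smooth_on_continuous[OF smd] perd], rule L2_orthogonal_smooth_imp_zero)
      show "d \<in> L2" by (rule L2_continuous[OF smooth_on_continuous[OF smd] perd])
      fix \<psi> :: "real^2 \<Rightarrow> real" assume \<psi>: "smooth_on UNIV \<psi>" "periodic \<psi>"
      have i: "set_integrable lborel cell (\<lambda>x. dd v (\<lambda>x. u t x $ i) x * \<psi> x)"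
        "set_integrable lborel cell (\<lambda>x. u t x $ i * dd v \<psi> x)" for v i
        by (intro set_integrable_cell_continuous smooth_on_continuous smooth_on_mult smooth_on_dd sm \<psi> open_UNIV)+
      have "(LINT x:cell|lborel. d x * \<psi> x) = (LINT x:cell|lborel. dd (axis 1 1) (\<lambda>x. u t x $ 1) x * \<psi> x + dd (axis 2 1) (\<lambda>x. u t x $ 2) x * \<psi> x)"
        by (simp add: d_def distrib_right)
      also have "\<dots> = (LINT x:cell|lborel. dd (axis 1 1) (\<lambda>x. u t x $ 1) x * \<psi> x) + (LINT x:cell|lborel. dd (axis 2 1) (\<lambda>x. u t x $ 2) x * \<psi> x)"
        by (rule set_integral_add(2)[OF i(1) i(1)])
      also have "\<dots> = - ((LINT x:cell|lborel. u t x $ 1 * dd (axis 1 1) \<psi> x) + (LINT x:cell|lborel. u t x $ 2 * dd (axis 2 1) \<psi> x))"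
        using cell_integral_by_parts[OF sm \<psi>(1) per \<psi>(2), of 1 "axis 1 1"] cell_integral_by_parts[OF sm \<psi>(1) per \<psi>(2), of 2 "axis 2 1"] by simp
      also have "\<dots> = - (LINT x:cell|lborel. u t x $ 1 * dd (axis 1 1) \<psi> x + u t x $ 2 * dd (axis 2 1) \<psi> x)"
        using set_integral_add(2)[OF i(2) i(2), of 1 "axis 1 1" 2 "axis 2 1"] by simp
      also have "\<dots> = 0" using df \<psi> unfolding divergence_free_def pd_eq_dd sum_2 by simp
      finally show "(LINT x:cell|lborel. d x * \<psi> x) = 0" .
    qed
    then show "dd (0, axis 1 1) (w 1) (t, x) + dd (0, axis 2 1) (w 2) (t, x) = 0"
      unfolding d_def dd_slice_w[OF t] .
  qed
qed (use t in auto)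

lemma grad_energy_slice:
  "t \<in> {0<..<T} \<Longrightarrow> (L2norm (weak_gradient (u t)))\<^sup>2 = grad_energy (u t)"
  by (rule L2norm_weak_gradient_smooth[OF smooth_slice periodic_slice])

lemma measurable_grad_energy:
  "(\<lambda>t. indicator {0<..<T} t *\<^sub>R grad_energy (u t)) \<in> borel_measurable borel"
proof -
  let ?F = "\<lambda>p. ((dd (0, axis 1 1) (w 1) p)\<^sup>2 + (dd (0, axis 2 1) (w 1) p)\<^sup>2) + ((dd (0, axis 1 1) (w 2) p)\<^sup>2 + (dd (0, axis 2 1) (w 2) p)\<^sup>2)"
  have "continuous_on ({0<..<T} \<times> UNIV) ?F"
    by (intro continuous_intros smooth_on_continuous[OF smooth_on_dd[OF smooth_w]])
  from borel_measurable_slice_integral_continuous[OF _ this cell_borel]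
  have "(\<lambda>t. indicator {0<..<T} t *\<^sub>R (LINT x:cell|lborel. ?F (t, x))) \<in> borel_measurable borel" by simp
  also have "(\<lambda>t. indicator {0<..<T} t *\<^sub>R (LINT x:cell|lborel. ?F (t, x))) = (\<lambda>t. indicator {0<..<T} t *\<^sub>R grad_energy (u t))"
  proof
    show "indicator {0<..<T} t *\<^sub>R (LINT x:cell|lborel. ?F (t, x)) = indicator {0<..<T} t *\<^sub>R grad_energy (u t)" for t
      by (cases "t \<in> {0<..<T}") (simp_all add: grad_energy_def dd_slice_w)
  qed
  finally show ?thesis .
qed

text \<open>Integrability cannot be read off from the energy balance, because the integral of a
  non-integrable function is zero by convention. It comes from \<open>L2_H1\<close>, whose gradient
  field has at almost every time the same norm as the classical gradient.\<close>

lemma integrable_grad_energy: "set_integrable lborel {0<..<T} (\<lambda>t. grad_energy (u t))"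
proof -
  obtain G where AEG: "AE t in lborel. t \<in> {0..<T} \<longrightarrow> has_weak_gradient (u t) (G t)"
    and iG: "set_integrable lborel ({0..<T} \<times> cell) (\<lambda>(t, x). (norm (G t x))\<^sup>2)"
    using weak unfolding weak_solution_def L2_H1_def by blast
  have "integrable (lborel \<Otimes>\<^sub>M lborel) (\<lambda>p. indicator ({0..<T} \<times> cell) p *\<^sub>R (norm (G (fst p) (snd p)))\<^sup>2)"
    using iG unfolding set_integrable_def lborel_prod by (simp add: case_prod_beta')
  from lborel_pair.integrable_fst'[OF this]
  have "integrable lborel (\<lambda>t. \<integral>x. indicator ({0..<T} \<times> cell) (t, x) *\<^sub>R (norm (G t x))\<^sup>2 \<partial>lborel)" by simp
  also have "(\<lambda>t. \<integral>x. indicator ({0..<T} \<times> cell) (t, x) *\<^sub>R (norm (G t x))\<^sup>2 \<partial>lborel) = (\<lambda>t. indicator {0..<T} t *\<^sub>R (L2norm (G t))\<^sup>2)"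
    unfolding L2norm_sq
  proof
    show "(\<integral>x. indicator ({0..<T} \<times> cell) (t, x) *\<^sub>R (norm (G t x))\<^sup>2 \<partial>lborel)
        = indicator {0..<T} t *\<^sub>R (LINT x:cell|lborel. (norm (G t x))\<^sup>2)" for t
      by (cases "t \<in> {0..<T}") (simp_all add: set_lebesgue_integral_def indicator_times)
  qed
  finally have i: "integrable lborel (\<lambda>t. indicator {0..<T} t *\<^sub>R (L2norm (G t))\<^sup>2)" .
  show ?thesis unfolding set_integrable_def
  proof (rule integrable_cong_AE_imp[OF i])
    show "(\<lambda>t. indicator {0<..<T} t *\<^sub>R grad_energy (u t)) \<in> borel_measurable lborel"
      using measurable_grad_energy by simp
    have "AE t in lborel. t \<noteq> (0::real)" by (rule AE_lborel_singleton)
    then show "AE t in lborel. indicator {0..<T} t *\<^sub>R (L2norm (G t))\<^sup>2 = indicator {0<..<T} t *\<^sub>R grad_energy (u t)"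
      using AEG
    proof eventually_elim
      case (elim t)
      show ?case
      proof (cases "t \<in> {0<..<T}")
        case True
        then have "has_weak_gradient (u t) (G t)" using elim by auto
        from weak_gradient_unique[OF this has_weak_gradient_classical[OF smooth_slice[OF True] periodic_slice[OF True]]]
        show ?thesis using True L2norm_classical_gradient[of "u t"] by simp
      next
        case False
        then show ?thesis using elim(1) by (auto simp: indicator_def)
      qed
    qed
  qed
qed

lemma energy_balance:
  assumes t: "t \<in> {0..<T}"
  shows "1/2 * (L2norm (u t))\<^sup>2 + \<nu> * (LINT s:{0<..t}|lborel. grad_energy (u s)) = 1/2 * (L2norm u0)\<^sup>2"
proof -
  \<comment> \<open>The datum need not have a weak gradient, so the value of the integrand at time
    zero is arbitrary; a single time does not matter for the integral.\<close>
  have "(LINT s:{0..t}|lborel. (L2norm (weak_gradient (u s)))\<^sup>2) = (LINT s:{0<..t}|lborel. (L2norm (weak_gradient (u s)))\<^sup>2)"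
    by (rule set_integral_discrete_difference[where X="{0}"]) auto
  also have "\<dots> = (LINT s:{0<..t}|lborel. grad_energy (u s))"
    by (rule set_lebesgue_integral_cong) (use t grad_energy_slice in auto)
  finally have e: "(LINT s:{0..t}|lborel. (L2norm (weak_gradient (u s)))\<^sup>2) = (LINT s:{0<..t}|lborel. grad_energy (u s))" .
  have "1/2 * (L2norm (u t))\<^sup>2 + \<nu> * (LINT s:{0..t}|lborel. (L2norm (weak_gradient (u s)))\<^sup>2) = 1/2 * (L2norm u0)\<^sup>2"
    using LH t unfolding leray_hopf_def by blast
  then show ?thesis unfolding e .
qed

lemma dissipation_eq:
  "(LINT t:{0..<T}|lborel. (L2norm (weak_gradient (u t)))\<^sup>2) = (LINT t:{0<..<T}|lborel. grad_energy (u t))"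
proof -
  have "(LINT t:{0..<T}|lborel. (L2norm (weak_gradient (u t)))\<^sup>2) = (LINT t:{0<..<T}|lborel. (L2norm (weak_gradient (u t)))\<^sup>2)"
    by (rule set_integral_discrete_difference[where X="{0}"]) auto
  also have "\<dots> = (LINT t:{0<..<T}|lborel. grad_energy (u t))"
    by (rule set_lebesgue_integral_cong) (use grad_energy_slice in auto)
  finally show ?thesis .
qed

lemma integrable_grad_energy_subset:
  "A \<subseteq> {0<..<T} \<Longrightarrow> A \<in> sets borel \<Longrightarrow> set_integrable lborel A (\<lambda>t. grad_energy (u t))"
  using set_integrable_subset[OF integrable_grad_energy] by simp

lemma grad_energy_integral_mono:
  assumes "A \<subseteq> B" "B \<subseteq> {0<..<T}" "A \<in> sets borel" "B \<in> sets borel"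
  shows "(LINT t:A|lborel. grad_energy (u t)) \<le> (LINT t:B|lborel. grad_energy (u t))"
  unfolding set_lebesgue_integral_def
proof (rule integral_mono)
  show "integrable lborel (\<lambda>t. indicator A t *\<^sub>R grad_energy (u t))" "integrable lborel (\<lambda>t. indicator B t *\<^sub>R grad_energy (u t))"
    using integrable_grad_energy_subset[of A] integrable_grad_energy_subset[of B] assms unfolding set_integrable_def by auto
  show "indicator A t *\<^sub>R grad_energy (u t) \<le> indicator B t *\<^sub>R grad_energy (u t)" for t
    using assms(1) grad_energy_nonneg[of "u t"] by (auto simp: indicator_def)
qed

lemma L2norm_le_initial:
  assumes t: "t \<in> {0..<T}" shows "(L2norm (u t))\<^sup>2 \<le> (L2norm u0)\<^sup>2"
proof -
  have "0 \<le> (LINT s:{0<..t}|lborel. grad_energy (u s))" by (rule set_integral_nonneg_real) (rule grad_energy_nonneg)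
  then have "0 \<le> \<nu> * (LINT s:{0<..t}|lborel. grad_energy (u s))" using nu_pos by simp
  then show ?thesis using energy_balance[OF t] by linarith
qed

lemma dissipation_le_initial:
  assumes t: "t \<in> {0..<T}"
  shows "\<nu> * (LINT s:{0<..t}|lborel. grad_energy (u s)) \<le> 1/2 * (L2norm u0)\<^sup>2"
proof -
  have "0 \<le> 1/2 * (L2norm (u t))\<^sup>2" by simp
  then show ?thesis using energy_balance[OF t] by linarith
qed

definition average_increment :: "real \<Rightarrow> real \<Rightarrow> real" where
  "average_increment l t = 1 / measure lborel (ball (0::real^2) l) * (LINT y:ball 0 l|lborel. translation_energy (u t) y)"

lemma S2_eq: "S2 T u l = (LINT t:{0<..<T}|lborel. average_increment l t)"
  unfolding S2_def average_increment_def translation_energy_def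
  by (rule set_integral_discrete_difference[where X="{0}"]) auto

lemma average_increment_nonneg: "0 \<le> average_increment l t"
  unfolding average_increment_def
  by (intro mult_nonneg_nonneg set_integral_nonneg_real translation_energy_nonneg) simp

lemma average_increment_le:
  "t \<in> {0<..<T} \<Longrightarrow> l > 0 \<Longrightarrow> average_increment l t \<le> l\<^sup>2 * grad_energy (u t)"
  unfolding average_increment_def by (rule average_translation_energy_le[OF smooth_slice periodic_slice])

text \<open>Continuity is available only over the open time interval. The pair of time and shift
  serves as outer variable when integrating over the cell, and a second application integrates out
  the shift.\<close>

lemma measurable_average_increment:
  "(\<lambda>t. indicator {0<..<T} t *\<^sub>R average_increment l t) \<in> borel_measurable borel"
proof -
  let ?S = "{0<..<T} \<times> (UNIV :: (real^2) set)"
  let ?F = "\<lambda>p. (norm (u (fst (fst p)) (snd p + snd (fst p)) - u (fst (fst p)) (snd p)))\<^sup>2"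
  have cu: "continuous_on ?S (\<lambda>p. u (fst p) (snd p))" by (rule smooth_on_continuous[OF smooth_u])
  have c1: "continuous_on (?S \<times> UNIV) (\<lambda>p. u (fst (fst p)) (snd p + snd (fst p)))"
  proof -
    have c: "continuous_on (?S \<times> UNIV) (\<lambda>p. (fst (fst p), snd p + snd (fst p)))" by (intro continuous_intros)
    have im: "(\<lambda>p. (fst (fst p), snd p + snd (fst p))) ` (?S \<times> UNIV) \<subseteq> ?S" by auto
    show ?thesis using continuous_on_compose2[OF cu c im] by simp
  qed
  have c2: "continuous_on (?S \<times> UNIV) (\<lambda>p. u (fst (fst p)) (snd p))"
  proof -
    have c: "continuous_on (?S \<times> UNIV) (\<lambda>p. (fst (fst p), snd p))" by (intro continuous_intros)
    have im: "(\<lambda>p. (fst (fst p), snd p)) ` (?S \<times> UNIV) \<subseteq> ?S" by auto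
    show ?thesis using continuous_on_compose2[OF cu c im] by simp
  qed
  have "continuous_on (?S \<times> UNIV) ?F" by (intro continuous_intros c1 c2)
  from borel_measurable_slice_integral_continuous[OF open_slab this cell_borel]
  have "(\<lambda>q. indicator ?S q *\<^sub>R translation_energy (u (fst q)) (snd q)) \<in> borel_measurable borel"
    unfolding translation_energy_eq by simp
  from borel_measurable_slice_integral[OF this, of "ball 0 l"]
  have [measurable]: "(\<lambda>t. LINT y:ball 0 l|lborel. indicator ?S (t, y) *\<^sub>R translation_energy (u t) y) \<in> borel_measurable borel" by simp
  have "(\<lambda>t. indicator {0<..<T} t *\<^sub>R average_increment l t)
     = (\<lambda>t. 1 / measure lborel (ball (0::real^2) l) * (LINT y:ball 0 l|lborel. indicator ?S (t, y) *\<^sub>R translation_energy (u t) y))"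
  proof
    show "indicator {0<..<T} t *\<^sub>R average_increment l t
      = 1 / measure lborel (ball (0::real^2) l) * (LINT y:ball 0 l|lborel. indicator ?S (t, y) *\<^sub>R translation_energy (u t) y)" for t
      by (cases "t \<in> {0<..<T}") (simp_all add: average_increment_def)
  qed
  also have "\<dots> \<in> borel_measurable borel" by measurable
  finally show ?thesis .
qed

lemma integrable_average_increment:
  assumes "l > 0" shows "set_integrable lborel {0<..<T} (average_increment l)"
proof (rule set_integrable_bound)
  show "set_integrable lborel {0<..<T} (\<lambda>t. l\<^sup>2 * grad_energy (u t))"
    by (intro set_integrable_mult_right integrable_grad_energy)
  show "set_borel_measurable lborel {0<..<T} (average_increment l)"
    using measurable_average_increment unfolding set_borel_measurable_def by simp
  show "AE t in lborel. t \<in> {0<..<T} \<longrightarrow> norm (average_increment l t) \<le> norm (l\<^sup>2 * grad_energy (u t))"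
    using average_increment_le[OF _ assms] average_increment_nonneg grad_energy_nonneg by simp
qed

lemma S2_nonneg: "0 \<le> S2 T u l"
  unfolding S2_eq by (rule set_integral_nonneg_real) (rule average_increment_nonneg)

lemma S2_le_dissipation:
  "S2 T u (sqrt \<nu>) \<le> \<nu> * (LINT t:{0..<T}|lborel. (L2norm (weak_gradient (u t)))\<^sup>2)"
proof -
  have s: "sqrt \<nu> > 0" "(sqrt \<nu>)\<^sup>2 = \<nu>" using nu_pos by auto
  have "S2 T u (sqrt \<nu>) \<le> (LINT t:{0<..<T}|lborel. \<nu> * grad_energy (u t))"
    unfolding S2_eq
  proof (rule set_integral_mono[OF integrable_average_increment[OF s(1)]])
    show "set_integrable lborel {0<..<T} (\<lambda>t. \<nu> * grad_energy (u t))"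
      by (intro set_integrable_mult_right integrable_grad_energy)
    show "average_increment (sqrt \<nu>) t \<le> \<nu> * grad_energy (u t)" if "t \<in> {0<..<T}" for t
      using average_increment_le[OF that s(1)] s(2) by simp
  qed
  then show ?thesis unfolding dissipation_eq by simp
qed

end

section \<open>Dissipation at short times\<close>

lemma continuous_periodic_bounded:
  fixes f :: "real^2 \<Rightarrow> 'b::real_normed_vector"
  assumes "continuous_on UNIV f" "periodic f"
  obtains C where "\<And>x. norm (f x) \<le> C"
proof -
  have "compact (f ` cbox 0 1)" using assms(1) continuous_on_subset by (intro compact_continuous_image) auto
  then obtain C where C: "\<And>y. y \<in> f ` cbox 0 1 \<Longrightarrow> norm y \<le> C"
    using compact_imp_bounded bounded_iff by metis
  have "norm (f x) \<le> C" for x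
  proof -
    define k where "k = lattice_vec (- \<lfloor>x $ 1\<rfloor>, - \<lfloor>x $ 2\<rfloor>)"
    have "x + k \<in> cell" unfolding cell_eq k_def lattice_vec_def by (simp, linarith)
    then have "f (x + k) \<in> f ` cbox 0 1" using cell_subset_cbox by blast
    moreover have "f (x + k) = f x" unfolding k_def by (rule periodic_lattice_vec[OF assms(2)])
    ultimately show ?thesis using C by metis
  qed
  then show ?thesis by (rule that)
qed

lemma smooth_on_affine_real:
  assumes "smooth_on UNIV s" shows "smooth_on UNIV (\<lambda>t::real. s (c + k * t))"
  by (rule smooth_on_compose_affine[OF bounded_linear_mult_right open_UNIV open_UNIV _ assms]) simp

text \<open>Only an upper bound for the derivative is recorded. The descending edge has a derivative
  of favourable sign, so it may be arbitrarily steep, and the constant does not deteriorate when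
  \<open>b\<close> and \<open>b'\<close> approach the final time.\<close>

lemma plateau:
  assumes st: "smooth_step s s' C" and ab: "a < a'" "a' \<le> b" "b < b'"
  obtains \<theta> \<theta>' where "smooth_on UNIV \<theta>" "\<And>t. (\<theta> has_real_derivative \<theta>' t) (at t)"
    "\<And>t. 0 \<le> \<theta> t" "\<And>t. \<theta> t \<le> 1" "\<And>t. t \<in> {a'..b} \<Longrightarrow> \<theta> t = 1" "\<And>t. t \<notin> {a..b'} \<Longrightarrow> \<theta> t = 0"
    "\<And>t. \<theta>' t \<le> C / (a' - a)" "\<And>t. t \<notin> {a..a'} \<Longrightarrow> \<theta>' t \<le> 0"
proof -
  define \<alpha> where "\<alpha> = a' - a"
  define \<beta> where "\<beta> = b' - b"
  have pos: "\<alpha> > 0" "\<beta> > 0" and eq: "a' = a + \<alpha>" "b' = b + \<beta>"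
    using assms unfolding \<alpha>_def \<beta>_def by auto
  have C: "C > 0" and sm: "smooth_on UNIV s" and D: "\<And>x. (s has_real_derivative s' x) (at x)"
    and s'0: "\<And>x. 0 \<le> s' x" and s'C: "\<And>x. s' x \<le> C" and s0: "\<And>x. x \<le> 0 \<Longrightarrow> s x = 0" and s1: "\<And>x. x \<ge> 1 \<Longrightarrow> s x = 1"
    and sb: "\<And>x. 0 \<le> s x" "\<And>x. s x \<le> 1" and s'z: "\<And>x. x \<notin> {0..1} \<Longrightarrow> s' x = 0"
    using st unfolding smooth_step_def by auto
  define p where "p t = s (- a / \<alpha> + 1 / \<alpha> * t)" for t
  define q where "q t = s (b' / \<beta> + (- 1 / \<beta>) * t)" for t
  define p' where "p' t = s' (- a / \<alpha> + 1 / \<alpha> * t) / \<alpha>" for t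
  define q' where "q' t = - (s' (b' / \<beta> + (- 1 / \<beta>) * t) / \<beta>)" for t
  have Dp: "(p has_real_derivative p' t) (at t)" for t
  proof -
    have "((\<lambda>t. - a / \<alpha> + 1 / \<alpha> * t) has_real_derivative 1 / \<alpha>) (at t)"
      using pos(1) by (auto intro!: derivative_eq_intros)
    from DERIV_chain2[OF D this] show ?thesis unfolding p_def p'_def by simp
  qed
  have Dq: "(q has_real_derivative q' t) (at t)" for t
  proof -
    have "((\<lambda>t. b' / \<beta> + (- 1 / \<beta>) * t) has_real_derivative - 1 / \<beta>) (at t)"
      using pos(2) by (auto intro!: derivative_eq_intros)
    from DERIV_chain2[OF D this] show ?thesis unfolding q_def q'_def by simp
  qed
  have pa: "- a / \<alpha> + 1 / \<alpha> * t = (t - a) / \<alpha>" for t by (simp add: diff_divide_distrib)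
  have qa: "b' / \<beta> + (- 1 / \<beta>) * t = (b' - t) / \<beta>" for t by (simp add: diff_divide_distrib)
  have p01: "0 \<le> p t" "p t \<le> 1" and q01: "0 \<le> q t" "q t \<le> 1" for t using sb unfolding p_def q_def by auto
  have p0: "p t = 0" if "t \<le> a" for t unfolding p_def pa by (rule s0) (use that pos eq in \<open>simp add: divide_nonpos_pos\<close>)
  have p1: "p t = 1" if "t \<ge> a'" for t unfolding p_def pa by (rule s1) (use that pos eq in \<open>simp add: le_divide_eq\<close>)
  have q0: "q t = 0" if "t \<ge> b'" for t unfolding q_def qa by (rule s0) (use that pos eq in \<open>simp add: divide_nonpos_pos\<close>)
  have q1: "q t = 1" if "t \<le> b" for t unfolding q_def qa by (rule s1) (use that pos eq in \<open>simp add: le_divide_eq\<close>)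
  have p'0: "0 \<le> p' t" and p'C: "p' t \<le> C / \<alpha>" for t unfolding p'_def using s'0 s'C pos(1) by (auto intro!: divide_right_mono divide_nonneg_pos)
  have q'0: "q' t \<le> 0" for t unfolding q'_def using s'0 pos(2) by simp
  have p'z: "p' t = 0" if "t \<notin> {a..a'}" for t
  proof -
    have "(t - a) / \<alpha> \<notin> {0..1}" using that pos(1) eq by (auto simp: zero_le_divide_iff divide_le_eq)
    then show ?thesis unfolding p'_def pa by (simp add: s'z)
  qed
  show ?thesis
  proof (rule that[of "\<lambda>t. p t * q t" "\<lambda>t. p' t * q t + q' t * p t"])
    show "smooth_on UNIV (\<lambda>t. p t * q t)" unfolding p_def q_def by (intro smooth_on_mult smooth_on_affine_real sm open_UNIV)
    show "((\<lambda>t. p t * q t) has_real_derivative p' t * q t + q' t * p t) (at t)" for t by (rule DERIV_mult[OF Dp Dq])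
    show "0 \<le> p t * q t" for t using p01 q01 by simp
    show "p t * q t \<le> 1" for t using mult_mono[OF p01(2) q01(2), of t t] p01 q01 by simp
    show "p t * q t = 1" if "t \<in> {a'..b}" for t using that p1[of t] q1[of t] by simp
    show "p t * q t = 0" if "t \<notin> {a..b'}" for t using that p0[of t] q0[of t] by force
    have neg: "q' t * p t \<le> 0" for t using q'0[of t] p01(1)[of t] by (rule mult_nonpos_nonneg)
    have "p' t * q t \<le> C / \<alpha> * 1" for t by (rule mult_mono[OF p'C q01(2)]) (use C pos(1) q01 in auto)
    then show "p' t * q t + q' t * p t \<le> C / (a' - a)" for t unfolding \<alpha>_def[symmetric] using neg[of t] by (smt (verit) mult.right_neutral)
    show "p' t * q t + q' t * p t \<le> 0" if "t \<notin> {a..a'}" for t using p'z[OF that] neg[of t] by simp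
  qed
qed

lemma dd_scaleR_fun:
  fixes f :: "'a::real_normed_vector \<Rightarrow> 'b::real_normed_vector"
  assumes "f differentiable (at x)"
  shows "dd v (\<lambda>x. c *\<^sub>R f x) x = c *\<^sub>R dd v f x"
  by (rule dd_eqI) (rule has_derivative_scaleR_right[OF dd_has_derivative[OF assms]])

lemma smooth_on_space:
  fixes v :: "real^2 \<Rightarrow> 'b::real_normed_vector"
  assumes "smooth_on UNIV v" shows "smooth_on UNIV (\<lambda>p::real \<times> (real^2). v (snd p))"
  using smooth_on_compose_affine[OF bounded_linear_snd, of UNIV UNIV 0 v] assms by simp

context leray_hopf_flow
begin

lemma weak_formulation:
  assumes "test_field T \<phi>"
  shows "(LINT t:{0..<T}|lborel. (LINT x:cell|lborel.
      u t x \<bullet> vector_derivative (\<lambda>s. \<phi> s x) (at t)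
      + (\<Sum>j\<in>UNIV. u t x $ j * (u t x \<bullet> pd j (\<phi> t) x))
      + \<nu> * (u t x \<bullet> laplacian (\<phi> t) x)))
    + (LINT x:cell|lborel. u0 x \<bullet> \<phi> 0 x) = 0"
  using weak assms unfolding weak_solution_def by blast

lemma set_integrable_slice_norm: "t \<in> {0<..<T} \<Longrightarrow> set_integrable lborel cell (\<lambda>x. (norm (u t x))\<^sup>2)"
  by (intro set_integrable_cell_continuous continuous_intros smooth_on_continuous smooth_slice)

text \<open>Polarization rewrites the initial term of the weak formulation through the distance
  between the datum and \<open>v\<close>, which is the quantity made small by the net.\<close>

lemma inner_cell_polar:
  fixes v :: "real^2 \<Rightarrow> real^2"
  assumes "v \<in> L2"
  shows "(LINT x:cell|lborel. u0 x \<bullet> v x) = 1/2 * (L2norm u0)\<^sup>2 + 1/2 * (L2norm v)\<^sup>2 - 1/2 * (LINT x:cell|lborel. (norm (u0 x - v x))\<^sup>2)"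
proof -
  note [measurable] = L2_measurable[OF assms] L2_measurable[OF u0_L2]
  have i1: "set_integrable lborel cell (\<lambda>x. (norm (u0 x))\<^sup>2)" and i2: "set_integrable lborel cell (\<lambda>x. (norm (v x))\<^sup>2)"
    by (intro L2_square_integrable u0_L2 assms)+
  have i3: "set_integrable lborel cell (\<lambda>x. (norm (u0 x - v x))\<^sup>2)"
  proof (rule set_integrable_bound)
    show "set_integrable lborel cell (\<lambda>x. 2 * (norm (u0 x))\<^sup>2 + 2 * (norm (v x))\<^sup>2)"
      by (intro set_integral_add(1) set_integrable_mult_right i1 i2)
    show "set_borel_measurable lborel cell (\<lambda>x. (norm (u0 x - v x))\<^sup>2)" unfolding set_borel_measurable_def by measurable
    show "AE x in lborel. x \<in> cell \<longrightarrow> norm ((norm (u0 x - v x))\<^sup>2) \<le> norm (2 * (norm (u0 x))\<^sup>2 + 2 * (norm (v x))\<^sup>2)"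
      using square_norm_sum_le[of "u0 _" "- v _"] by simp
  qed
  have "(LINT x:cell|lborel. u0 x \<bullet> v x) = (LINT x:cell|lborel. (1/2 * (norm (u0 x))\<^sup>2 + 1/2 * (norm (v x))\<^sup>2) - 1/2 * (norm (u0 x - v x))\<^sup>2)"
  proof -
    have "u0 x \<bullet> v x = (1/2 * (norm (u0 x))\<^sup>2 + 1/2 * (norm (v x))\<^sup>2) - 1/2 * (norm (u0 x - v x))\<^sup>2" for x
      by (simp add: power2_norm_eq_inner inner_diff_left inner_diff_right inner_commute field_simps)
    then show ?thesis by (simp only:)
  qed
  also have "\<dots> = (LINT x:cell|lborel. 1/2 * (norm (u0 x))\<^sup>2 + 1/2 * (norm (v x))\<^sup>2) - (LINT x:cell|lborel. 1/2 * (norm (u0 x - v x))\<^sup>2)"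
    by (intro set_integral_diff(2) set_integral_add(1) set_integrable_mult_right i1 i2 i3)
  also have "(LINT x:cell|lborel. 1/2 * (norm (u0 x))\<^sup>2 + 1/2 * (norm (v x))\<^sup>2)
     = (LINT x:cell|lborel. 1/2 * (norm (u0 x))\<^sup>2) + (LINT x:cell|lborel. 1/2 * (norm (v x))\<^sup>2)"
    by (intro set_integral_add(2) set_integrable_mult_right i1 i2)
  finally show ?thesis unfolding L2norm_sq by (simp only: set_integral_mult_right)
qed

text \<open>Write D for the dissipation up to \<open>\<delta>\<close>. Testing with
  \<open>X t *\<^sub>R v x\<close> compares the pairing of \<open>u0\<close> and \<open>v\<close>
  with an average over [\<delta>, 2 \<delta>] of the pairing of \<open>u\<close> and
  \<open>v\<close>, up to an error of order \<open>\<delta>\<close>. By Young's inequality and the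
  energy balance the average is at most half the squared norms of \<open>u0\<close> and
  \<open>v\<close>, minus D, as D is already spent at these times. The initial pairing equals the
  same half squares minus half the squared distance; subtracting leaves the bound on D.\<close>

lemma short_time_dissipation:
  assumes st: "smooth_step s s' C0" and nu1: "\<nu> \<le> 1"
    and v: "smooth_on UNIV v" "periodic v" "\<And>x. divergence v x = 0"
    and C: "\<And>j x. norm (pd j v x) \<le> C / 2" "\<And>x. norm (laplacian v x) \<le> C" "0 \<le> C"
    and d: "0 < \<delta>" "2 * \<delta> < T"
  shows "\<nu> * (LINT t:{0<..\<delta>}|lborel. grad_energy (u t))
    \<le> 1/2 * (LINT x:cell|lborel. (norm (u0 x - v x))\<^sup>2) + 2 * \<delta> * (2 * C * (1 + (L2norm u0)\<^sup>2))"
proof -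
  have smS: "smooth_on UNIV s" and DS: "\<And>x. (s has_real_derivative s' x) (at x)"
    and s'0: "\<And>x. 0 \<le> s' x" and s'C: "\<And>x. s' x \<le> C0" and s0: "\<And>x. x \<le> 0 \<Longrightarrow> s x = 0" and s1: "\<And>x. x \<ge> 1 \<Longrightarrow> s x = 1"
    and sb: "\<And>x. 0 \<le> s x" "\<And>x. s x \<le> 1" and s'z: "\<And>x. x \<notin> {0..1} \<Longrightarrow> s' x = 0" and cs': "continuous_on UNIV s'"
    using st unfolding smooth_step_def by auto
  \<comment> \<open>Equal to 1 up to time \<open>\<delta>\<close> and to 0 from
    \<open>2 * \<delta>\<close> on, so that its derivative acts as a negative weight of total mass
    one on the interval in between.\<close>
  define X where "X t = s (2 + (- 1 / \<delta>) * t)" for t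
  define X' where "X' t = - (s' (2 + (- 1 / \<delta>) * t) / \<delta>)" for t
  have arg: "2 + (- 1 / \<delta>) * t = (2 * \<delta> - t) / \<delta>" for t using d by (simp add: field_simps)
  have smX: "smooth_on UNIV X" unfolding X_def by (rule smooth_on_affine_real[OF smS])
  have DX: "(X has_real_derivative X' t) (at t)" for t
  proof -
    have "((\<lambda>t. 2 + (- 1 / \<delta>) * t) has_real_derivative - 1 / \<delta>) (at t)"
      using d(1) by (auto intro!: derivative_eq_intros)
    from DERIV_chain2[OF DS this] show ?thesis unfolding X_def X'_def by simp
  qed
  have X01: "0 \<le> X t" "X t \<le> 1" for t using sb unfolding X_def by auto
  have X_one: "X 0 = 1" unfolding X_def by (rule s1) simp
  have X_zero: "X t = 0" if "t \<ge> 2 * \<delta>" for t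
    unfolding X_def arg by (rule s0) (use that d in \<open>simp add: divide_nonpos_pos\<close>)
  have X'0: "X' t \<le> 0" for t unfolding X'_def using s'0 d by simp
  have X'z: "X' t = 0" if "t \<notin> {\<delta>..2 * \<delta>}" for t
  proof -
    have "(2 * \<delta> - t) / \<delta> \<notin> {0..1}" using that d by (auto simp: zero_le_divide_iff divide_le_eq)
    then show ?thesis unfolding X'_def arg by (simp add: s'z)
  qed
  have cX': "continuous_on UNIV X'" unfolding X'_def using d
    by (intro continuous_intros continuous_on_compose2[OF cs']) auto
  define \<phi> where "\<phi> t x = X t *\<^sub>R v x" for t x
  have dv: "v differentiable (at x)" for x by (rule smooth_on_differentiable[OF v(1) UNIV_I])
  have p1: "pd j (\<phi> t) = (\<lambda>x. X t *\<^sub>R pd j v x)" for j t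
    unfolding \<phi>_def pd_eq_dd[abs_def] by (rule ext, rule dd_scaleR_fun[OF dv])
  have dpv: "pd j v differentiable (at x)" for j x
    unfolding pd_eq_dd[abs_def] by (rule smooth_on_differentiable[OF smooth_on_dd[OF v(1)] UNIV_I])
  have p2: "laplacian (\<phi> t) x = X t *\<^sub>R laplacian v x" for t x
    unfolding laplacian_def p1 unfolding pd_eq_dd[of _ "\<lambda>x. X t *\<^sub>R _ x"] pd_eq_dd[of _ "pd _ v"]
    by (simp add: dd_scaleR_fun[OF dpv] scaleR_sum_right)
  have p3: "vector_derivative (\<lambda>s. \<phi> s x) (at t) = X' t *\<^sub>R v x" for t x
  proof (rule vector_derivative_at)
    show "((\<lambda>s. \<phi> s x) has_vector_derivative X' t *\<^sub>R v x) (at t)"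
      unfolding \<phi>_def using has_vector_derivative_scaleR[OF DX has_vector_derivative_const, of "v x"] by simp
  qed
  have tf: "test_field T \<phi>" unfolding test_field_def
  proof (intro conjI allI)
    show "smooth_on UNIV (\<lambda>(t, x). \<phi> t x)"
      using smooth_on_scaleR[OF open_UNIV smooth_on_time[OF smX] smooth_on_space[OF v(1)]]
      unfolding \<phi>_def by (simp add: case_prod_beta')
    show "periodic (\<phi> t)" for t using v(2) unfolding periodic_def \<phi>_def by simp
    show "divergence (\<phi> t) x = 0" for t x
      using v(3)[of x] unfolding divergence_def p1 by (simp add: sum_distrib_left[symmetric])
    show "\<exists>T'<T. \<forall>t\<ge>T'. \<forall>x. \<phi> t x = 0" using X_zero d(2) unfolding \<phi>_def by auto
  qed
  define F where "F t x = u t x \<bullet> (X' t *\<^sub>R v x) + (\<Sum>j\<in>UNIV. u t x $ j * (u t x \<bullet> (X t *\<^sub>R pd j v x))) + \<nu> * (u t x \<bullet> (X t *\<^sub>R laplacian v x))" for t x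
  define I where "I t = (LINT x:cell|lborel. F t x)" for t
  have weakF: "(LINT t:{0<..<T}|lborel. I t) = - (LINT x:cell|lborel. u0 x \<bullet> v x)"
  proof -
    have "(LINT t:{0..<T}|lborel. I t) + (LINT x:cell|lborel. u0 x \<bullet> \<phi> 0 x) = 0"
      using weak_formulation[OF tf] unfolding I_def F_def p1 p2 p3 .
    moreover have "(LINT t:{0..<T}|lborel. I t) = (LINT t:{0<..<T}|lborel. I t)"
      by (rule set_integral_discrete_difference[where X="{0}"]) auto
    ultimately show ?thesis unfolding \<phi>_def X_one by simp
  qed
  define V2 where "V2 = (L2norm v)\<^sup>2"
  define E0 where "E0 = (L2norm u0)\<^sup>2"
  define D where "D = \<nu> * (LINT t:{0<..\<delta>}|lborel. grad_energy (u t))"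
  define M where "M = 2 * C * (1 + E0)"
  have M0: "0 \<le> M" unfolding M_def E0_def using C(3) by simp
  \<comment> \<open>The bound \<open>C / 2\<close> on each of the two derivatives makes the
    convective terms together at most \<open>C\<close> times the square of the speed; the viscous
    term is at most \<open>C\<close> times the speed, hence at most \<open>C\<close> times one plus
    its square.\<close>
  have rest: "\<bar>(\<Sum>j\<in>UNIV. u t x $ j * (u t x \<bullet> (X t *\<^sub>R pd j v x))) + \<nu> * (u t x \<bullet> (X t *\<^sub>R laplacian v x))\<bar>
      \<le> X t * (2 * C * (1 + (norm (u t x))\<^sup>2))" for t x
  proof -
    let ?n = "norm (u t x)"
    have a: "\<bar>u t x $ j * (u t x \<bullet> pd j v x)\<bar> \<le> ?n * (?n * (C / 2))" for j
      unfolding abs_mult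
      by (intro mult_mono component_le_norm_cart order_trans[OF Cauchy_Schwarz_ineq2] mult_left_mono C) (auto simp: C)
    have b: "\<bar>u t x \<bullet> laplacian v x\<bar> \<le> ?n * C"
      by (intro order_trans[OF Cauchy_Schwarz_ineq2] mult_left_mono C) auto
    have n: "?n \<le> 1 + ?n\<^sup>2" using zero_le_power2[of "?n - 1/2"] by (simp add: power2_eq_square algebra_simps)
    have "\<bar>\<nu> * (u t x \<bullet> laplacian v x)\<bar> \<le> 1 * (?n * C)"
      unfolding abs_mult using nu1 nu_pos b by (intro mult_mono) auto
    also have "\<dots> \<le> (1 + ?n\<^sup>2) * C" using n C(3) by (simp add: mult_right_mono)
    finally have b': "\<bar>\<nu> * (u t x \<bullet> laplacian v x)\<bar> \<le> (1 + ?n\<^sup>2) * C" .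
    have e: "(\<Sum>j\<in>UNIV. u t x $ j * (u t x \<bullet> (X t *\<^sub>R pd j v x))) + \<nu> * (u t x \<bullet> (X t *\<^sub>R laplacian v x))
       = X t * ((u t x $ 1 * (u t x \<bullet> pd 1 v x) + u t x $ 2 * (u t x \<bullet> pd 2 v x)) + \<nu> * (u t x \<bullet> laplacian v x))"
      by (simp add: sum_2 algebra_simps)
    have ar: "\<bar>(p + q) + r\<bar> \<le> 2 * C * (1 + k)" if "\<bar>p\<bar> \<le> z" "\<bar>q\<bar> \<le> z" "\<bar>r\<bar> \<le> (1 + k) * C" "z = k * C / 2" for p q r z k :: real
    proof -
      have e1: "(1 + k) * C = C + k * C" and e2: "2 * C * (1 + k) = 2 * C + 2 * (k * C)" by (simp_all add: algebra_simps)
      have "- z \<le> p" "p \<le> z" "- z \<le> q" "q \<le> z" "- (C + k * C) \<le> r" "r \<le> C + k * C"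
        using that(1-3) unfolding e1 abs_le_iff by linarith+
      moreover have "2 * z = k * C" using that(4) by simp
      ultimately show ?thesis unfolding e2 abs_le_iff using C(3) by linarith
    qed
    have "\<bar>(u t x $ 1 * (u t x \<bullet> pd 1 v x) + u t x $ 2 * (u t x \<bullet> pd 2 v x)) + \<nu> * (u t x \<bullet> laplacian v x)\<bar> \<le> 2 * C * (1 + ?n\<^sup>2)"
      by (rule ar[OF a a b']) (simp add: power2_eq_square)
    then show ?thesis unfolding e abs_mult using X01(1)[of t] by (simp add: mult_left_mono)
  qed
  have cF: "continuous_on ({0<..<T} \<times> UNIV) (\<lambda>p. F (fst p) (snd p))"
  proof -
    have cu: "continuous_on ({0<..<T} \<times> UNIV) (\<lambda>p. u (fst p) (snd p))" by (rule smooth_on_continuous[OF smooth_u])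
    have cv: "continuous_on UNIV v" by (rule smooth_on_continuous[OF v(1)])
    have cpv: "continuous_on UNIV (pd j v)" for j
      unfolding pd_eq_dd[abs_def] by (rule smooth_on_continuous[OF smooth_on_dd[OF v(1)]])
    have clv: "continuous_on UNIV (laplacian v)"
      unfolding pd_eq_dd[abs_def] laplacian_def[abs_def]
      by (intro continuous_on_sum smooth_on_continuous[OF smooth_on_dd[OF smooth_on_dd[OF v(1)]]])
    have cX: "continuous_on UNIV X" by (rule smooth_on_continuous[OF smX])
    show ?thesis unfolding F_def
      by (intro continuous_intros cu continuous_on_compose2[OF cv] continuous_on_compose2[OF cpv]
          continuous_on_compose2[OF clv] continuous_on_compose2[OF cX] continuous_on_compose2[OF cX']) auto
  qed
  have iF: "set_integrable lborel cell (F t)" if t: "t \<in> {0<..<T}" for t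
    by (rule set_integrable_cell_continuous, rule continuous_on_compose2[OF cF, of UNIV "\<lambda>x. (t, x)", simplified])
      (use t in \<open>auto intro!: continuous_intros\<close>)
  have iv: "set_integrable lborel cell (\<lambda>x. (norm (v x))\<^sup>2)"
    by (intro set_integrable_cell_continuous continuous_intros smooth_on_continuous v)
  have ic: "set_integrable lborel cell (\<lambda>x. c)" for c :: real by (intro set_integrable_cell_continuous continuous_intros)
  have cell1: "(LINT x:cell|lborel. c) \<le> c" if "0 \<le> c" for c :: real
  proof -
    have "measure lborel cell \<le> 1" using emeasure_cell_le by (simp add: measure_def enn2real_leI)
    then have "measure lborel cell * c \<le> 1 * c" using that by (intro mult_right_mono) auto
    then show ?thesis by (simp add: set_lebesgue_integral_def)
  qed
  have M_int: "(LINT x:cell|lborel. 2 * C * (1 + (norm (u t x))\<^sup>2)) \<le> M"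
    and iM: "set_integrable lborel cell (\<lambda>x. 2 * C * (1 + (norm (u t x))\<^sup>2))" if t: "t \<in> {0<..<T}" for t
  proof -
    have i: "set_integrable lborel cell (\<lambda>x. 1 + (norm (u t x))\<^sup>2)" by (intro set_integral_add(1) ic set_integrable_slice_norm t)
    then show "set_integrable lborel cell (\<lambda>x. 2 * C * (1 + (norm (u t x))\<^sup>2))" by (intro set_integrable_mult_right)
    have "(LINT x:cell|lborel. 1 + (norm (u t x))\<^sup>2) = (LINT x:cell|lborel. 1) + (LINT x:cell|lborel. (norm (u t x))\<^sup>2)"
      by (rule set_integral_add(2)[OF ic set_integrable_slice_norm[OF t]])
    also have "\<dots> \<le> 1 + E0"
      using cell1[of 1] L2norm_le_initial[of t] t unfolding E0_def L2norm_sq[of "u t"] by simp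
    finally have "2 * C * (LINT x:cell|lborel. 1 + (norm (u t x))\<^sup>2) \<le> 2 * C * (1 + E0)"
      using C(3) by (intro mult_left_mono) auto
    then show "(LINT x:cell|lborel. 2 * C * (1 + (norm (u t x))\<^sup>2)) \<le> M" by (simp add: M_def)
  qed
  \<comment> \<open>An upper bound, valid at all times from \<open>\<delta>\<close> on, for the
    majorant that Young's inequality gives for the pairing of \<open>u t\<close> and
    \<open>v\<close>.\<close>
  define K where "K = 1/2 * E0 + 1/2 * V2 - D"
  have young: "\<bar>a \<bullet> b\<bar> \<le> 1/2 * (norm a)\<^sup>2 + 1/2 * (norm b)\<^sup>2" for a b :: "real^2"
    using Cauchy_Schwarz_ineq2[of a b] zero_le_power2[of "norm a - norm b"] by (simp add: power2_eq_square algebra_simps)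
  have iuv: "set_integrable lborel cell (\<lambda>x. 1/2 * (norm (u t x))\<^sup>2 + 1/2 * (norm (v x))\<^sup>2)" if "t \<in> {0<..<T}" for t
    by (intro set_integral_add(1) set_integrable_mult_right set_integrable_slice_norm iv that)
  have Iuv: "(LINT x:cell|lborel. 1/2 * (norm (u t x))\<^sup>2 + 1/2 * (norm (v x))\<^sup>2) = 1/2 * (L2norm (u t))\<^sup>2 + 1/2 * V2" if "t \<in> {0<..<T}" for t
    unfolding V2_def L2norm_sq
    using set_integral_add(2)[OF set_integrable_mult_right[of "1/2", OF set_integrable_slice_norm[OF that]] set_integrable_mult_right[of "1/2", OF iv]] by simp
  \<comment> \<open>Since \<open>X' t\<close> is nonpositive, upper bounds for the pairing become
    lower bounds for \<open>I\<close>; outside [\<delta>, 2 \<delta>] the factor \<open>X' t\<close>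
    vanishes and the bound by \<open>K\<close> is not called upon.\<close>
  have lower: "X' t * K - indicator {0<..<2 * \<delta>} t * M \<le> I t" if t: "t \<in> {0<..<T}" for t
  proof -
    have "X' t * K - indicator {0<..<2 * \<delta>} t * M \<le> X' t * (1/2 * (L2norm (u t))\<^sup>2 + 1/2 * V2) - X t * M"
    proof -
      have 1: "X' t * K \<le> X' t * (1/2 * (L2norm (u t))\<^sup>2 + 1/2 * V2)"
      proof (cases "t \<in> {\<delta>..2 * \<delta>}")
        case True
        have "D \<le> \<nu> * (LINT s:{0<..t}|lborel. grad_energy (u s))"
          unfolding D_def using nu_pos True t by (intro mult_left_mono grad_energy_integral_mono) auto
        then have "1/2 * (L2norm (u t))\<^sup>2 + 1/2 * V2 \<le> K"
          using energy_balance[of t] t unfolding K_def E0_def by simp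
        then show ?thesis using X'0[of t] by (rule mult_left_mono_neg)
      qed (simp add: X'z)
      have 2: "X t * M \<le> indicator {0<..<2 * \<delta>} t * M"
        using X_zero[of t] X01(2)[of t] t M0 by (intro mult_right_mono) (auto simp: indicator_def)
      from 1 2 show ?thesis by linarith
    qed
    also have "\<dots> \<le> (LINT x:cell|lborel. X' t * (1/2 * (norm (u t x))\<^sup>2 + 1/2 * (norm (v x))\<^sup>2)) - (LINT x:cell|lborel. X t * (2 * C * (1 + (norm (u t x))\<^sup>2)))"
      using mult_left_mono[OF M_int[OF t] X01(1)[of t]] Iuv[OF t] by (simp only: set_integral_mult_right)
    also have "\<dots> = (LINT x:cell|lborel. X' t * (1/2 * (norm (u t x))\<^sup>2 + 1/2 * (norm (v x))\<^sup>2) - X t * (2 * C * (1 + (norm (u t x))\<^sup>2)))"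
      by (intro set_integral_diff(2)[symmetric] set_integrable_mult_right iuv iM t)
    also have "\<dots> \<le> I t" unfolding I_def
    proof (rule set_integral_mono[OF _ iF[OF t]])
      show "set_integrable lborel cell (\<lambda>x. X' t * (1/2 * (norm (u t x))\<^sup>2 + 1/2 * (norm (v x))\<^sup>2) - X t * (2 * C * (1 + (norm (u t x))\<^sup>2)))"
        by (intro set_integral_diff(1) set_integrable_mult_right iuv iM t)
      show "X' t * (1/2 * (norm (u t x))\<^sup>2 + 1/2 * (norm (v x))\<^sup>2) - X t * (2 * C * (1 + (norm (u t x))\<^sup>2)) \<le> F t x" for x
      proof -
        have "u t x \<bullet> v x \<le> 1/2 * (norm (u t x))\<^sup>2 + 1/2 * (norm (v x))\<^sup>2" using young[of "u t x" "v x"] by linarith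
        then have "X' t * (1/2 * (norm (u t x))\<^sup>2 + 1/2 * (norm (v x))\<^sup>2) \<le> X' t * (u t x \<bullet> v x)"
          using X'0[of t] by (rule mult_left_mono_neg)
        moreover have "u t x \<bullet> (X' t *\<^sub>R v x) = X' t * (u t x \<bullet> v x)" by simp
        ultimately show ?thesis using rest[of t x] unfolding F_def by linarith
      qed
    qed
    finally show ?thesis .
  qed
  have b1: "bounded {0<..<r}" "bounded {0..r}" for r :: real by (auto intro: bounded_subset[OF compact_imp_bounded[OF compact_Icc[of 0 r]]])
  have iX': "set_integrable lborel {0<..<T} X'" by (rule set_integrable_bounded_continuous[OF b1(1) _ cX']) simp
  \<comment> \<open>Serves the integrability of \<open>I\<close> in time, for which the majorant may
    depend on \<open>t\<close> through the bounded function \<open>X'\<close>.\<close>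
  have upper: "\<bar>I t\<bar> \<le> \<bar>X' t\<bar> * (1/2 * E0 + 1/2 * V2) + M" if t: "t \<in> {0<..<T}" for t
  proof -
    have "\<bar>I t\<bar> \<le> (LINT x:cell|lborel. \<bar>F t x\<bar>)" unfolding I_def set_lebesgue_integral_def
      using integral_abs_bound[of lborel "\<lambda>x. indicator cell x *\<^sub>R F t x"] by (simp add: abs_mult)
    also have "\<dots> \<le> (LINT x:cell|lborel. \<bar>X' t\<bar> * (1/2 * (norm (u t x))\<^sup>2 + 1/2 * (norm (v x))\<^sup>2) + 2 * C * (1 + (norm (u t x))\<^sup>2))"
    proof (rule set_integral_mono)
      show "set_integrable lborel cell (\<lambda>x. \<bar>F t x\<bar>)" by (rule set_integrable_abs[OF iF[OF t]])
      show "set_integrable lborel cell (\<lambda>x. \<bar>X' t\<bar> * (1/2 * (norm (u t x))\<^sup>2 + 1/2 * (norm (v x))\<^sup>2) + 2 * C * (1 + (norm (u t x))\<^sup>2))"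
        by (intro set_integral_add(1) set_integrable_mult_right[of "\<bar>X' t\<bar>"] iuv iM t)
      show "\<bar>F t x\<bar> \<le> \<bar>X' t\<bar> * (1/2 * (norm (u t x))\<^sup>2 + 1/2 * (norm (v x))\<^sup>2) + 2 * C * (1 + (norm (u t x))\<^sup>2)" for x
      proof -
        have "\<bar>u t x \<bullet> (X' t *\<^sub>R v x)\<bar> \<le> \<bar>X' t\<bar> * (1/2 * (norm (u t x))\<^sup>2 + 1/2 * (norm (v x))\<^sup>2)"
          using mult_left_mono[OF young[of "u t x" "v x"], of "\<bar>X' t\<bar>"] by (simp only: inner_scaleR_right abs_mult abs_ge_zero)
        moreover have "X t * (2 * C * (1 + (norm (u t x))\<^sup>2)) \<le> 1 * (2 * C * (1 + (norm (u t x))\<^sup>2))"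
          using X01(2)[of t] C(3) by (intro mult_right_mono) auto
        ultimately show ?thesis using rest[of t x] unfolding F_def by linarith
      qed
    qed
    also have "\<dots> = \<bar>X' t\<bar> * (1/2 * (L2norm (u t))\<^sup>2 + 1/2 * V2) + (LINT x:cell|lborel. 2 * C * (1 + (norm (u t x))\<^sup>2))"
      using set_integral_add(2)[OF set_integrable_mult_right[of "\<bar>X' t\<bar>", OF iuv[OF t]] iM[OF t]] Iuv[OF t]
      by (simp only: set_integral_mult_right[of _ _ "\<bar>X' t\<bar>"])
    also have "\<dots> \<le> \<bar>X' t\<bar> * (1/2 * E0 + 1/2 * V2) + M"
      using M_int[OF t] L2norm_le_initial[of t] t unfolding E0_def by (intro add_mono mult_left_mono) auto
    finally show ?thesis .
  qed
  have iI: "set_integrable lborel {0<..<T} I"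
  proof (rule set_integrable_bound)
    show "set_integrable lborel {0<..<T} (\<lambda>t. \<bar>X' t\<bar> * (1/2 * E0 + 1/2 * V2) + M)"
      by (intro set_integrable_bounded_continuous b1 continuous_intros cX') auto
    show "set_borel_measurable lborel {0<..<T} I"
      using borel_measurable_slice_integral_continuous[OF _ cF cell_borel] unfolding set_borel_measurable_def I_def by simp
    show "AE t in lborel. t \<in> {0<..<T} \<longrightarrow> norm (I t) \<le> norm (\<bar>X' t\<bar> * (1/2 * E0 + 1/2 * V2) + M)"
    proof (intro AE_I2 impI)
      fix t assume t: "t \<in> {0<..<T}"
      show "norm (I t) \<le> norm (\<bar>X' t\<bar> * (1/2 * E0 + 1/2 * V2) + M)"
        using upper[OF t] by simp
    qed
  qed
  have intX': "(LINT t:{0<..<T}|lborel. X' t) = - 1"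
  proof -
    have "(\<integral>t. X' t * indicator {0..T} t \<partial>lborel) = X T - X 0"
    proof (rule integral_FTC_Icc_real)
      show "isCont X' t" for t using cX' continuous_on_eq_continuous_at[OF open_UNIV] by blast
    qed (use T_pos DX in auto)
    moreover have "(LINT t:{0<..<T}|lborel. X' t) = (LINT t:{0..T}|lborel. X' t)"
      by (rule set_integral_discrete_difference[where X="{0, T}"]) auto
    ultimately show ?thesis using X_zero[of T] X_one d(2) by (simp add: set_lebesgue_integral_def mult.commute)
  qed
  have iind: "set_integrable lborel {0<..<T} (\<lambda>t. indicator {0<..<2 * \<delta>} t * M)"
    using set_integrable_bounded_continuous[OF b1(1) _ continuous_on_const, of "2 * \<delta>" M] d
    unfolding set_integrable_def by (simp add: indicator_inter_arith[symmetric] mult.assoc[symmetric] Int_absorb1 subset_eq)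
  have "(LINT t:{0<..<T}|lborel. X' t * K - indicator {0<..<2 * \<delta>} t * M) \<le> (LINT t:{0<..<T}|lborel. I t)"
    by (rule set_integral_mono[OF _ iI lower]) (intro set_integral_diff(1) set_integrable_mult_left iX' iind impI)
  also have "(LINT t:{0<..<T}|lborel. X' t * K - indicator {0<..<2 * \<delta>} t * M)
     = (LINT t:{0<..<T}|lborel. X' t * K) - (LINT t:{0<..<T}|lborel. indicator {0<..<2 * \<delta>} t * M)"
    by (intro set_integral_diff(2) set_integrable_mult_left iX' iind impI)
  also have "(LINT t:{0<..<T}|lborel. indicator {0<..<2 * \<delta>} t * M) = 2 * \<delta> * M"
  proof -
    have "(LINT t:{0<..<T}|lborel. indicator {0<..<2 * \<delta>} t * M) = (\<integral>t. indicator {0<..<2 * \<delta>} t * M \<partial>lborel)"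
      unfolding set_lebesgue_integral_def by (rule Bochner_Integration.integral_cong) (use d in \<open>auto simp: indicator_def\<close>)
    then show ?thesis using d by simp
  qed
  finally have "- K - 2 * \<delta> * M \<le> - (LINT x:cell|lborel. u0 x \<bullet> v x)"
    unfolding weakF by (simp add: intX')
  then show ?thesis
    using inner_cell_polar[OF L2_continuous[OF smooth_on_continuous[OF v(1)] v(2)]]
    unfolding K_def V2_def[symmetric] E0_def[symmetric] D_def[symmetric] M_def by linarith
qed

end

section \<open>Dissipation at late times\<close>

lemma dd_zero_on_open:
  fixes f :: "'a::real_normed_vector \<Rightarrow> 'b::real_normed_vector"
  assumes "open R" "x \<in> R" "\<And>y. y \<in> R \<Longrightarrow> f y = 0"
  shows "dd v f x = 0"
proof -
  have "dd v f x = dd v (\<lambda>_. 0) x" by (rule dd_cong_open[OF assms(1,2)]) (rule assms(3))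
  also have "\<dots> = 0" by (rule dd_eqI[OF has_derivative_const])
  finally show ?thesis .
qed

lemma vector_derivative_time_slice:
  fixes F :: "real \<times> (real^2) \<Rightarrow> 'b::real_normed_vector"
  assumes "F differentiable (at (t, x))"
  shows "vector_derivative (\<lambda>s. F (s, x)) (at t) = dd (1, 0) F (t, x)"
proof (rule vector_derivative_at)
  have D: "(F has_derivative (\<lambda>v. dd v F (t, x))) (at (t, x))" by (rule dd_has_derivative[OF assms])
  have "((\<lambda>s. (s, x)) has_derivative (\<lambda>r. (r, 0))) (at t)"
    by (intro has_derivative_Pair has_derivative_const has_derivative_ident)
  from has_derivative_compose[OF this D]
  have "((\<lambda>s. F (s, x)) has_derivative (\<lambda>r. dd (r, 0) F (t, x))) (at t)" .
  moreover have "(\<lambda>r. dd (r, 0) F (t, x)) = (\<lambda>r. r *\<^sub>R dd (1, 0) F (t, x))"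
  proof
    show "dd (r, 0) F (t, x) = r *\<^sub>R dd (1, 0) F (t, x)" for r
      using linear_cmul[OF has_derivative_linear[OF D], of r "(1, 0)"] by simp
  qed
  ultimately show "((\<lambda>s. F (s, x)) has_vector_derivative dd (1, 0) F (t, x)) (at t)"
    unfolding has_vector_derivative_def by simp
qed

lemma inner_vec2: "(a :: real^2) \<bullet> b = a $ 1 * b $ 1 + a $ 2 * b $ 2"
  by (simp add: inner_vec_def sum_2)

lemma set_integral_mono_set:
  fixes f :: "'a \<Rightarrow> real"
  assumes "set_integrable M B f" "A \<subseteq> B" "A \<in> sets M" "\<And>x. x \<in> B \<Longrightarrow> 0 \<le> f x"
  shows "(LINT x:A|M. f x) \<le> (LINT x:B|M. f x)"
  unfolding set_lebesgue_integral_def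
proof (rule integral_mono)
  show "integrable M (\<lambda>x. indicator A x *\<^sub>R f x)"
    using set_integrable_subset[OF assms(1,3,2)] unfolding set_integrable_def .
  show "integrable M (\<lambda>x. indicator B x *\<^sub>R f x)" using assms(1) unfolding set_integrable_def .
  show "indicator A x *\<^sub>R f x \<le> indicator B x *\<^sub>R f x" for x
    using assms(2,4) by (auto simp: indicator_def)
qed

context leray_hopf_flow
begin

text \<open>The product is smooth on the open slab and identically zero on the open set of times
  outside [a, b]; the two sets cover space-time. Such globally smooth functions are what the
  calculus of \<open>stint\<close> requires.\<close>

lemma smooth_cutoff:
  fixes F :: "real \<times> (real^2) \<Rightarrow> real"
  assumes \<theta>: "smooth_on UNIV \<theta>" "\<And>t. t \<notin> {a..b} \<Longrightarrow> \<theta> t = (0::real)" and ab: "0 < a" "b < T"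
    and F: "smooth_on ({0<..<T} \<times> UNIV) F"
  shows "smooth_on UNIV (\<lambda>p. \<theta> (fst p) * F p)"
proof -
  let ?R = "{p :: real \<times> (real^2). fst p \<notin> {a..b}}"
  have "?R = (- {a..b}) \<times> UNIV" by auto
  then have R: "open ?R" by (simp add: open_Times open_Compl)
  have "smooth_on ({0<..<T} \<times> UNIV) (\<lambda>p. \<theta> (fst p) * F p)"
    by (intro smooth_on_mult open_slab F smooth_on_subset[OF smooth_on_time[OF \<theta>(1)]]) simp
  moreover have "smooth_on ?R (\<lambda>p. \<theta> (fst p) * F p)"
    by (rule smooth_on_cong[OF R _ smooth_on_const[OF R, of 0]]) (simp add: \<theta>(2))
  ultimately have "smooth_on ({0<..<T} \<times> UNIV \<union> ?R) (\<lambda>p. \<theta> (fst p) * F p)"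
    by (rule smooth_on_Un[OF open_slab R])
  moreover have "{0<..<T} \<times> UNIV \<union> ?R = UNIV" using ab by auto
  ultimately show ?thesis by simp
qed

text \<open>The cutoff \<open>\<theta>\<close> rises on [\<delta>/2, \<delta>] with slope at most
  \<open>2 * C0 / \<delta>\<close>, and its descent has the favourable sign in the enstrophy
  identity. So the right side involves only the vorticity on [\<delta>/2, \<delta>], whose square is
  at most twice that of the gradient; a further factor \<open>\<nu>\<close> makes it dissipation,
  which the energy balance bounds. The constants combine as 1/2 times
  \<open>4 * C0 / \<delta>\<close> times 1/2 of the initial squared norm.\<close>

lemma second_energy_bound:
  assumes st: "smooth_step s s' C0" and d: "0 < \<delta>" "\<delta> < b" "b < T"
  shows "set_integrable lborel {\<delta>..b} (\<lambda>t. second_energy (u t))"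
    and "\<nu>\<^sup>2 * (LINT t:{\<delta>..b}|lborel. second_energy (u t)) \<le> C0 / \<delta> * (L2norm u0)\<^sup>2"
proof -
  \<comment> \<open>\<open>T1\<close> and \<open>T2\<close> leave room for two nested descents
    between \<open>b\<close> and \<open>T\<close>.\<close>
  define T1 where "T1 = (b + T) / 2"
  define T2 where "T2 = (T1 + T) / 2"
  have T12: "b < T1" "T1 < T2" "T2 < T" using d unfolding T1_def T2_def by auto
  have C0: "C0 > 0" using st unfolding smooth_step_def by blast
  obtain \<theta> \<theta>' where \<theta>: "smooth_on UNIV \<theta>" "\<And>t. (\<theta> has_real_derivative \<theta>' t) (at t)"
    "\<And>t. 0 \<le> \<theta> t" "\<And>t. \<theta> t \<le> 1" and \<theta>1: "\<And>t. t \<in> {\<delta>..b} \<Longrightarrow> \<theta> t = 1" and \<theta>0: "\<And>t. t \<notin> {\<delta>/2..T1} \<Longrightarrow> \<theta> t = 0"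
    and \<theta>'_le: "\<And>t. \<theta>' t \<le> C0 / (\<delta> - \<delta>/2)" and \<theta>'_neg: "\<And>t. t \<notin> {\<delta>/2..\<delta>} \<Longrightarrow> \<theta>' t \<le> 0"
  proof (rule plateau[OF st, of "\<delta>/2" \<delta> b T1])
    show "\<delta>/2 < \<delta>" "\<delta> \<le> b" "b < T1" using d T12 by auto
  qed (rule that)
  have \<theta>': "\<theta>' t \<le> 2 * C0 / \<delta>" for t using \<theta>'_le[of t] by (simp add: mult.commute)
  \<comment> \<open>The second cutoff makes the velocity itself globally smooth. It equals 1
    wherever \<open>\<theta>\<close> is nonzero, so the cut-off velocity agrees with the true one on
    the support of the test field.\<close>
  obtain \<eta> \<eta>' where \<eta>: "smooth_on UNIV \<eta>" "\<And>t. (\<eta> has_real_derivative \<eta>' t) (at t)"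
    and \<eta>1: "\<And>t. t \<in> {\<delta>/2..T1} \<Longrightarrow> \<eta> t = 1" and \<eta>0: "\<And>t. t \<notin> {\<delta>/4..T2} \<Longrightarrow> \<eta> t = 0"
  proof (rule plateau[OF st, of "\<delta>/4" "\<delta>/2" T1 T2])
    show "\<delta>/4 < \<delta>/2" "\<delta>/2 \<le> T1" "T1 < T2" using d T12 by auto
  qed (rule that)
  define W where "W i p = \<eta> (fst p) * w i p" for i p
  define U where "U = W 1"
  define V where "V = W 2"
  have smW: "smooth_on UNIV (W i)" for i
    unfolding W_def[abs_def] by (rule smooth_cutoff[of \<eta> "\<delta>/4" T2, OF \<eta>(1) \<eta>0 _ T12(3) smooth_w]) (use d in auto)
  have \<eta>out: "\<eta> t = 0" if "t \<notin> {0<..<T}" for t using \<eta>0[of t] that d T12 by auto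
  have sliceW: "(\<lambda>x. W i (t, x)) = (\<lambda>x. \<eta> t * (u t x $ i))" for t i by (simp add: W_def w_def)
  have smwi: "smooth_on UNIV (\<lambda>x. u t x $ i)" if "t \<in> {0<..<T}" for t i
    by (rule smooth_on_vec_nth[OF open_UNIV smooth_slice[OF that]])
  have xpW: "xper (W i)" for i unfolding xper_def
  proof
    show "periodic (\<lambda>x. W i (t, x))" for t
    proof (cases "t \<in> {0<..<T}")
      case True
      then show ?thesis using periodic_slice[OF True] unfolding sliceW periodic_def by simp
    next
      case False
      then show ?thesis using \<eta>out unfolding sliceW periodic_def by simp
    qed
  qed
  have ddW: "dd (0, v) (W i) (t, x) = dd v (\<lambda>x. W i (t, x)) x" for v i t x
    by (rule dd_slice[symmetric]) (rule smooth_on_differentiable[OF smW UNIV_I])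
  have div: "D1 U p + D2 V p = 0" for p
  proof (cases p)
    case (Pair t x)
    show ?thesis
    proof (cases "t \<in> {0<..<T}")
      case True
      have "D1 U p + D2 V p = \<eta> t * (dd (axis 1 1) (\<lambda>x. u t x $ 1) x + dd (axis 2 1) (\<lambda>x. u t x $ 2) x)"
        unfolding Pair U_def V_def ddW sliceW dd_cmult_fun[OF smwi[OF True]] by (simp add: distrib_left)
      also have "\<dots> = 0" using divergence_slice[OF True, of x] unfolding dd_slice_w[OF True] by simp
      finally show ?thesis .
    next
      case False
      have z: "dd v (\<lambda>x::real^2. 0::real) x = 0" for v by (rule dd_eqI[OF has_derivative_const])
      show ?thesis unfolding Pair U_def V_def ddW sliceW \<eta>out[OF False] mult_zero_left z by simp
    qed
  qed
  have U: "smooth_on UNIV U" "xper U" and V: "smooth_on UNIV V" "xper V"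
    unfolding U_def V_def by (rule smW xpW)+
  define \<omega> where "\<omega> = (\<lambda>p. D1 V p - D2 U p)"
  define P where "P = (\<lambda>p. - (\<theta> (fst p) * D2 (\<lambda>p. D1 V p - D2 U p) p))"
  define Q where "Q = (\<lambda>p. \<theta> (fst p) * D1 (\<lambda>p. D1 V p - D2 U p) p)"
  note sm = smooth_intros U(1) V(1) smooth_on_time[OF \<theta>(1)]
  note xp = xper_intros U(2) V(2)
  have \<omega>: "smooth_on UNIV \<omega>" unfolding \<omega>_def by (intro sm)
  have P: "smooth_on UNIV P" "xper P" and Q: "smooth_on UNIV Q" "xper Q"
    unfolding P_def Q_def by (intro sm xp)+
  define \<Phi> :: "real \<times> (real^2) \<Rightarrow> real^2" where "\<Phi> p = (\<chi> i. if i = 1 then P p else Q p)" for p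
  have \<Phi>1: "(\<lambda>p. \<Phi> p $ 1) = P" and \<Phi>2: "(\<lambda>p. \<Phi> p $ 2) = Q" unfolding \<Phi>_def by simp_all
  have \<Phi>: "smooth_on UNIV \<Phi>"
  proof (rule smooth_on_vec[OF open_UNIV])
    show "smooth_on UNIV (\<lambda>p. \<Phi> p $ i)" for i
      using exhaust_2[of i] P(1) Q(1) \<Phi>1 \<Phi>2 by auto
  qed
  have d\<Phi>1: "dd v \<Phi> p $ 1 = dd v P p" and d\<Phi>2: "dd v \<Phi> p $ 2 = dd v Q p" for v p
    using dd_vec_nth[OF smooth_on_differentiable[OF \<Phi> UNIV_I], of v p] unfolding \<Phi>1[symmetric] \<Phi>2[symmetric] by auto
  have dd\<Phi>1: "dd v (dd v \<Phi>) p $ 1 = dd v (dd v P) p" and dd\<Phi>2: "dd v (dd v \<Phi>) p $ 2 = dd v (dd v Q) p" for v p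
    using dd_vec_nth[OF smooth_on_differentiable[OF smooth_on_dd[OF \<Phi>] UNIV_I], of v v p]
    unfolding d\<Phi>1[symmetric, abs_def] d\<Phi>2[symmetric, abs_def] by auto
  define \<phi> where "\<phi> t x = \<Phi> (t, x)" for t x
  have p1: "pd j (\<phi> t) = (\<lambda>x. dd (0, axis j 1) \<Phi> (t, x))" for j t
    unfolding pd_eq_dd[abs_def] \<phi>_def
    by (rule ext, rule dd_slice[OF smooth_on_differentiable[OF \<Phi> UNIV_I]])
  have p2: "laplacian (\<phi> t) x = dd (0, axis 1 1) (dd (0, axis 1 1) \<Phi>) (t, x) + dd (0, axis 2 1) (dd (0, axis 2 1) \<Phi>) (t, x)" for t x
    unfolding laplacian_def p1 sum_2 pd_eq_dd
    by (simp only: dd_slice[OF smooth_on_differentiable[OF smooth_on_dd[OF \<Phi>] UNIV_I]])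
  have p3: "vector_derivative (\<lambda>s. \<phi> s x) (at t) = dd (1, 0) \<Phi> (t, x)" for t x
    unfolding \<phi>_def by (rule vector_derivative_time_slice[OF smooth_on_differentiable[OF \<Phi> UNIV_I]])
  have divPQ: "D1 P p + D2 Q p = 0" for p
  proof -
    have g: "smooth_on UNIV (\<lambda>p. D1 V p - D2 U p)" by (intro sm)
    have X: "D1 (\<lambda>p. \<theta> (fst p)) p = 0" "D2 (\<lambda>p. \<theta> (fst p)) p = 0"
      by (cases p; simp add: dd_time[OF \<theta>(2)])+
    have "D1 P p = - (\<theta> (fst p) * D1 (D2 (\<lambda>p. D1 V p - D2 U p)) p)"
      unfolding P_def by (simp add: dd_uminus_fun[OF smooth_on_mult[OF open_UNIV smooth_on_time[OF \<theta>(1)] smooth_on_dd[OF g]]]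
          dd_mult_fun[OF smooth_on_time[OF \<theta>(1)] smooth_on_dd[OF g]] X)
    moreover have "D2 Q p = \<theta> (fst p) * D2 (D1 (\<lambda>p. D1 V p - D2 U p)) p"
      unfolding Q_def by (simp add: dd_mult_fun[OF smooth_on_time[OF \<theta>(1)] smooth_on_dd[OF g]] X)
    ultimately show ?thesis using dd_commute[OF g, of "(0, axis 1 1)" "(0, axis 2 1)" p] by simp
  qed
  have tf: "test_field T \<phi>" unfolding test_field_def
  proof (intro conjI allI)
    show "smooth_on UNIV (\<lambda>(t, x). \<phi> t x)" using \<Phi> unfolding \<phi>_def by simp
    show "periodic (\<phi> t)" for t
      using P(2) Q(2) unfolding xper_def periodic_def \<phi>_def \<Phi>_def by (simp add: vec_eq_iff)
    show "divergence (\<phi> t) x = 0" for t x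
      unfolding divergence_def p1 sum_2 d\<Phi>1 d\<Phi>2 by (rule divPQ)
    show "\<exists>T'<T. \<forall>t\<ge>T'. \<forall>x. \<phi> t x = 0"
    proof (intro exI conjI allI impI)
      show "T2 < T" by (rule T12(3))
      show "\<phi> t x = 0" if "T2 \<le> t" for t x
        using \<theta>0[of t] that T12 unfolding \<phi>_def \<Phi>_def P_def Q_def by (simp add: vec_eq_iff)
    qed
  qed
  define R where "R = {p :: real \<times> (real^2). fst p \<notin> {\<delta>/2..T1}}"
  have "R = (- {\<delta>/2..T1}) \<times> UNIV" unfolding R_def by auto
  then have R: "open R" by (simp add: open_Times open_Compl)
  have PR: "P p = 0" and QR: "Q p = 0" if "p \<in> R" for p
    using \<theta>0[of "fst p"] that unfolding R_def P_def Q_def by auto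
  note dP = dd_zero_on_open[OF R _ PR] and dQ = dd_zero_on_open[OF R _ QR]
  note ddP = dd_zero_on_open[OF R _ dP] and ddQ = dd_zero_on_open[OF R _ dQ]
  define F where "F = (\<lambda>p. U p * D0 P p + V p * D0 Q p
        + (U p * (U p * D1 P p + V p * D1 Q p) + V p * (U p * D2 P p + V p * D2 Q p))
        + \<nu> * (U p * (D1 (D1 P) p + D2 (D2 P) p) + V p * (D1 (D1 Q) p + D2 (D2 Q) p)))"
  \<comment> \<open>Inside [\<delta>/2, T1] the cut-off velocity is the true one. Outside, the test
    field vanishes on an open set, so all of its derivatives vanish and both sides are zero whatever
    the velocity does.\<close>
  have F_eq: "u t x \<bullet> vector_derivative (\<lambda>s. \<phi> s x) (at t)
      + (\<Sum>j\<in>UNIV. u t x $ j * (u t x \<bullet> pd j (\<phi> t) x)) + \<nu> * (u t x \<bullet> laplacian (\<phi> t) x) = F (t, x)" for t x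
  proof (cases "t \<in> {\<delta>/2..T1}")
    case True
    then have "u t x $ 1 = U (t, x)" "u t x $ 2 = V (t, x)" unfolding U_def V_def W_def w_def by (simp_all add: \<eta>1)
    then show ?thesis unfolding p1 p2 p3 F_def sum_2 inner_vec2 vector_add_component d\<Phi>1 d\<Phi>2 dd\<Phi>1 dd\<Phi>2
      by simp
  next
    case False
    then have "(t, x) \<in> R" unfolding R_def by simp
    then show ?thesis unfolding p1 p2 p3 F_def sum_2 inner_vec2 vector_add_component d\<Phi>1 d\<Phi>2 dd\<Phi>1 dd\<Phi>2
      by (simp add: dP dQ ddP ddQ)
  qed
  have cF: "continuous_on UNIV F" unfolding F_def by (intro smooth_on_continuous sm P Q)
  \<comment> \<open>The initial datum drops out because the test field is zero near time zero; this
    is why no bound on the initial enstrophy enters.\<close>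
  have weak0: "stint T F = 0"
  proof -
    have "(0, x) \<in> R" for x unfolding R_def using d by simp
    then have "\<phi> 0 x = 0" for x unfolding \<phi>_def \<Phi>_def by (simp add: PR QR vec_eq_iff)
    then show ?thesis using weak_formulation[OF tf] unfolding F_eq stint_iterated(1)[OF cF] by simp
  qed
  have ens: "\<nu> * stint T (\<lambda>p. \<theta> (fst p) * ((D1 \<omega> p)\<^sup>2 + (D2 \<omega> p)\<^sup>2)) = 1/2 * stint T (\<lambda>p. \<theta>' (fst p) * (\<omega> p)\<^sup>2)"
    unfolding \<omega>_def
  proof (rule enstrophy_identity[where a="\<delta>/2" and b=T1, OF U V div \<theta>(1,2) _ _ \<theta>0])
    show "0 < \<delta> / 2" "T1 < T" using d T12 by auto
    show "stint T (\<lambda>p. U p * D0 (\<lambda>p. - (\<theta> (fst p) * D2 (\<lambda>p. D1 V p - D2 U p) p)) p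
        + V p * D0 (\<lambda>p. \<theta> (fst p) * D1 (\<lambda>p. D1 V p - D2 U p) p) p
        + (U p * (U p * D1 (\<lambda>p. - (\<theta> (fst p) * D2 (\<lambda>p. D1 V p - D2 U p) p)) p + V p * D1 (\<lambda>p. \<theta> (fst p) * D1 (\<lambda>p. D1 V p - D2 U p) p) p)
          + V p * (U p * D2 (\<lambda>p. - (\<theta> (fst p) * D2 (\<lambda>p. D1 V p - D2 U p) p)) p + V p * D2 (\<lambda>p. \<theta> (fst p) * D1 (\<lambda>p. D1 V p - D2 U p) p) p))
        + \<nu> * (U p * (D1 (D1 (\<lambda>p. - (\<theta> (fst p) * D2 (\<lambda>p. D1 V p - D2 U p) p))) p + D2 (D2 (\<lambda>p. - (\<theta> (fst p) * D2 (\<lambda>p. D1 V p - D2 U p) p))) p)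
          + V p * (D1 (D1 (\<lambda>p. \<theta> (fst p) * D1 (\<lambda>p. D1 V p - D2 U p) p)) p + D2 (D2 (\<lambda>p. \<theta> (fst p) * D1 (\<lambda>p. D1 V p - D2 U p) p)) p))) = 0"
      using weak0 unfolding F_def P_def Q_def .
  qed
  define G2 where "G2 = (\<lambda>p. \<theta> (fst p) * ((D1 (D1 U) p)\<^sup>2 + (D2 (D2 U) p)\<^sup>2 + (D1 (D1 V) p)\<^sup>2 + (D2 (D2 V) p)\<^sup>2))"
  have G2le: "stint T G2 \<le> stint T (\<lambda>p. \<theta> (fst p) * ((D1 \<omega> p)\<^sup>2 + (D2 \<omega> p)\<^sup>2))"
    unfolding G2_def \<omega>_def by (rule second_derivatives_le[OF U V div \<theta>(1,2,3)])
  have cG2: "continuous_on UNIV G2"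
    unfolding G2_def by (intro continuous_intros smooth_on_continuous sm)
  define g2 where "g2 t = (LINT x:cell|lborel. G2 (t, x))" for t
  have stG2: "stint T G2 = (LINT t:{0..<T}|lborel. g2 t)" and ig2: "set_integrable lborel {0..<T} g2"
    using stint_iterated[OF cG2, of T] unfolding g2_def by auto
  have sliceU: "(\<lambda>x. U (t, x)) = (\<lambda>x. u t x $ 1)" "(\<lambda>x. V (t, x)) = (\<lambda>x. u t x $ 2)" if "t \<in> {\<delta>/2..T1}" for t
    unfolding U_def V_def sliceW \<eta>1[OF that] by simp_all
  have slice1: "dd (0, v) F (t, x) = dd v (\<lambda>x. F (t, x)) x" if "smooth_on UNIV F" for F :: "real \<times> (real^2) \<Rightarrow> real" and v t x
    by (rule dd_slice[OF smooth_on_differentiable[OF that UNIV_I], symmetric])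
  have slice2: "dd (0, v) (dd (0, v) F) (t, x) = dd v (dd v (\<lambda>x. F (t, x))) x" if "smooth_on UNIV F" for F :: "real \<times> (real^2) \<Rightarrow> real" and v t x
    unfolding slice1[OF smooth_on_dd[OF that]] slice1[OF that] ..
  have g2_eq: "g2 t = second_energy (u t)" if t: "t \<in> {\<delta>..b}" for t
  proof -
    have t': "t \<in> {\<delta>/2..T1}" using t d T12 by auto
    show ?thesis unfolding g2_def G2_def second_energy_def slice2[OF U(1)] slice2[OF V(1)] sliceU[OF t']
      by (simp add: \<theta>1[OF t])
  qed
  have g20: "0 \<le> g2 t" for t unfolding g2_def G2_def
    by (rule set_integral_nonneg_real) (simp add: \<theta>(3))
  have sub: "{\<delta>..b} \<subseteq> {0..<T}" using d by auto
  have "set_integrable lborel {\<delta>..b} g2" by (rule set_integrable_subset[OF ig2 _ sub]) simp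
  then show int2: "set_integrable lborel {\<delta>..b} (\<lambda>t. second_energy (u t))"
    by (rule set_integrable_cong[THEN iffD1, rotated -1]) (auto simp: g2_eq)
  have "(LINT t:{\<delta>..b}|lborel. second_energy (u t)) = (LINT t:{\<delta>..b}|lborel. g2 t)"
    by (rule set_lebesgue_integral_cong) (auto simp: g2_eq)
  also have "\<dots> \<le> stint T G2" unfolding stG2 by (rule set_integral_mono_set[OF ig2 sub _ g20]) simp
  finally have left: "(LINT t:{\<delta>..b}|lborel. second_energy (u t)) \<le> stint T G2" .

  define H where "H = (\<lambda>p. \<theta>' (fst p) * (\<omega> p)\<^sup>2)"
  \<comment> \<open>\<open>plateau\<close> does not state continuity of the derivative; it follows
    from smoothness of \<open>\<theta>\<close> once the two are identified.\<close>
  have "\<theta>' = dd 1 \<theta>"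
  proof
    show "\<theta>' t = dd 1 \<theta> t" for t using dd_eqI[OF \<theta>(2)[unfolded has_field_derivative_def], of 1 t] by simp
  qed
  then have "smooth_on UNIV \<theta>'" using smooth_on_dd[OF \<theta>(1)] by simp
  then have cH: "continuous_on UNIV H"
    unfolding H_def by (intro continuous_intros smooth_on_continuous smooth_on_time \<omega>)
  have iA: "set_integrable lborel {0..<T} (\<lambda>t. indicator {\<delta>/2..\<delta>} t * (4 * C0 / \<delta> * grad_energy (u t)))"
  proof -
    have "set_integrable lborel {\<delta>/2..\<delta>} (\<lambda>t. 4 * C0 / \<delta> * grad_energy (u t))"
      by (intro set_integrable_mult_right integrable_grad_energy_subset) (use d in auto)
    moreover have "(\<lambda>t. indicator {\<delta>/2..\<delta>} t *\<^sub>R (4 * C0 / \<delta> * grad_energy (u t)))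
       = (\<lambda>t. indicator {0..<T} t *\<^sub>R (indicator {\<delta>/2..\<delta>} t * (4 * C0 / \<delta> * grad_energy (u t))))"
      using d by (auto simp: indicator_def fun_eq_iff)
    ultimately show ?thesis unfolding set_integrable_def by simp
  qed
  have "stint T H = (LINT t:{0..<T}|lborel. LINT x:cell|lborel. H (t, x))" by (rule stint_iterated(1)[OF cH])
  \<comment> \<open>Outside [\<delta>/2, \<delta>] the derivative of \<open>\<theta>\<close> is
    nonpositive and the contribution is discarded; inside, the slope bound and the comparison of
    vorticity with gradient apply.\<close>
  also have "\<dots> \<le> (LINT t:{0..<T}|lborel. indicator {\<delta>/2..\<delta>} t * (4 * C0 / \<delta> * grad_energy (u t)))"
  proof (rule set_integral_mono[OF stint_iterated(2)[OF cH] iA])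
    fix t assume "t \<in> {0..<T}"
    show "(LINT x:cell|lborel. H (t, x)) \<le> indicator {\<delta>/2..\<delta>} t * (4 * C0 / \<delta> * grad_energy (u t))"
    proof (cases "t \<in> {\<delta>/2..\<delta>}")
      case True
      then have t': "t \<in> {\<delta>/2..T1}" and t0: "t \<in> {0<..<T}" using d T12 by auto
      let ?g = "\<lambda>x. ((dd (axis 1 1) (\<lambda>x. u t x $ 1) x)\<^sup>2 + (dd (axis 2 1) (\<lambda>x. u t x $ 1) x)\<^sup>2)
        + ((dd (axis 1 1) (\<lambda>x. u t x $ 2) x)\<^sup>2 + (dd (axis 2 1) (\<lambda>x. u t x $ 2) x)\<^sup>2)"
      have "(LINT x:cell|lborel. H (t, x)) \<le> (LINT x:cell|lborel. 4 * C0 / \<delta> * ?g x)"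
      proof (rule set_integral_mono)
        show "set_integrable lborel cell (\<lambda>x. H (t, x))"
          by (rule set_integrable_cell_continuous, rule continuous_on_compose2[OF cH]) (auto intro!: continuous_intros)
        show "set_integrable lborel cell (\<lambda>x. 4 * C0 / \<delta> * ?g x)"
          by (intro set_integrable_cell_continuous continuous_intros smooth_on_continuous smooth_on_dd smwi t0)
        have ar: "2 * C0 / \<delta> * (2 * X) = 4 * C0 / \<delta> * X" for X :: real by simp
        fix x
        have "\<omega> (t, x) = dd (axis 1 1) (\<lambda>x. u t x $ 2) x - dd (axis 2 1) (\<lambda>x. u t x $ 1) x"
          unfolding \<omega>_def slice1[OF U(1)] slice1[OF V(1)] sliceU[OF t'] ..
        then have "(\<omega> (t, x))\<^sup>2 \<le> 2 * (dd (axis 1 1) (\<lambda>x. u t x $ 2) x)\<^sup>2 + 2 * (dd (axis 2 1) (\<lambda>x. u t x $ 1) x)\<^sup>2"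
          by (simp only: square_diff_le)
        also have "\<dots> \<le> 2 * ?g x" by simp
        finally have o: "(\<omega> (t, x))\<^sup>2 \<le> 2 * ?g x" .
        have "\<theta>' t * (\<omega> (t, x))\<^sup>2 \<le> 2 * C0 / \<delta> * (\<omega> (t, x))\<^sup>2" by (intro mult_right_mono \<theta>') simp
        also have "\<dots> \<le> 2 * C0 / \<delta> * (2 * ?g x)" using o C0 d by (intro mult_left_mono) auto
        also have "\<dots> = 4 * C0 / \<delta> * ?g x" by (rule ar)
        finally show "H (t, x) \<le> 4 * C0 / \<delta> * ?g x" unfolding H_def fst_conv .
      qed
      also have "\<dots> = 4 * C0 / \<delta> * grad_energy (u t)" unfolding grad_energy_def by (rule set_integral_mult_right)
      finally show ?thesis using True by simp
    next
      case False
      have "(LINT x:cell|lborel. H (t, x)) = \<theta>' t * (LINT x:cell|lborel. (\<omega> (t, x))\<^sup>2)"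
        unfolding H_def fst_conv by (rule set_integral_mult_right)
      also have "\<dots> \<le> 0" by (intro mult_nonpos_nonneg \<theta>'_neg[OF False] set_integral_nonneg_real) simp
      finally show ?thesis using False by simp
    qed
  qed
  also have "\<dots> = (LINT t:{\<delta>/2..\<delta>}|lborel. 4 * C0 / \<delta> * grad_energy (u t))"
    unfolding set_lebesgue_integral_def
    by (rule Bochner_Integration.integral_cong) (use d in \<open>auto simp: indicator_def\<close>)
  also have "\<dots> = 4 * C0 / \<delta> * (LINT t:{\<delta>/2..\<delta>}|lborel. grad_energy (u t))" by (rule set_integral_mult_right)
  also have "\<dots> \<le> 4 * C0 / \<delta> * (LINT t:{0<..b}|lborel. grad_energy (u t))"
    using C0 d by (intro mult_left_mono grad_energy_integral_mono) auto
  finally have right: "stint T H \<le> 4 * C0 / \<delta> * (LINT t:{0<..b}|lborel. grad_energy (u t))" .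
  have "\<nu> * (\<nu> * (LINT t:{\<delta>..b}|lborel. second_energy (u t))) \<le> \<nu> * (\<nu> * stint T (\<lambda>p. \<theta> (fst p) * ((D1 \<omega> p)\<^sup>2 + (D2 \<omega> p)\<^sup>2)))"
    using left G2le nu_pos by (intro mult_left_mono) auto
  also have "\<dots> = \<nu> * (1/2 * stint T H)" unfolding ens H_def ..
  also have "\<dots> \<le> \<nu> * (1/2 * (4 * C0 / \<delta> * (LINT t:{0<..b}|lborel. grad_energy (u t))))"
    using right nu_pos by (intro mult_left_mono) auto
  also have "\<dots> = 2 * C0 / \<delta> * (\<nu> * (LINT t:{0<..b}|lborel. grad_energy (u t)))" by simp
  also have "\<dots> \<le> 2 * C0 / \<delta> * (1/2 * (L2norm u0)\<^sup>2)"
    using C0 d by (intro mult_left_mono dissipation_le_initial) auto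
  finally show "\<nu>\<^sup>2 * (LINT t:{\<delta>..b}|lborel. second_energy (u t)) \<le> C0 / \<delta> * (L2norm u0)\<^sup>2"
    by (simp add: power2_eq_square mult.assoc)
qed

lemma late_dissipation_Icc:
  assumes st: "smooth_step s s' C0" and d: "0 < \<delta>" "\<delta> < b" "b < T" and \<epsilon>: "0 < \<epsilon>" "\<epsilon> \<le> 1/2"
  shows "\<nu> * (LINT t:{\<delta>..b}|lborel. grad_energy (u t))
    \<le> 64 / \<epsilon>\<^sup>2 * S2 T u (sqrt \<nu>) + 2 * \<epsilon>\<^sup>2 * (C0 / \<delta> * (L2norm u0)\<^sup>2)"
proof -
  have r: "sqrt \<nu> > 0" "(sqrt \<nu>)\<^sup>2 = \<nu>" using nu_pos by auto
  \<comment> \<open>With this length \<nu> / h^2 is 1 / \<epsilon>^2 and \<nu> h^2 is \<epsilon>^2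
    \<nu>^2, which matches \<open>second_energy_bound\<close>. The restriction
    \<open>\<epsilon> \<le> 1/2\<close> provides the condition \<open>h \<le> sqrt \<nu> / 2\<close>
    of the interpolation.\<close>
  define h where "h = \<epsilon> * sqrt \<nu>"
  have h: "h > 0" "h \<le> sqrt \<nu> / 2" "h\<^sup>2 = \<epsilon>\<^sup>2 * \<nu>"
    using \<epsilon> r mult_right_mono[OF \<epsilon>(2), of "sqrt \<nu>"] unfolding h_def by (auto simp: power_mult_distrib)
  have sub: "{\<delta>..b} \<subseteq> {0<..<T}" using d by auto
  have iZ: "set_integrable lborel {\<delta>..b} (\<lambda>t. grad_energy (u t))" by (rule integrable_grad_energy_subset[OF sub]) simp
  have iA: "set_integrable lborel {\<delta>..b} (average_increment (sqrt \<nu>))"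
    by (rule set_integrable_subset[OF integrable_average_increment[OF r(1)] _ sub]) simp
  note iQ = second_energy_bound[OF st d]
  have "\<nu> * (LINT t:{\<delta>..b}|lborel. grad_energy (u t)) = (LINT t:{\<delta>..b}|lborel. \<nu> * grad_energy (u t))"
    by (rule set_integral_mult_right[symmetric])
  also have "\<dots> \<le> (LINT t:{\<delta>..b}|lborel. 64 / \<epsilon>\<^sup>2 * average_increment (sqrt \<nu>) t + 2 * \<epsilon>\<^sup>2 * \<nu>\<^sup>2 * second_energy (u t))"
  proof (rule set_integral_mono)
    show "set_integrable lborel {\<delta>..b} (\<lambda>t. \<nu> * grad_energy (u t))" by (intro set_integrable_mult_right iZ)
    show "set_integrable lborel {\<delta>..b} (\<lambda>t. 64 / \<epsilon>\<^sup>2 * average_increment (sqrt \<nu>) t + 2 * \<epsilon>\<^sup>2 * \<nu>\<^sup>2 * second_energy (u t))"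
      by (intro set_integral_add(1) set_integrable_mult_right iA iQ)
    fix t assume "t \<in> {\<delta>..b}"
    then have t: "t \<in> {0<..<T}" using sub by blast
    have "grad_energy (u t) \<le> 64 / h\<^sup>2 * average_increment (sqrt \<nu>) t + 2 * h\<^sup>2 * second_energy (u t)"
      unfolding average_increment_def
      by (rule grad_energy_interpolation[OF smooth_slice[OF t] periodic_slice[OF t] r(1) h(1,2)])
    then have "\<nu> * grad_energy (u t) \<le> \<nu> * (64 / h\<^sup>2 * average_increment (sqrt \<nu>) t + 2 * h\<^sup>2 * second_energy (u t))"
      using nu_pos by (intro mult_left_mono) auto
    also have "\<dots> = 64 / \<epsilon>\<^sup>2 * average_increment (sqrt \<nu>) t + 2 * \<epsilon>\<^sup>2 * \<nu>\<^sup>2 * second_energy (u t)"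
      unfolding h(3) using nu_pos \<epsilon> by (simp add: field_simps power2_eq_square)
    finally show "\<nu> * grad_energy (u t) \<le> 64 / \<epsilon>\<^sup>2 * average_increment (sqrt \<nu>) t + 2 * \<epsilon>\<^sup>2 * \<nu>\<^sup>2 * second_energy (u t)" .
  qed
  also have "\<dots> = (LINT t:{\<delta>..b}|lborel. 64 / \<epsilon>\<^sup>2 * average_increment (sqrt \<nu>) t) + (LINT t:{\<delta>..b}|lborel. 2 * \<epsilon>\<^sup>2 * \<nu>\<^sup>2 * second_energy (u t))"
    by (intro set_integral_add(2) set_integrable_mult_right iA iQ)
  also have "\<dots> = 64 / \<epsilon>\<^sup>2 * (LINT t:{\<delta>..b}|lborel. average_increment (sqrt \<nu>) t) + 2 * \<epsilon>\<^sup>2 * (\<nu>\<^sup>2 * (LINT t:{\<delta>..b}|lborel. second_energy (u t)))"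
    by (simp only: set_integral_mult_right mult.assoc)
  also have "\<dots> \<le> 64 / \<epsilon>\<^sup>2 * S2 T u (sqrt \<nu>) + 2 * \<epsilon>\<^sup>2 * (C0 / \<delta> * (L2norm u0)\<^sup>2)"
  proof (intro add_mono mult_left_mono iQ(2))
    show "(LINT t:{\<delta>..b}|lborel. average_increment (sqrt \<nu>) t) \<le> S2 T u (sqrt \<nu>)"
      unfolding S2_eq by (rule set_integral_mono_set[OF integrable_average_increment[OF r(1)] sub _ average_increment_nonneg]) simp
  qed auto
  finally show ?thesis .
qed

text \<open>The late estimate holds on [\<delta>, b] with a bound that does not depend on b, so it
  survives the limit as b increases to \<open>T\<close>.\<close>

lemma total_dissipation_le:
  assumes st: "smooth_step s s' C0" and d: "0 < \<delta>" "\<delta> < T" and \<epsilon>: "0 < \<epsilon>" "\<epsilon> \<le> 1/2"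
  shows "\<nu> * (LINT t:{0..<T}|lborel. (L2norm (weak_gradient (u t)))\<^sup>2)
    \<le> \<nu> * (LINT t:{0<..\<delta>}|lborel. grad_energy (u t))
      + (64 / \<epsilon>\<^sup>2 * S2 T u (sqrt \<nu>) + 2 * \<epsilon>\<^sup>2 * (C0 / \<delta> * (L2norm u0)\<^sup>2))"
proof -
  let ?X = "64 / \<epsilon>\<^sup>2 * S2 T u (sqrt \<nu>) + 2 * \<epsilon>\<^sup>2 * (C0 / \<delta> * (L2norm u0)\<^sup>2)"
  \<comment> \<open>The denominator starts at 2 because the late estimate requires the right end to
    exceed \<open>\<delta>\<close> strictly; with 1 the first end would be \<open>\<delta>\<close>
    itself.\<close>
  define B where "B n = {0<..T - (T - \<delta>) / real (n + 2)}" for n :: nat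
  have Bb: "\<delta> < T - (T - \<delta>) / real (n + 2)" "T - (T - \<delta>) / real (n + 2) < T" for n :: nat
  proof -
    have "(T - \<delta>) / real (n + 2) < (T - \<delta>) / 1" by (rule divide_strict_left_mono) (use d in auto)
    then show "\<delta> < T - (T - \<delta>) / real (n + 2)" by simp
    show "T - (T - \<delta>) / real (n + 2) < T" using d by simp
  qed
  have B_le: "\<nu> * (LINT t:B n|lborel. grad_energy (u t)) \<le> \<nu> * (LINT t:{0<..\<delta>}|lborel. grad_energy (u t)) + ?X" for n
  proof -
    define b where "b = T - (T - \<delta>) / real (n + 2)"
    have b: "\<delta> < b" "b < T" using Bb unfolding b_def by auto
    have "B n = {0<..\<delta>} \<union> {\<delta><..b}" unfolding B_def b_def[symmetric] using d b by auto
    then have "(LINT t:B n|lborel. grad_energy (u t)) = (LINT t:{0<..\<delta>}|lborel. grad_energy (u t)) + (LINT t:{\<delta><..b}|lborel. grad_energy (u t))"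
      using d b by (simp only:) (rule set_integral_Un, auto intro!: integrable_grad_energy_subset)
    also have "\<dots> \<le> (LINT t:{0<..\<delta>}|lborel. grad_energy (u t)) + (LINT t:{\<delta>..b}|lborel. grad_energy (u t))"
      using d b by (intro add_left_mono grad_energy_integral_mono) auto
    finally have "\<nu> * (LINT t:B n|lborel. grad_energy (u t)) \<le> \<nu> * ((LINT t:{0<..\<delta>}|lborel. grad_energy (u t)) + (LINT t:{\<delta>..b}|lborel. grad_energy (u t)))"
      using nu_pos by (intro mult_left_mono) auto
    then show ?thesis using late_dissipation_Icc[OF st d(1) b \<epsilon>] by (simp add: distrib_left)
  qed
  have incB: "incseq B"
  proof (rule incseq_SucI)
    fix n
    have "(T - \<delta>) / real (Suc n + 2) \<le> (T - \<delta>) / real (n + 2)" by (rule divide_left_mono) (use d in auto)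
    then show "B n \<subseteq> B (Suc n)" unfolding B_def by auto
  qed
  have UB: "(\<Union>n. B n) = {0<..<T}"
  proof
    show "(\<Union>n. B n) \<subseteq> {0<..<T}"
    proof
      fix t assume "t \<in> (\<Union>n. B n)"
      then obtain n where "t \<in> B n" by blast
      then show "t \<in> {0<..<T}" using Bb(2)[of n] unfolding B_def by auto
    qed
    show "{0<..<T} \<subseteq> (\<Union>n. B n)"
    proof
      fix t assume t: "t \<in> {0<..<T}"
      obtain n :: nat where n: "(T - \<delta>) / (T - t) < real n" using reals_Archimedean2 by blast
      have "(T - \<delta>) < real n * (T - t)" using n t by (simp add: divide_less_eq)
      also have "\<dots> \<le> real (n + 2) * (T - t)" using t by (intro mult_right_mono) auto
      finally have "(T - \<delta>) / real (n + 2) \<le> T - t" by (simp add: divide_le_eq mult.commute)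
      then have "t \<in> B n" using t unfolding B_def by auto
      then show "t \<in> (\<Union>n. B n)" by blast
    qed
  qed
  have "(\<lambda>n. LINT t:B n|lborel. grad_energy (u t)) \<longlonglongrightarrow> (LINT t:(\<Union>n. B n)|lborel. grad_energy (u t))"
  proof (rule set_integral_cont_up)
    show "B n \<in> sets lborel" for n unfolding B_def by simp
    show "set_integrable lborel (\<Union>n. B n) (\<lambda>t. grad_energy (u t))" unfolding UB by (rule integrable_grad_energy)
  qed (rule incB)
  then have "(\<lambda>n. \<nu> * (LINT t:B n|lborel. grad_energy (u t))) \<longlonglongrightarrow> \<nu> * (LINT t:{0<..<T}|lborel. grad_energy (u t))"
    unfolding UB by (rule tendsto_mult_left)
  then show ?thesis unfolding dissipation_eq
    by (rule LIMSEQ_le_const2) (use B_le in blast)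
qed

end

section \<open>Compactness of the data\<close>

lemma openin_L2_ball:
  "f \<in> L2 \<Longrightarrow> e > 0 \<Longrightarrow> openin L2_topology {g \<in> L2. L2norm (\<lambda>x. g x - f x) < e}"
  unfolding L2_topology_def by (rule topology_generated_by_Basis) blast

lemma L2norm_zero: "L2norm (\<lambda>x. 0) = 0"
  unfolding L2norm_def by (simp add: set_lebesgue_integral_def)

lemma L2_dist_triangle:
  fixes f g h :: "real^2 \<Rightarrow> 'b::euclidean_space"
  assumes "f \<in> L2" "g \<in> L2" "h \<in> L2"
  shows "(LINT x:cell|lborel. (norm (f x - h x))\<^sup>2)
    \<le> 2 * (LINT x:cell|lborel. (norm (f x - g x))\<^sup>2) + 2 * (LINT x:cell|lborel. (norm (g x - h x))\<^sup>2)"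
proof -
  have i: "set_integrable lborel cell (\<lambda>x. (norm (p x - q x))\<^sup>2)" if "p \<in> L2" "q \<in> L2" for p q :: "real^2 \<Rightarrow> 'b"
  proof (rule set_integrable_bound)
    note [measurable] = L2_measurable[OF that(1)] L2_measurable[OF that(2)]
    show "set_integrable lborel cell (\<lambda>x. 2 * (norm (p x))\<^sup>2 + 2 * (norm (q x))\<^sup>2)"
      by (intro set_integral_add(1) set_integrable_mult_right L2_square_integrable that)
    show "set_borel_measurable lborel cell (\<lambda>x. (norm (p x - q x))\<^sup>2)" unfolding set_borel_measurable_def by measurable
    show "AE x in lborel. x \<in> cell \<longrightarrow> norm ((norm (p x - q x))\<^sup>2) \<le> norm (2 * (norm (p x))\<^sup>2 + 2 * (norm (q x))\<^sup>2)"
      using square_norm_sum_le[of "p _" "- q _"] by simp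
  qed
  have "(LINT x:cell|lborel. (norm (f x - h x))\<^sup>2) \<le> (LINT x:cell|lborel. 2 * (norm (f x - g x))\<^sup>2 + 2 * (norm (g x - h x))\<^sup>2)"
  proof (rule set_integral_mono[OF i[OF assms(1,3)]])
    show "set_integrable lborel cell (\<lambda>x. 2 * (norm (f x - g x))\<^sup>2 + 2 * (norm (g x - h x))\<^sup>2)"
      by (intro set_integral_add(1) set_integrable_mult_right i assms)
    show "(norm (f x - h x))\<^sup>2 \<le> 2 * (norm (f x - g x))\<^sup>2 + 2 * (norm (g x - h x))\<^sup>2" for x
      using square_norm_sum_le[of "f x - g x" "g x - h x"] by simp
  qed
  also have "\<dots> = (LINT x:cell|lborel. 2 * (norm (f x - g x))\<^sup>2) + (LINT x:cell|lborel. 2 * (norm (g x - h x))\<^sup>2)"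
    by (intro set_integral_add(2) set_integrable_mult_right i assms)
  finally show "(LINT x:cell|lborel. (norm (f x - h x))\<^sup>2)
    \<le> 2 * (LINT x:cell|lborel. (norm (f x - g x))\<^sup>2) + 2 * (LINT x:cell|lborel. (norm (g x - h x))\<^sup>2)" by simp
qed

text \<open>The centres are taken from \<open>F\<close>, because only there is divergence-freeness
  known later, whereas the covering balls are centred at arbitrary elements of \<open>L2\<close>. A
  member of \<open>F\<close> in each ball replaces its centre; with balls of squared radius
  \<open>r / 4\<close> the factors 2 of the squared triangle inequality give
  \<open>r\<close>.\<close>

lemma strongly_compact_finite_net:
  fixes F :: "(real^2 \<Rightarrow> 'b::euclidean_space) set"
  assumes F: "strongly_compact F" and "r > 0"
  obtains A where "finite A" "A \<subseteq> F" "\<And>f. f \<in> F \<Longrightarrow> \<exists>a\<in>A. (LINT x:cell|lborel. (norm (f x - a x))\<^sup>2) < r"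
proof -
  define \<rho> where "\<rho> = sqrt (r / 4)"
  have \<rho>: "\<rho> > 0" "\<rho>\<^sup>2 = r / 4" using assms(2) by (auto simp: \<rho>_def)
  define ball where "ball f = {g \<in> L2. L2norm (\<lambda>x. g x - f x) < \<rho>}" for f :: "real^2 \<Rightarrow> 'b"
  have FL: "F \<subseteq> L2" and comp: "compactin L2_topology (L2_topology closure_of F)"
    using F unfolding strongly_compact_def by auto
  have self: "f \<in> ball f" if "f \<in> L2" for f using that \<rho>(1) by (simp add: ball_def L2norm_zero)
  have op: "openin L2_topology (ball f)" if "f \<in> L2" for f
    unfolding ball_def by (rule openin_L2_ball[OF that \<rho>(1)])
  have top: "topspace (L2_topology :: (real^2 \<Rightarrow> 'b) topology) = L2"
  proof
    show "topspace (L2_topology :: (real^2 \<Rightarrow> 'b) topology) \<subseteq> L2"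
      unfolding L2_topology_def topology_generated_by_topspace by blast
    show "L2 \<subseteq> topspace (L2_topology :: (real^2 \<Rightarrow> 'b) topology)"
      using self op openin_subset by blast
  qed
  have "L2_topology closure_of F \<subseteq> \<Union> (ball ` L2)"
    using closure_of_subset_topspace[of L2_topology F] self unfolding top by blast
  moreover have "openin L2_topology U" if "U \<in> ball ` L2" for U using that op by blast
  ultimately obtain \<C> where \<C>: "finite \<C>" "\<C> \<subseteq> ball ` L2" "L2_topology closure_of F \<subseteq> \<Union>\<C>"
    using compactinD[OF comp, of "ball ` L2"] by blast
  have FC: "F \<subseteq> \<Union>\<C>" using closure_of_subset[of F L2_topology] FL \<C>(3) unfolding top by blast
  \<comment> \<open>Balls that miss \<open>F\<close> are left out of the final set, so the choice is
    made only where a member exists.\<close>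
  define pick where "pick U = (SOME f. f \<in> U \<inter> F)" for U :: "(real^2 \<Rightarrow> 'b) set"
  have pick: "pick U \<in> U \<inter> F" if "f \<in> U" "f \<in> F" for f U
    unfolding pick_def by (rule someI[of _ f]) (use that in auto)
  show ?thesis
  proof (rule that[of "pick ` {U \<in> \<C>. U \<inter> F \<noteq> {}}"])
    show "finite (pick ` {U \<in> \<C>. U \<inter> F \<noteq> {}})" using \<C>(1) by simp
    show "pick ` {U \<in> \<C>. U \<inter> F \<noteq> {}} \<subseteq> F" using pick by blast
    fix f assume f: "f \<in> F"
    then obtain U where U: "U \<in> \<C>" "f \<in> U" using FC by blast
    then obtain g where g: "g \<in> L2" "U = ball g" using \<C>(2) by blast
    have p: "pick U \<in> U" "pick U \<in> F" using pick[OF U(2) f] by auto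
    have d: "(LINT x:cell|lborel. (norm (h x - g x))\<^sup>2) < r / 4" if "h \<in> U" for h
    proof -
      have "L2norm (\<lambda>x. h x - g x) < \<rho>" using that unfolding g(2) ball_def by blast
      moreover have "0 \<le> L2norm (\<lambda>x. h x - g x)"
        unfolding L2norm_def by (intro real_sqrt_ge_zero set_integral_nonneg_real) simp
      ultimately have "(L2norm (\<lambda>x. h x - g x))\<^sup>2 < \<rho>\<^sup>2" by (intro power_strict_mono) auto
      then show ?thesis unfolding L2norm_sq \<rho>(2) .
    qed
    have "(LINT x:cell|lborel. (norm (f x - pick U x))\<^sup>2)
      \<le> 2 * (LINT x:cell|lborel. (norm (f x - g x))\<^sup>2) + 2 * (LINT x:cell|lborel. (norm (g x - pick U x))\<^sup>2)"
      using f p FL g by (intro L2_dist_triangle) auto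
    moreover have "(LINT x:cell|lborel. (norm (g x - pick U x))\<^sup>2) < r / 4"
      using d[OF p(1)] by (simp add: norm_minus_commute)
    ultimately have "(LINT x:cell|lborel. (norm (f x - pick U x))\<^sup>2) < r" using d[OF U(2)] by linarith
    moreover have "U \<in> {U \<in> \<C>. U \<inter> F \<noteq> {}}" using U f by blast
    ultimately show "\<exists>a\<in>pick ` {U \<in> \<C>. U \<inter> F \<noteq> {}}. (LINT x:cell|lborel. (norm (f x - a x))\<^sup>2) < r" by blast
  qed
qed

text \<open>Smooth approximations of individual data have derivative bounds that may blow up along
  the family. Passing to a finite net first leaves finitely many of them, so one constant serves all
  data; this is where compactness enters.\<close>

lemma smooth_net:
  fixes F :: "(real^2 \<Rightarrow> real^2) set"
  assumes F: "strongly_compact F" and df: "\<And>f. f \<in> F \<Longrightarrow> divergence_free f" and "r > 0"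
  obtains C B where "0 \<le> C" "0 \<le> B" "\<And>f. f \<in> F \<Longrightarrow> (L2norm f)\<^sup>2 \<le> B"
    "\<And>f. f \<in> F \<Longrightarrow> \<exists>v. smooth_on UNIV v \<and> periodic v \<and> (\<forall>x. divergence v x = 0) \<and>
       (\<forall>j x. norm (pd j v x) \<le> C / 2) \<and> (\<forall>x. norm (laplacian v x) \<le> C) \<and>
       (LINT x:cell|lborel. (norm (f x - v x))\<^sup>2) \<le> r"
proof -
  have FL: "F \<subseteq> L2" using F unfolding strongly_compact_def by blast
  obtain A where A: "finite A" "A \<subseteq> F" and net: "\<And>f. f \<in> F \<Longrightarrow> \<exists>a\<in>A. (LINT x:cell|lborel. (norm (f x - a x))\<^sup>2) < r / 4"
    using strongly_compact_finite_net[OF F, of "r / 4"] assms(3) by auto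
  define G where "G a v C \<longleftrightarrow> 0 \<le> C \<and> smooth_on UNIV v \<and> periodic v \<and> (\<forall>x. divergence v x = 0) \<and>
       (\<forall>j x. norm (pd j v x) \<le> C / 2) \<and> (\<forall>x. norm (laplacian v x) \<le> C) \<and>
       (LINT x:cell|lborel. (norm (a x - v x))\<^sup>2) < r / 4" for a v C
  have "\<exists>v C. G a v C" if "a \<in> A" for a
  proof -
    have "a \<in> L2" "divergence_free a" using that A FL df by auto
    then obtain v where v: "smooth_on UNIV v" "periodic v" "\<And>x. divergence v x = 0" "(LINT x:cell|lborel. (norm (a x - v x))\<^sup>2) < r / 4"
      using divergence_free_approx[of a "r / 4"] assms(3) by auto
    have c: "continuous_on UNIV (pd j v)" "periodic (pd j v)" for j
      unfolding pd_eq_dd[abs_def] by (rule smooth_on_continuous[OF smooth_on_dd[OF v(1)]], rule periodic_dd[OF v(2)])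
    have cl: "continuous_on UNIV (laplacian v)" "periodic (laplacian v)"
    proof -
      show "continuous_on UNIV (laplacian v)" unfolding pd_eq_dd[abs_def] laplacian_def[abs_def]
        by (intro continuous_on_sum smooth_on_continuous[OF smooth_on_dd[OF smooth_on_dd[OF v(1)]]])
      show "periodic (laplacian v)" using periodic_dd[OF periodic_dd[OF v(2)]]
        unfolding pd_eq_dd[abs_def] laplacian_def[abs_def] sum_2 periodic_def by simp
    qed
    obtain C1 where C1: "\<And>x. norm (pd 1 v x) \<le> C1" using continuous_periodic_bounded[OF c(1) c(2)] by blast
    obtain C2 where C2: "\<And>x. norm (pd 2 v x) \<le> C2" using continuous_periodic_bounded[OF c(1) c(2)] by blast
    obtain C3 where C3: "\<And>x. norm (laplacian v x) \<le> C3" using continuous_periodic_bounded[OF cl] by blast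
    \<comment> \<open>The doubled terms allow for the bound \<open>C / 2\<close> on the first
      derivatives, the last term for the bound on the Laplacian.\<close>
    define C where "C = 2 * \<bar>C1\<bar> + 2 * \<bar>C2\<bar> + \<bar>C3\<bar>"
    have "norm (pd j v x) \<le> C / 2" for j x
      using exhaust_2[of j] C1[of x] C2[of x] unfolding C_def by auto
    moreover have "norm (laplacian v x) \<le> C" for x using C3[of x] unfolding C_def by linarith
    moreover have "0 \<le> C" unfolding C_def by simp
    ultimately show ?thesis using v unfolding G_def by blast
  qed
  then obtain v C where "\<And>a. a \<in> A \<Longrightarrow> G a (v a) (C a)" by metis
  then have vC: "a \<in> A \<Longrightarrow> 0 \<le> C a \<and> smooth_on UNIV (v a) \<and> periodic (v a) \<and> (\<forall>x. divergence (v a) x = 0) \<and>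
       (\<forall>j x. norm (pd j (v a) x) \<le> C a / 2) \<and> (\<forall>x. norm (laplacian (v a) x) \<le> C a) \<and>
       (LINT x:cell|lborel. (norm (a x - v a x))\<^sup>2) < r / 4" for a
    unfolding G_def by blast
  define C' where "C' = (\<Sum>a\<in>A. C a)"
  have C': "C a \<le> C'" if "a \<in> A" for a
    unfolding C'_def by (rule member_le_sum[OF that _ A(1)]) (use vC in blast)
  \<comment> \<open>The squared triangle inequality from \<open>f\<close> to zero through a point of
    the net, with the sum over the net in place of its maximum.\<close>
  define B where "B = 2 * (r / 4) + 2 * (\<Sum>a\<in>A. (L2norm a)\<^sup>2)"
  show ?thesis
  proof (rule that[of C' B])
    show "0 \<le> C'" unfolding C'_def by (rule sum_nonneg) (use vC in blast)
    show "0 \<le> B" unfolding B_def using assms(3) by (simp add: sum_nonneg)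
    fix f assume f: "f \<in> F"
    then obtain a where a: "a \<in> A" "(LINT x:cell|lborel. (norm (f x - a x))\<^sup>2) < r / 4" using net by blast
    have fL: "f \<in> L2" and aL: "a \<in> L2" using f a A FL by auto
    have zL: "(\<lambda>x. 0 :: real^2) \<in> L2" by (rule L2_continuous) (auto simp: periodic_def)
    have "(L2norm a)\<^sup>2 \<le> (\<Sum>a\<in>A. (L2norm a)\<^sup>2)" by (rule member_le_sum[OF a(1) _ A(1)]) simp
    then show "(L2norm f)\<^sup>2 \<le> B"
      using L2_dist_triangle[OF fL aL zL] a(2) unfolding B_def L2norm_sq by simp
    have vL: "v a \<in> L2" using vC[OF a(1)] by (intro L2_continuous smooth_on_continuous) auto
    have "(LINT x:cell|lborel. (norm (f x - v a x))\<^sup>2) \<le> r"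
      using L2_dist_triangle[OF fL aL vL] a(2) vC[OF a(1)] by linarith
    moreover have "norm (pd j (v a) x) \<le> C' / 2" "norm (laplacian (v a) x) \<le> C'" for j x
    proof -
      have "norm (pd j (v a) x) \<le> C a / 2" "norm (laplacian (v a) x) \<le> C a" using vC[OF a(1)] by blast+
      then show "norm (pd j (v a) x) \<le> C' / 2" "norm (laplacian (v a) x) \<le> C'" using C'[OF a(1)] by linarith+
    qed
    ultimately show "\<exists>v. smooth_on UNIV v \<and> periodic v \<and> (\<forall>x. divergence v x = 0) \<and>
       (\<forall>j x. norm (pd j v x) \<le> C' / 2) \<and> (\<forall>x. norm (laplacian v x) \<le> C') \<and>
       (LINT x:cell|lborel. (norm (f x - v x))\<^sup>2) \<le> r" using vC[OF a(1)] by blast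
  qed
qed

section \<open>Choice of parameters and passage to the inviscid limit\<close>

theorem theorem1p6:
  fixes T :: real
    and N :: "real set"
    and u0 :: "real \<Rightarrow> real^2 \<Rightarrow> real^2"
    and u :: "real \<Rightarrow> real \<Rightarrow> real^2 \<Rightarrow> real^2"
  assumes "T > 0"
    and "N \<subseteq> {0<..}" and "0 islimpt N"
    and "\<And>\<nu>. \<nu> \<in> N \<Longrightarrow> u0 \<nu> \<in> L2 \<and> divergence_free (u0 \<nu>)"
    and "strongly_compact (u0 ` N)"
    and "\<And>\<nu>. \<nu> \<in> N \<Longrightarrow> leray_hopf T \<nu> (u0 \<nu>) (u \<nu>)"
  shows "((\<lambda>\<nu>. S2 T (u \<nu>) (sqrt \<nu>)) \<longlongrightarrow> 0) (at 0 within N) \<longleftrightarrow>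
    ((\<lambda>\<nu>. \<nu> * (LINT t:{0..<T}|lborel. (L2norm (weak_gradient (u \<nu> t)))\<^sup>2)) \<longlongrightarrow> 0) (at 0 within N)"
proof -
  let ?S = "\<lambda>\<nu>. S2 T (u \<nu>) (sqrt \<nu>)"
  let ?D = "\<lambda>\<nu>. \<nu> * (LINT t:{0..<T}|lborel. (L2norm (weak_gradient (u \<nu> t)))\<^sup>2)"
  have flow: "leray_hopf_flow T \<nu> (u0 \<nu>) (u \<nu>)" if "\<nu> \<in> N" for \<nu>
    by unfold_locales (use assms that in auto)
  have inN: "eventually (\<lambda>\<nu>. \<nu> \<in> N) (at 0 within N)" by (simp add: eventually_at_filter)
  have S0: "0 \<le> ?S \<nu>" and SD: "?S \<nu> \<le> ?D \<nu>" if "\<nu> \<in> N" for \<nu>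
    using leray_hopf_flow.S2_nonneg[OF flow[OF that]] leray_hopf_flow.S2_le_dissipation[OF flow[OF that]] by auto
  show ?thesis
  proof
    assume D: "(?D \<longlongrightarrow> 0) (at 0 within N)"
    show "(?S \<longlongrightarrow> 0) (at 0 within N)"
    proof (rule tendsto_sandwich[OF _ _ tendsto_const D])
      show "eventually (\<lambda>\<nu>. 0 \<le> ?S \<nu>) (at 0 within N)" using inN by eventually_elim (rule S0)
      show "eventually (\<lambda>\<nu>. ?S \<nu> \<le> ?D \<nu>) (at 0 within N)" using inN by eventually_elim (rule SD)
    qed
  next
    assume S: "(?S \<longlongrightarrow> 0) (at 0 within N)"
    show "(?D \<longlongrightarrow> 0) (at 0 within N)"
    proof (rule tendstoI)
      fix e :: real assume e: "e > 0"
      \<comment> \<open>The short-time part contributes at most \<open>2 * r\<close>, the remainder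
        of the interpolation \<open>r\<close>, and the increments less than \<open>r\<close>; a
        fifth of \<open>e\<close> leaves a margin.\<close>
      define r where "r = e / 5"
      have r: "r > 0" using e by (simp add: r_def)
      obtain C B where C: "0 \<le> C" and B: "0 \<le> B" and bound: "\<And>f. f \<in> u0 ` N \<Longrightarrow> (L2norm f)\<^sup>2 \<le> B" and
        net: "\<And>f. f \<in> u0 ` N \<Longrightarrow> \<exists>v. smooth_on UNIV v \<and> periodic v \<and> (\<forall>x. divergence v x = 0) \<and>
           (\<forall>j x. norm (pd j v x) \<le> C / 2) \<and> (\<forall>x. norm (laplacian v x) \<le> C) \<and>
           (LINT x:cell|lborel. (norm (f x - v x))\<^sup>2) \<le> r"
      proof -
        have "divergence_free f" if "f \<in> u0 ` N" for f using that assms(4) by blast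
        from smooth_net[OF assms(5) this r] that show thesis by blast
      qed
      obtain s s' C0 where st: "smooth_step s s' C0" by (rule smooth_step_exists)
      have C0: "C0 > 0" using st unfolding smooth_step_def by blast
      define M where "M = 2 * C * (1 + B)"
      have M: "0 \<le> M" unfolding M_def using B C by simp
      \<comment> \<open>\<open>T / 3\<close> gives \<open>2 * \<delta> < T\<close>, and the other
        entry gives \<open>2 * \<delta> * M \<le> r\<close>, where \<open>+ 1\<close> guards against
        \<open>M = 0\<close>.\<close>
      define \<delta> where "\<delta> = min (T / 3) (r / (2 * (M + 1)))"
      have \<delta>: "0 < \<delta>" "2 * \<delta> < T" unfolding \<delta>_def using assms(1) r M by auto
      have \<delta>M: "2 * \<delta> * M \<le> r"
      proof -
        have "\<delta> \<le> r / (2 * (M + 1))" unfolding \<delta>_def by simp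
        then have "2 * \<delta> * (M + 1) \<le> r" using M by (simp add: le_divide_eq mult_ac)
        then show ?thesis using \<delta>(1) by (simp add: distrib_left)
      qed
      define K where "K = 2 * (C0 / \<delta> * B)"
      have K: "0 \<le> K" unfolding K_def using C0 \<delta> B by simp
      \<comment> \<open>Depends on \<open>\<delta>\<close> through \<open>K\<close>, which collects
        the factor \<open>1 / \<delta>\<close> of the late estimate; the square root makes the
        remainder at most \<open>r\<close>.\<close>
      define \<epsilon> where "\<epsilon> = min (1/2) (sqrt (r / (K + 1)))"
      have \<epsilon>: "0 < \<epsilon>" "\<epsilon> \<le> 1/2" unfolding \<epsilon>_def using r K by auto
      have \<epsilon>K: "\<epsilon>\<^sup>2 * K \<le> r"
      proof -
        have "\<epsilon>\<^sup>2 \<le> (sqrt (r / (K + 1)))\<^sup>2" using \<epsilon> by (intro power_mono) (auto simp: \<epsilon>_def)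
        also have "\<dots> = r / (K + 1)" using r K by simp
        finally have "\<epsilon>\<^sup>2 * (K + 1) \<le> r" using K by (simp add: le_divide_eq)
        moreover have "\<epsilon>\<^sup>2 * K \<le> \<epsilon>\<^sup>2 * (K + 1)" by (intro mult_left_mono) auto
        ultimately show ?thesis by linarith
      qed
      \<comment> \<open>All parameters are fixed by now, so the coefficient of the increments is a
        constant as the viscosity tends to zero.\<close>
      have "((\<lambda>\<nu>. 64 / \<epsilon>\<^sup>2 * ?S \<nu>) \<longlongrightarrow> 64 / \<epsilon>\<^sup>2 * 0) (at 0 within N)" by (intro tendsto_intros S)
      then have "eventually (\<lambda>\<nu>. 64 / \<epsilon>\<^sup>2 * ?S \<nu> < r) (at 0 within N)"
        by (rule order_tendstoD(2)) (use r in simp)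
      moreover have "eventually (\<lambda>\<nu>. \<nu> < 1) (at 0 within N)"
        by (rule order_tendstoD(2)[of _ 0]) (auto intro: tendsto_ident_at)
      ultimately show "eventually (\<lambda>\<nu>. dist (?D \<nu>) 0 < e) (at 0 within N)"
        using inN
      proof eventually_elim
        case (elim \<nu>)
        then have \<nu>: "\<nu> \<in> N" "\<nu> < 1" and small: "64 / \<epsilon>\<^sup>2 * ?S \<nu> < r" by auto
        interpret leray_hopf_flow T \<nu> "u0 \<nu>" "u \<nu>" by (rule flow[OF \<nu>(1)])
        have im: "u0 \<nu> \<in> u0 ` N" using \<nu> by blast
        obtain v where v: "smooth_on UNIV v" "periodic v" "\<And>x. divergence v x = 0"
          "\<And>j x. norm (pd j v x) \<le> C / 2" "\<And>x. norm (laplacian v x) \<le> C"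
          "(LINT x:cell|lborel. (norm (u0 \<nu> x - v x))\<^sup>2) \<le> r"
          using net[OF im] by blast
        have E: "(L2norm (u0 \<nu>))\<^sup>2 \<le> B" by (rule bound[OF im])
        have "2 * \<delta> * (2 * C * (1 + (L2norm (u0 \<nu>))\<^sup>2)) \<le> 2 * \<delta> * M"
          unfolding M_def using E C \<delta> by (intro mult_left_mono add_left_mono) auto
        then have short: "\<nu> * (LINT t:{0<..\<delta>}|lborel. grad_energy (u \<nu> t)) \<le> 2 * r"
          using short_time_dissipation[OF st less_imp_le[OF \<nu>(2)] v(1,2,3,4,5) C \<delta>] v(6) \<delta>M r by linarith
        have "2 * \<epsilon>\<^sup>2 * (C0 / \<delta> * (L2norm (u0 \<nu>))\<^sup>2) \<le> 2 * \<epsilon>\<^sup>2 * (C0 / \<delta> * B)"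
          using E C0 \<delta> by (intro mult_left_mono) auto
        then have late: "2 * \<epsilon>\<^sup>2 * (C0 / \<delta> * (L2norm (u0 \<nu>))\<^sup>2) \<le> r"
          using \<epsilon>K unfolding K_def by (simp add: mult_ac)
        have "\<delta> < T" using \<delta> by linarith
        from total_dissipation_le[OF st \<delta>(1) this \<epsilon>] short late small
        have "?D \<nu> < 5 * r" using r by linarith
        moreover have "0 \<le> ?D \<nu>" using S0[OF \<nu>(1)] SD[OF \<nu>(1)] by linarith
        ultimately show ?case by (simp add: r_def)
      qed
    qed
  qed
qed

end
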